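(* Let $\pi(x)=\sum_{k=1}^M\alpha_kq(x;\mu_k,\Sigma_k)$ be a mixture of $M$ Gaussians on $\mathbb{R}^d$, where $\alpha_k>0$, $\sum_k\alpha_k=1$, and $q(x;\mu_k,\Sigma_k)$ is the density of $\mathcal{N}(\mu_k,\Sigma_k)$. Let $0<\beta_1<\dots<\beta_n=1$, and let $\pi_i$ be the probability density proportional to $\tilde\pi_i(x)=\pi(x)^{\beta_i}$. Then: 1. (Density ratio bound) For $2\le i\le n$, with $\Delta\beta=\beta_i-\beta_{i-1}$, $\frac{d\pi_i}{d\pi_{i-1}}\le\gamma_i$, where $$\gamma_i=\frac{1}{\min_k\alpha_k}\left(\frac{\beta_i}{\beta_{i-1}}\right)^{d/2}\left(\frac{\max_k|\Sigma_k|}{\min_k|\Sigma_k|}\right)^{\Delta\beta/2}.$$ 2. (Local log-Sobolev constants) Each $\pi_i$ is expressible as a mixture $\pi_i=\sum_{k=1}^Mw_k^{(i)}\nu_k^{(i)}$, where $\nu_k^{(i)}$ is the probability density with $$\nu_k^{(i)}(x)\propto\tilde\nu_k^{(i)}(x):=\frac{\pi(x)^{\beta_i}}{\sum_{j=1}^M\alpha_jq(x;\mu_j,\Sigma_j)^{\beta_i}}\,q(x;\mu_k,\Sigma_k)^{\beta_i},\qquad w_k^{(i)}=\frac{\alpha_k\int\tilde\nu_k^{(i)}}{\sum_j\alpha_j\int\tilde\nu_j^{(i)}},$$ and each $\nu_k^{(i)}$ satisfies a log-Sobolev inequality $\operatorname{Ent}_{\nu_k^{(i)}}[f^2]\le C_{\mathrm{LSI}}(\nu_k^{(i)})\,\mathscr{E}_{\nu_k^{(i)}}(f,f)$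 for all $f$, with $$C_{\mathrm{LSI}}(\nu_k^{(i)})\le\frac{1}{\min_j\alpha_j}\cdot\frac{\lambda_{\max}(\Sigma_k)}{\beta_i}.$$ 3. (Weight lower bound) $$\min_{i,k}w_k^{(i)}\ge\min_{i,k}\frac{\int q(x;\mu_k,\Sigma_k)^{\beta_i}dx}{\sum_j\alpha_j\int q(x;\mu_j,\Sigma_j)^{\beta_i}dx}\cdot\min_k\alpha_k^2 .$$ If $\Sigma_j=\Sigma_k$ for all $j,k$, this reduces to $\min_{i,k}w_k^{(i)}\ge\min_k\alpha_k^2$.
   Context: $|\Sigma|$ denotes the determinant and $\lambda_{\max}(\Sigma)$ the largest eigenvalue of the (positive definite) covariance matrix $\Sigma$. $\mathscr{E}_\nu(f,f)=\int\|\nabla f\|^2\,d\nu$ is the Dirichlet form of Langevin diffusion with stationary distribution $\nu$, and $\operatorname{Ent}_\nu[h]=\int h\log h\,d\nu-\int h\,d\nu\,\log\int h\,d\nu$ for $h\ge0$.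
   Formalization: The bound on C_LSI is proved with an extra factor 2, i.e. C_LSI ≤ 2·(1/min α)·λ_max(Σ_k)/β_i; as printed, with Ent[f²] ≤ C·E(f,f), it fails for a single standard Gaussian (f = e^x gives C ≥ 2 > 1). Test functions f are C¹ with f and ∇f square integrable. *)

theory Defs
  imports "HOL-Probability.Probability"
begin

definition pos_def_matrix :: "real^'n^'n \<Rightarrow> bool" where
  "pos_def_matrix A \<longleftrightarrow> transpose A = A \<and> (\<forall>v. v \<noteq> 0 \<longrightarrow> 0 < v \<bullet> (A *v v))"

definition eigenvalues :: "real^'n^'n \<Rightarrow> real set" where
  "eigenvalues A = {l. \<exists>v. v \<noteq> 0 \<and> A *v v = l *\<^sub>R v}"

definition lambda_max :: "real^'n^'n \<Rightarrow> real" where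
  "lambda_max A = Max (eigenvalues A)"

definition gauss :: "real^'n \<Rightarrow> real^'n^'n \<Rightarrow> real^'n \<Rightarrow> real" where
  "gauss m S x =
     exp (- ((x - m) \<bullet> (matrix_inv S *v (x - m))) / 2)
       / sqrt ((2 * pi) ^ CARD('n) * det S)"

definition gauss_mix ::
  "nat \<Rightarrow> (nat \<Rightarrow> real) \<Rightarrow> (nat \<Rightarrow> real^'n) \<Rightarrow> (nat \<Rightarrow> real^'n^'n) \<Rightarrow> real^'n \<Rightarrow> real" where
  "gauss_mix M \<alpha> m S x = (\<Sum>k=1..M. \<alpha> k * gauss (m k) (S k) x)"

definition normalize_fun :: "(real^'n \<Rightarrow> real) \<Rightarrow> real^'n \<Rightarrow> real" where
  "normalize_fun g x = g x / (LINT y|lborel. g y)"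

definition law :: "(real^'n \<Rightarrow> real) \<Rightarrow> (real^'n) measure" where
  "law p = density lborel (\<lambda>x. ennreal (p x))"

definition tempered ::
  "nat \<Rightarrow> (nat \<Rightarrow> real) \<Rightarrow> (nat \<Rightarrow> real^'n) \<Rightarrow> (nat \<Rightarrow> real^'n^'n) \<Rightarrow> real \<Rightarrow> real^'n \<Rightarrow> real" where
  "tempered M \<alpha> m S b = normalize_fun (\<lambda>x. gauss_mix M \<alpha> m S x powr b)"

definition comp_unnorm ::
  "nat \<Rightarrow> (nat \<Rightarrow> real) \<Rightarrow> (nat \<Rightarrow> real^'n) \<Rightarrow> (nat \<Rightarrow> real^'n^'n) \<Rightarrow> real \<Rightarrow> nat \<Rightarrow> real^'n \<Rightarrow> real" where
  "comp_unnorm M \<alpha> m S b k x =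
     gauss_mix M \<alpha> m S x powr b / (\<Sum>j=1..M. \<alpha> j * gauss (m j) (S j) x powr b)
       * gauss (m k) (S k) x powr b"

definition comp_density ::
  "nat \<Rightarrow> (nat \<Rightarrow> real) \<Rightarrow> (nat \<Rightarrow> real^'n) \<Rightarrow> (nat \<Rightarrow> real^'n^'n) \<Rightarrow> real \<Rightarrow> nat \<Rightarrow> real^'n \<Rightarrow> real" where
  "comp_density M \<alpha> m S b k = normalize_fun (comp_unnorm M \<alpha> m S b k)"

definition comp_weight ::
  "nat \<Rightarrow> (nat \<Rightarrow> real) \<Rightarrow> (nat \<Rightarrow> real^'n) \<Rightarrow> (nat \<Rightarrow> real^'n^'n) \<Rightarrow> real \<Rightarrow> nat \<Rightarrow> real" where
  "comp_weight M \<alpha> m S b k =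
     \<alpha> k * (LINT x|lborel. comp_unnorm M \<alpha> m S b k x)
       / (\<Sum>j=1..M. \<alpha> j * (LINT x|lborel. comp_unnorm M \<alpha> m S b j x))"

definition ratio_bound ::
  "nat \<Rightarrow> (nat \<Rightarrow> real) \<Rightarrow> (nat \<Rightarrow> real^'n^'n) \<Rightarrow> real \<Rightarrow> real \<Rightarrow> real" where
  "ratio_bound M \<alpha> S b b' =
     1 / (MIN k\<in>{1..M}. \<alpha> k) * (b / b') powr (real CARD('n) / 2)
       * ((MAX k\<in>{1..M}. det (S k)) / (MIN k\<in>{1..M}. det (S k))) powr ((b - b') / 2)"

(* ln 0 = 0 in the library, so h * ln h follows the convention 0 log 0 = 0. *)
definition Ent :: "'a measure \<Rightarrow> ('a \<Rightarrow> real) \<Rightarrow> real" where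
  "Ent N h = (LINT x|N. h x * ln (h x)) - (LINT x|N. h x) * ln (LINT x|N. h x)"

definition grad :: "('a::real_inner \<Rightarrow> real) \<Rightarrow> 'a \<Rightarrow> 'a" where
  "grad f x = (THE D. GDERIV f x :> D)"

definition dirichlet_form :: "'a::real_inner measure \<Rightarrow> ('a \<Rightarrow> real) \<Rightarrow> real" where
  "dirichlet_form N f = (LINT x|N. (norm (grad f x))\<^sup>2)"

(* C^1 functions for which both sides of the inequality make sense: f and grad f are
   square integrable. *)
definition lsi_test :: "'a::real_inner measure \<Rightarrow> ('a \<Rightarrow> real) \<Rightarrow> bool" where
  "lsi_test N f \<longleftrightarrow> (\<forall>x. f differentiable (at x)) \<and> continuous_on UNIV (grad f)
     \<and> integrable N (\<lambda>x. (f x)\<^sup>2) \<and> integrable N (\<lambda>x. (norm (grad f x))\<^sup>2)"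

(* The Bochner integral of a non-integrable function is 0, so finiteness of the entropy is
   stated as part of the inequality. *)
definition log_sobolev :: "'a::real_inner measure \<Rightarrow> real \<Rightarrow> bool" where
  "log_sobolev N C \<longleftrightarrow> (\<forall>f. lsi_test N f \<longrightarrow>
     integrable N (\<lambda>x. (f x)\<^sup>2 * ln ((f x)\<^sup>2))
     \<and> Ent N (\<lambda>x. (f x)\<^sup>2) \<le> C * dirichlet_form N f)"

(* There is no factor 2 in front of C in log_sobolev, so in this normalization the optimal
   constant of the Gaussian with covariance S is 2 * lambda_max S (test functions
   exp (a \<bullet> x)). It is lambda_max S in the normalization Ent(f^2) \<le> 2 C E(f,f). A bound
   (1 / min alpha) * lambda_max / beta in the latter normalization therefore reads
   2 * (1 / min alpha) * lambda_max / beta here; without the 2 it fails for one Gaussian.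
   The infimum of the empty set is unspecified: any bound on C_LSI N should come together
   with log_sobolev N (C_LSI N). *)
definition C_LSI :: "'a::real_inner measure \<Rightarrow> real" where
  "C_LSI N = Inf {C. 0 \<le> C \<and> log_sobolev N C}"

end

theory Submission
  imports Defs
begin

text \<open>Since \<open>\<beta> \<le> 1\<close>, concavity and subadditivity of \<open>t \<mapsto> t powr \<beta>\<close> give
  \<open>min \<alpha> * \<pi> powr \<beta> \<le> (\<Sum>j. \<alpha> j * q j powr \<beta>) \<le> \<pi> powr \<beta>\<close>. Hence every component \<open>\<nu> k\<close> is a perturbation of
  the Gaussian proportional to \<open>q k powr \<beta>\<close> by a factor between \<open>1\<close> and \<open>1 / min \<alpha>\<close>. The density ratio and the weights
  are then controlled by explicit Gaussian integrals, and the log-Sobolev constants by the Holley--Stroock argument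
  and the Gaussian log-Sobolev inequality.

  In dimension one the latter is proved by transport on \<open>{-R..R}\<close>: if \<open>T\<close> is the increasing map that carries the measure with
  density \<open>h = f\<^sup>2 / \<integral>f\<^sup>2\<close> relative to the truncated Gaussian to the truncated Gaussian itself, and \<open>\<theta> = T x - x\<close>, then
  \<open>ln h = - x \<theta> - \<theta>\<^sup>2 / 2 + ln (1 + \<theta>') \<le> - x \<theta> - \<theta>\<^sup>2 / 2 + \<theta>'\<close>. Multiplying by \<open>h\<close> and integrating by parts, where no
  boundary terms arise because \<open>\<theta>\<close> vanishes at both ends, leaves \<open>2 \<integral>f'\<^sup>2\<close> after completing the square; then \<open>R\<close>
  tends to infinity. Higher dimensions follow by subadditivity of the entropy over products and an affine change of
  variables \<open>y \<mapsto> m + A y\<close> with \<open>A A\<^sup>T\<close> the covariance. These steps use only test functions bounded between positive constants; the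
  general case follows by cutoff and Fatou's lemma.\<close>

section \<open>The one-dimensional Gaussian log-Sobolev inequality on an interval\<close>

text \<open>A power of a mixture has no closed-form normalizer, so every comparison passes through
  the explicit masses \<open>K k\<close> of the single powers \<open>q k powr \<beta>\<close>. A
  perturbation with values in \<open>[c, B * c]\<close> costs only the quotient \<open>B\<close> of
  its bounds: the upper bound enters through the entropy, the lower one through the energy, and
  \<open>c\<close>, which contains the unknown normalizer, cancels. The transport lives on a bounded
  interval because there the map is continuous up to the ends and fixes them; on the whole line the
  decay of the boundary term would need an argument of its own. A Bochner integral of a
  non-integrable function is 0, so an inequality between such integrals can be void. The
  intermediate inequalities therefore keep \<open>f\<close> between positive constants, which makes
  the entropy finite, and take the energy in \<open>ennreal\<close>, where it may be
  infinite.\<close>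

lemma std_normal_density_DERIV:
  "(std_normal_density has_real_derivative - x * std_normal_density x) (at x)"
proof -
  have "((\<lambda>x. (1 / sqrt (2 * pi)) * exp (- x\<^sup>2 / 2)) has_real_derivative
      - x * ((1 / sqrt (2 * pi)) * exp (- x\<^sup>2 / 2))) (at x)"
    by (rule derivative_eq_intros refl | simp)+
  then show ?thesis
    by (simp only: std_normal_density_def[abs_def])
qed

lemma continuous_on_std_normal_density [continuous_intros]:
  "continuous_on A g \<Longrightarrow> continuous_on A (\<lambda>x. std_normal_density (g x))"
  unfolding std_normal_density_def by (auto intro!: continuous_intros)

text \<open>Working on the whole line makes the derivative two-sided at the ends of
  \<open>{a..b}\<close> too, as the fundamental theorem on \<open>{a..b}\<close> requires.\<close>

lemma antiderivative_on_reals: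
  fixes f :: "real \<Rightarrow> real"
  assumes "continuous_on UNIV f"
  obtains F where "\<And>x. (F has_real_derivative f x) (at x)" and "F a = 0"
proof -
  have "\<exists>F. \<forall>x. - \<infinity> < ereal x \<longrightarrow> ereal x < \<infinity> \<longrightarrow> (F has_vector_derivative f x) (at x)"
    using assms by (intro einterval_antiderivative) (auto simp: continuous_on_eq_continuous_at)
  then obtain F where F: "\<And>x. (F has_real_derivative f x) (at x)"
    by (auto simp: has_real_derivative_iff_has_vector_derivative)
  show ?thesis
    by (rule that[of "\<lambda>x. F x - F a"]) (auto intro!: derivative_eq_intros F)
qed

text \<open>\<open>T\<close> is the inverse of \<open>F\<close> after \<open>G\<close>, where
  \<open>G\<close> and \<open>F\<close> are the cumulative functions of \<open>p\<close> and
  \<open>q\<close> based at \<open>a\<close>. Equal masses make \<open>G b = F b\<close>, whence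
  \<open>T b = b\<close>. The derivative is computed only in the open interval, where
  \<open>g\<close> is continuous at \<open>G x\<close>.\<close>

lemma monotone_transport:
  fixes p q :: "real \<Rightarrow> real"
  assumes "a < b" and p: "continuous_on UNIV p" "\<And>x. 0 < p x" and q: "continuous_on UNIV q" "\<And>x. 0 < q x"
    and eq: "(LINT x|lborel. p x * indicator {a..b} x) = (LINT x|lborel. q x * indicator {a..b} x)"
  obtains T where "T a = a" "T b = b" "continuous_on {a..b} T"
    "\<And>x. a < x \<Longrightarrow> x < b \<Longrightarrow> (T has_real_derivative p x / q (T x)) (at x)"
proof -
  obtain G where G: "\<And>x. (G has_real_derivative p x) (at x)" "G a = 0"
    using antiderivative_on_reals[OF p(1), of a] by metis
  obtain F where F: "\<And>x. (F has_real_derivative q x) (at x)" "F a = 0"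
    using antiderivative_on_reals[OF q(1), of a] by metis
  have Gb: "G b = F b"
    using integral_FTC_Icc_real[of a b G p] integral_FTC_Icc_real[of a b F q] G F p q \<open>a < b\<close> eq
    by (simp add: continuous_on_eq_continuous_at)
  have incF: "F x < F y" if "x < y" for x y
    using DERIV_pos_imp_increasing[OF that, of F] F q by blast
  have incG: "G x < G y" if "x < y" for x y
    using DERIV_pos_imp_increasing[OF that, of G] G p by blast
  have incF': "F x \<le> F y" and incG': "G x \<le> G y" if "x \<le> y" for x y
    using incF[of x y] incG[of x y] that by (cases "x = y"; simp)+
  have injF: "inj F"
    using incF by (metis injI less_irrefl linorder_neqE)
  define g where "g = inv F"
  have gF: "g (F x) = x" for x
    using injF by (simp add: g_def)
  have contF: "continuous_on A F" for A
    using F(1) by (meson DERIV_isCont continuous_at_imp_continuous_on)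
  have contG: "continuous_on A G" for A
    using G(1) by (meson DERIV_isCont continuous_at_imp_continuous_on)
  have im: "F ` {a..b} = {0..F b}"
  proof
    show "F ` {a..b} \<subseteq> {0..F b}"
      using incF'[of a] incF'[of _ b] F(2) by auto
    show "{0..F b} \<subseteq> F ` {a..b}"
      using IVT'[of F a _ b] contF F(2) \<open>a < b\<close> by fastforce
  qed
  have contg: "continuous_on {0..F b} g"
    using continuous_on_inv[OF contF, of "{a..b}" g] gF im by auto
  have Fg: "F (g y) = y" if "y \<in> {0..F b}" for y
    using that im gF by (metis imageE)
  have Gin: "G x \<in> {0<..<F b}" if "a < x" "x < b" for x
    using incG[OF that(1)] incG[OF that(2)] G Gb by auto
  have Gin': "G ` {a..b} \<subseteq> {0..F b}"
    using incG'[of a] incG'[of _ b] G(2) Gb by auto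
  show ?thesis
  proof (rule that[of "\<lambda>x. g (G x)"])
    show "g (G a) = a" "g (G b) = b"
      using gF[of a] gF[of b] G(2) F(2) Gb by auto
    show "continuous_on {a..b} (\<lambda>x. g (G x))"
      by (rule continuous_on_compose2[OF contg contG Gin'])
    fix x assume x: "a < x" "x < b"
    have "isCont g (G x)"
      using contg Gin[OF x] by (intro continuous_on_interior[of "{0..F b}"]) auto
    then have "(g has_real_derivative inverse (q (g (G x)))) (at (G x))"
      using Gin[OF x] Fg q(2) F(1)
      by (intro DERIV_inverse_function[where f = F and a = 0 and b = "F b"]) (auto simp: less_imp_neq[symmetric])
    from DERIV_chain2[OF this G(1)]
    show "((\<lambda>x. g (G x)) has_real_derivative p x / q (g (G x))) (at x)"
      by (simp add: field_simps)
  qed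
qed

text \<open>Integration by parts takes the form of a monotonicity statement, so the derivative of
  \<open>T\<close> is never integrated: \<open>K\<close> is an antiderivative of the integrand,
  \<open>u\<close> is the boundary term, and \<open>K - u\<close> does not increase. As
  \<open>u\<close> vanishes at both ends, \<open>K R \<le> K (-R)\<close>.\<close>

lemma gaussian_log_sobolev_interval:
  fixes f f' :: "real \<Rightarrow> real" and R :: real
  assumes "0 < R" and f: "\<And>x. (f has_real_derivative f' x) (at x)" "\<And>x. 0 < f x"
    and f': "continuous_on UNIV f'"
  defines "P \<equiv> LINT x|lborel. std_normal_density x * indicator {-R..R} x"
    and "A \<equiv> LINT x|lborel. (f x)\<^sup>2 * std_normal_density x * indicator {-R..R} x"
  shows "(LINT x|lborel. ((f x)\<^sup>2 * ln ((f x)\<^sup>2 * (P / A)) - 2 * (f' x)\<^sup>2) * std_normal_density x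
            * indicator {-R..R} x) \<le> 0"
    and "0 < P" and "0 < A"
proof -
  let ?\<phi> = std_normal_density
  have contf: "continuous_on B f" for B
    using f(1) by (meson DERIV_isCont continuous_at_imp_continuous_on)
  have ipos: "0 < (LINT x|lborel. p x * indicator {-R..R} x)"
    if p: "continuous_on UNIV p" "\<And>x. 0 < p x" for p :: "real \<Rightarrow> real"
  proof -
    obtain F where F: "\<And>x. (F has_real_derivative p x) (at x)"
      using antiderivative_on_reals[OF p(1)] by metis
    have "F (-R) < F R"
      using DERIV_pos_imp_increasing[of "-R" R F] F p \<open>0 < R\<close> by fastforce
    then show ?thesis
      using integral_FTC_Icc_real[of "-R" R F p] F p \<open>0 < R\<close>
      by (simp add: continuous_on_eq_continuous_at)
  qed
  have phi_pos: "0 < ?\<phi> x" for x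
    by (simp add: normal_density_pos)
  show P: "0 < P" unfolding P_def
    using phi_pos by (intro ipos) (auto intro!: continuous_intros)
  show A: "0 < A" unfolding A_def
    using phi_pos f(2) by (intro ipos) (auto intro!: continuous_intros contf simp: less_imp_neq[symmetric] zero_less_mult_iff)
  \<comment> \<open>The scaling that gives \<open>h\<close> times the Gaussian density the same mass
    on the interval as the Gaussian density itself, so that a transport map exists.\<close>
  define c where "c = P / A"
  have c: "0 < c" using P A by (simp add: c_def)
  define h where "h x = c * (f x)\<^sup>2" for x
  have h: "0 < h x" for x using c f(2) by (simp add: h_def zero_less_mult_iff less_imp_neq[symmetric])
  have eq: "(LINT x|lborel. (h x * ?\<phi> x) * indicator {-R..R} x) = (LINT x|lborel. ?\<phi> x * indicator {-R..R} x)"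
  proof -
    have "(LINT x|lborel. (h x * ?\<phi> x) * indicator {-R..R} x) = (LINT x|lborel. c * ((f x)\<^sup>2 * ?\<phi> x * indicator {-R..R} x))"
      by (simp add: h_def mult_ac)
    also have "\<dots> = P" using A by (simp add: c_def A_def[symmetric])
    finally show ?thesis by (simp add: P_def)
  qed
  have conthp: "continuous_on UNIV (\<lambda>x. h x * ?\<phi> x)"
    unfolding h_def by (intro continuous_intros contf)
  obtain T where T: "T (-R) = -R" "T R = R" "continuous_on {-R..R} T"
    "\<And>x. -R < x \<Longrightarrow> x < R \<Longrightarrow> (T has_real_derivative h x * ?\<phi> x / ?\<phi> (T x)) (at x)"
    using monotone_transport[OF _ conthp _ continuous_on_std_normal_density[OF continuous_on_id] _ eq]
      h phi_pos \<open>0 < R\<close> by auto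
  define k where "k x = ((f x)\<^sup>2 * ln ((f x)\<^sup>2 * c) - 2 * (f' x)\<^sup>2) * ?\<phi> x" for x
  have contk: "continuous_on UNIV k"
    using c f(2) unfolding k_def by (auto intro!: continuous_intros contf f' simp: less_imp_neq[symmetric])
  obtain K where K: "\<And>x. (K has_real_derivative k x) (at x)"
    using antiderivative_on_reals[OF contk] by metis
  define u where "u x = (f x)\<^sup>2 * ?\<phi> x * (T x - x)" for x
  have "K R - u R \<le> K (-R) - u (-R)"
  proof (rule DERIV_nonpos_imp_decreasing_open[where f = "\<lambda>x. K x - u x"])
    show "-R \<le> R" using \<open>0 < R\<close> by simp
    have "continuous_on {-R..R} K"
      using K by (meson DERIV_isCont continuous_at_imp_continuous_on)
    then show "continuous_on {-R..R} (\<lambda>x. K x - u x)"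
      unfolding u_def by (auto intro!: continuous_intros contf T)
    fix x assume x: "-R < x" "x < R"
    define D where "D = h x * ?\<phi> x / ?\<phi> (T x)"
    define t where "t = T x - x"
    have D: "0 < D" using h phi_pos by (simp add: D_def)
    \<comment> \<open>The product rule for \<open>u\<close>; \<open>D - 1\<close> is the derivative
      of the displacement \<open>t\<close>, and the Gaussian density contributes the term with
      factor \<open>- x\<close>.\<close>
    define u' where "u' = (2 * f x * f' x * t - x * (f x)\<^sup>2 * t + (f x)\<^sup>2 * (D - 1)) * ?\<phi> x"
    have "(u has_real_derivative u') (at x)"
      unfolding u_def u'_def t_def D_def
      by (auto intro!: derivative_eq_intros f(1) std_normal_density_DERIV T(4) x simp: algebra_simps power2_eq_square)
    then have "((\<lambda>x. K x - u x) has_real_derivative k x - u') (at x)"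
      by (auto intro!: derivative_eq_intros K)
    moreover have "k x - u' \<le> 0"
    proof -
      have r: "?\<phi> x / ?\<phi> (T x) = exp (t * x + t\<^sup>2 / 2)"
        by (simp add: std_normal_density_def t_def exp_diff[symmetric] divide_simps mult_exp_exp)
           (simp add: algebra_simps power2_eq_square)
      have "D = h x * exp (t * x + t\<^sup>2 / 2)"
        unfolding D_def r[symmetric] by simp
      then have "ln D = ln (h x) + (t * x + t\<^sup>2 / 2)"
        using h[of x] by (simp add: ln_mult)
      then have "ln (h x) \<le> D - 1 - t * x - t\<^sup>2 / 2"
        using ln_le_minus_one[OF D] by linarith
      then have "(f x)\<^sup>2 * ln (h x) \<le> (f x)\<^sup>2 * (D - 1 - t * x - t\<^sup>2 / 2)"
        by (intro mult_left_mono) auto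
      \<comment> \<open>Half of this square is
        \<open>2 * f'^2 + 2 * f * f' * t + f^2 * t^2 / 2\<close>: it trades the two negative terms
        at hand for the cross term in \<open>u'\<close>.\<close>
      moreover have "0 \<le> (2 * f' x + f x * t)\<^sup>2" by simp
      ultimately have "(f x)\<^sup>2 * ln (h x) - 2 * (f' x)\<^sup>2 \<le> 2 * f x * f' x * t - x * (f x)\<^sup>2 * t + (f x)\<^sup>2 * (D - 1)"
        by (simp add: power2_eq_square algebra_simps)
      then have "k x \<le> u'"
        unfolding k_def u'_def using phi_pos[of x] by (intro mult_right_mono) (auto simp: h_def mult.commute)
      then show ?thesis by simp
    qed
    ultimately show "\<exists>y. ((\<lambda>x. K x - u x) has_real_derivative y) (at x) \<and> y \<le> 0" by blast
  qed
  moreover have "u R = 0" "u (-R) = 0" by (simp_all add: u_def T)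
  moreover have "(LINT x|lborel. k x * indicator {-R..R} x) = K R - K (-R)"
    using K contk \<open>0 < R\<close> by (intro integral_FTC_Icc_real) (auto simp: continuous_on_eq_continuous_at)
  ultimately show "(LINT x|lborel. ((f x)\<^sup>2 * ln ((f x)\<^sup>2 * (P / A)) - 2 * (f' x)\<^sup>2) * std_normal_density x
            * indicator {-R..R} x) \<le> 0"
    by (simp add: k_def c_def)
qed

section \<open>Subadditivity of the entropy\<close>

abbreviation std_gaussian :: "real measure" where
  "std_gaussian \<equiv> density lborel (\<lambda>x. ennreal (std_normal_density x))"

lemma abs_mult_ln_le:
  fixes a b x :: real
  assumes "0 < a" "a \<le> x" "x \<le> b"
  shows "\<bar>x * ln x\<bar> \<le> b * (\<bar>ln a\<bar> + \<bar>ln b\<bar>)"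
proof -
  have "ln a \<le> ln x" "ln x \<le> ln b" using assms by auto
  then have "\<bar>ln x\<bar> \<le> \<bar>ln a\<bar> + \<bar>ln b\<bar>" by linarith
  then have "\<bar>x\<bar> * \<bar>ln x\<bar> \<le> b * (\<bar>ln a\<bar> + \<bar>ln b\<bar>)"
    using assms by (intro mult_mono) auto
  then show ?thesis by (simp add: abs_mult)
qed

text \<open>If \<open>g\<close> is not integrable, the left side is 0; otherwise passing to the
  right side only discards the negative part. This lets an iterated integral be estimated fibre by
  fibre.\<close>

lemma ennreal_integral_le_nn_integral: "ennreal (LINT x|N. g x) \<le> (\<integral>\<^sup>+x. ennreal (g x) \<partial>N)"
proof (cases "integrable N g")
  case True
  have "(LINT x|N. g x) \<le> (LINT x|N. max 0 (g x))"
    using True by (intro integral_mono) auto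
  then have "ennreal (LINT x|N. g x) \<le> ennreal (LINT x|N. max 0 (g x))"
    by (rule ennreal_leI)
  also have "\<dots> = (\<integral>\<^sup>+x. ennreal (max 0 (g x)) \<partial>N)"
    using True by (intro nn_integral_eq_integral[symmetric]) auto
  also have "\<dots> = (\<integral>\<^sup>+x. ennreal (g x) \<partial>N)"
    by (auto intro!: nn_integral_cong simp: max_def ennreal_neg)
  finally show ?thesis .
qed (simp add: not_integrable_integral_eq)

lemma (in prob_space) integrable_mult_ln:
  fixes h :: "'a \<Rightarrow> real"
  assumes "h \<in> borel_measurable M" "0 < a" "\<And>x. a \<le> h x" "\<And>x. h x \<le> b"
  shows "integrable M (\<lambda>x. h x * ln (h x))"
  using assms abs_mult_ln_le[of a _ b]
  by (intro integrable_const_bound[where B = "b * (\<bar>ln a\<bar> + \<bar>ln b\<bar>)"]) auto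

lemma (in prob_space) integrable_between:
  fixes h :: "'a \<Rightarrow> real"
  assumes "h \<in> borel_measurable M" "0 < a" "\<And>x. a \<le> h x" "\<And>x. h x \<le> b"
  shows "integrable M h"
proof (rule integrable_const_bound[where B = b])
  show "AE x in M. norm (h x) \<le> b"
    using assms(2,4) order_trans[OF less_imp_le[OF assms(2)] assms(3)] by auto
qed fact

lemma (in prob_space) integral_between:
  fixes h :: "'a \<Rightarrow> real"
  assumes "h \<in> borel_measurable M" "0 < a" "\<And>x. a \<le> h x" "\<And>x. h x \<le> b"
  shows "a \<le> (LINT x|M. h x)" "(LINT x|M. h x) \<le> b"
  using integrable_between[OF assms] assms by (auto intro!: integral_ge_const integral_le_const)

text \<open>Integrate Young's inequality \<open>u s \<le> u ln u - u + exp s\<close> with \<open>u = h / \<integral>h\<close> and \<open>s = v\<close>.\<close>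

lemma (in prob_space) integral_mult_le_Ent:
  assumes h: "h \<in> borel_measurable M" "0 < a" "\<And>x. a \<le> h x" "\<And>x. h x \<le> b"
    and v: "v \<in> borel_measurable M" "\<And>x. \<bar>v x\<bar> \<le> c" "(LINT x|M. exp (v x)) = 1"
  shows "(LINT x|M. h x * v x) \<le> Ent M h"
proof -
  define s where "s = (LINT x|M. h x)"
  have s: "0 < s" using integral_between[OF h] h(2) by (simp add: s_def)
  have hpos: "0 < h x" for x using h(2,3) by (metis less_le_trans)
  have ih: "integrable M h" by (rule integrable_between[OF h])
  have il: "integrable M (\<lambda>x. h x * ln (h x))" by (rule integrable_mult_ln[OF h])
  have ie: "integrable M (\<lambda>x. exp (v x))"
    using v(1,2) by (intro integrable_const_bound[where B = "exp c"]) (auto simp: abs_le_iff)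
  have iv: "integrable M (\<lambda>x. h x * v x)"
  proof (rule integrable_const_bound[where B = "b * c"])
    have "norm (h x * v x) \<le> b * c" for x
    proof -
      have "0 \<le> h x" "0 \<le> b" using hpos[of x] h(4)[of x] by auto
      then show ?thesis
        using v(2)[of x] h(4)[of x] by (auto simp: abs_mult intro!: mult_mono)
    qed
    then show "AE x in M. norm (h x * v x) \<le> b * c" by simp
  qed (use h v in auto)
  have "(LINT x|M. h x * v x) \<le> (LINT x|M. h x * ln (h x) - h x * ln s - h x + s * exp (v x))"
  proof (rule integral_mono)
    fix x
    have "1 + (v x - ln (h x / s)) \<le> exp (v x - ln (h x / s))"
      by (rule exp_ge_add_one_self)
    also have "\<dots> = exp (v x) * s / h x"
      using hpos[of x] s by (simp add: exp_diff)
    finally have "h x * (1 + (v x - ln (h x / s))) \<le> exp (v x) * s"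
      using hpos[of x] by (simp add: field_simps)
    then show "h x * v x \<le> h x * ln (h x) - h x * ln s - h x + s * exp (v x)"
      using hpos[of x] s by (simp add: ln_div algebra_simps)
  qed (use iv il ih ie in auto)
  also have "\<dots> = Ent M h"
    using ih il ie v(3) by (simp add: Ent_def s_def)
  finally show ?thesis .
qed

lemma (in prob_space) Ent_nonneg:
  assumes "h \<in> borel_measurable M" "0 < a" "\<And>x. a \<le> h x" "\<And>x. h x \<le> b"
  shows "0 \<le> Ent M h"
  using integral_mult_le_Ent[OF assms, of "\<lambda>_. 0" 0] by (simp add: prob_space)

lemma Ent_distr:
  assumes "g \<in> measurable M N" "h \<in> borel_measurable N"
  shows "Ent (distr M N g) h = Ent M (\<lambda>x. h (g x))"
  using assms by (simp add: Ent_def integral_distr)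

text \<open>The entropy splits into the averaged entropy in the first coordinate and the entropy of
  the marginal \<open>H\<close>. By Fubini the latter is the integral of \<open>h * v\<close> with
  \<open>v = ln (H / m)\<close>; since \<open>exp v\<close> has mean 1,
  \<open>integral_mult_le_Ent\<close> bounds the inner integral for each \<open>x\<close> by the
  entropy in the second coordinate.\<close>

lemma Ent_pair_measure_le:
  assumes "prob_space M1" "prob_space M2"
    and h[measurable]: "h \<in> borel_measurable (M1 \<Otimes>\<^sub>M M2)"
    and b: "0 < a" "\<And>z. a \<le> h z" "\<And>z. h z \<le> b"
  shows "ennreal (Ent (M1 \<Otimes>\<^sub>M M2) h)
    \<le> (\<integral>\<^sup>+y. ennreal (Ent M1 (\<lambda>x. h (x, y))) \<partial>M2) + (\<integral>\<^sup>+x. ennreal (Ent M2 (\<lambda>y. h (x, y))) \<partial>M1)"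
proof -
  interpret M1: prob_space M1 by fact
  interpret M2: prob_space M2 by fact
  interpret pair_prob_space M1 M2 ..
  have hx: "(\<lambda>x. h (x, y)) \<in> borel_measurable M1" if "y \<in> space M2" for y
    using that by measurable
  have hy: "(\<lambda>y. h (x, y)) \<in> borel_measurable M2" if "x \<in> space M1" for x
    using that by measurable
  define H where "H y = (LINT x|M1. h (x, y))" for y
  define L where "L y = (LINT x|M1. h (x, y) * ln (h (x, y)))" for y
  have [measurable]: "H \<in> borel_measurable M2" "L \<in> borel_measurable M2"
    unfolding H_def L_def by measurable
  have H_bd: "a \<le> H y" "H y \<le> b" if "y \<in> space M2" for y
    unfolding H_def using M1.integral_between[OF hx[OF that] b(1) b(2) b(3)] by auto
  have Hpos: "0 < H y" if "y \<in> space M2" for y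
    using H_bd[OF that] b(1) by simp
  have ih: "integrable (M1 \<Otimes>\<^sub>M M2) h"
    by (rule integrable_between[OF h b])
  have il: "integrable (M1 \<Otimes>\<^sub>M M2) (\<lambda>z. h z * ln (h z))"
    by (rule integrable_mult_ln[OF h b])
  define m where "m = (LINT z|(M1 \<Otimes>\<^sub>M M2). h z)"
  have m: "a \<le> m" "m \<le> b" "0 < m"
    using integral_between[OF h b] b(1) by (auto simp: m_def)
  have mH: "(LINT y|M2. H y) = m"
    unfolding H_def m_def using integral_snd[of "\<lambda>x y. h (x, y)"] ih by simp
  have LL: "(LINT y|M2. L y) = (LINT z|(M1 \<Otimes>\<^sub>M M2). h z * ln (h z))"
    unfolding L_def using integral_snd[of "\<lambda>x y. h (x, y) * ln (h (x, y))"] il by (simp add: case_prod_beta')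
  have iL: "integrable M2 L"
    unfolding L_def using integrable_snd[of "\<lambda>x y. h (x, y) * ln (h (x, y))"] il by (simp add: case_prod_beta')
  have iH: "integrable M2 H"
    unfolding H_def using integrable_snd[of "\<lambda>x y. h (x, y)"] ih by simp
  have iHl: "integrable M2 (\<lambda>y. H y * ln (H y))"
    using H_bd abs_mult_ln_le[OF b(1), of _ b]
    by (intro M2.integrable_const_bound[where B = "b * (\<bar>ln a\<bar> + \<bar>ln b\<bar>)"]) auto
  \<comment> \<open>The bounds on \<open>H\<close> are available only on the space of
    \<open>M2\<close>, whereas \<open>integral_mult_le_Ent\<close> asks for a bound on
    \<open>v\<close> everywhere; hence the value 0 outside.\<close>
  define v where "v y = (if y \<in> space M2 then ln (H y / m) else 0)" for y
  have v[measurable]: "v \<in> borel_measurable M2"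
    unfolding v_def by measurable
  have ab: "0 < b" "a \<le> b" using b(1) order_trans[OF b(2) b(3)] by auto
  have vb: "\<bar>v y\<bar> \<le> ln (b / a)" for y
  proof (cases "y \<in> space M2")
    case True
    have "H y / m \<le> b / a" "a / b \<le> H y / m"
      using H_bd[OF True] m b(1) ab by (intro frac_le; simp)+
    moreover have "0 < H y / m" using H_bd[OF True] b(1) m by simp
    ultimately have "ln (H y / m) \<le> ln (b / a)" "ln (a / b) \<le> ln (H y / m)"
      using b(1) ab by (auto simp del: ln_div)
    then show ?thesis
      using True b(1) ab m H_bd[OF True] by (simp add: v_def ln_div)
  qed (use b(1) ab in \<open>simp add: v_def\<close>)
  have ev: "(LINT y|M2. exp (v y)) = 1"
  proof -
    have "(LINT y|M2. exp (v y)) = (LINT y|M2. H y / m)"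
      using Hpos m by (intro Bochner_Integration.integral_cong) (auto simp: v_def)
    then show ?thesis using mH m by simp
  qed
  have ihv: "integrable (M1 \<Otimes>\<^sub>M M2) (\<lambda>z. h z * v (snd z))"
  proof (rule integrable_const_bound[where B = "b * ln (b / a)"])
    show "AE z in M1 \<Otimes>\<^sub>M M2. norm (h z * v (snd z)) \<le> b * ln (b / a)"
    proof (rule AE_I2)
      fix z
      have "0 \<le> h z" using b(1) b(2)[of z] by linarith
      then show "norm (h z * v (snd z)) \<le> b * ln (b / a)"
        using b(3)[of z] vb[of "snd z"] ab by (auto simp: abs_mult intro!: mult_mono)
    qed
  qed measurable
  have E2m[measurable]: "(\<lambda>x. Ent M2 (\<lambda>y. h (x, y))) \<in> borel_measurable M1"
    unfolding Ent_def by measurable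
  have E2nn: "0 \<le> Ent M2 (\<lambda>y. h (x, y))" if "x \<in> space M1" for x
    by (rule M2.Ent_nonneg[OF hy[OF that] b(1) b(2) b(3)])
  have E1nn: "0 \<le> Ent M1 (\<lambda>x. h (x, y))" if "y \<in> space M2" for y
    by (rule M1.Ent_nonneg[OF hx[OF that] b(1) b(2) b(3)])
  have E1: "Ent M1 (\<lambda>x. h (x, y)) = L y - H y * ln (H y)" for y
    by (simp add: Ent_def L_def H_def)
  have e1: "ennreal ((LINT y|M2. L y) - (LINT y|M2. H y * ln (H y))) = (\<integral>\<^sup>+y. ennreal (Ent M1 (\<lambda>x. h (x, y))) \<partial>M2)"
    using iL iHl E1nn by (subst nn_integral_eq_integral) (auto simp: E1)
  have "ennreal (LINT x|M1. (LINT y|M2. h (x, y) * v y)) \<le> (\<integral>\<^sup>+x. ennreal (LINT y|M2. h (x, y) * v y) \<partial>M1)"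
    by (rule ennreal_integral_le_nn_integral)
  also have "\<dots> \<le> (\<integral>\<^sup>+x. ennreal (Ent M2 (\<lambda>y. h (x, y))) \<partial>M1)"
    by (intro nn_integral_mono ennreal_leI M2.integral_mult_le_Ent[OF hy b(1) b(2) b(3) v vb ev])
  finally have e2: "ennreal (LINT x|M1. (LINT y|M2. h (x, y) * v y)) \<le> (\<integral>\<^sup>+x. ennreal (Ent M2 (\<lambda>y. h (x, y))) \<partial>M1)" .
  have "(LINT x|M1. (LINT y|M2. h (x, y) * v y)) = (LINT y|M2. (LINT x|M1. h (x, y) * v y))"
    using Fubini_integral[of "\<lambda>x y. h (x, y) * v y"] ihv by (simp add: case_prod_beta')
  also have "\<dots> = (LINT y|M2. H y * ln (H y) - ln m * H y)"
    using Hpos m by (intro Bochner_Integration.integral_cong) (auto simp: v_def H_def[symmetric] ln_div algebra_simps)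
  also have "\<dots> = (LINT y|M2. H y * ln (H y)) - m * ln m"
    using iH iHl mH by simp
  finally have e3: "(LINT x|M1. (LINT y|M2. h (x, y) * v y)) = (LINT y|M2. H y * ln (H y)) - m * ln m" .
  have "Ent (M1 \<Otimes>\<^sub>M M2) h = ((LINT y|M2. L y) - (LINT y|M2. H y * ln (H y))) + ((LINT y|M2. H y * ln (H y)) - m * ln m)"
    by (simp add: Ent_def LL m_def)
  then have "ennreal (Ent (M1 \<Otimes>\<^sub>M M2) h) \<le> ennreal ((LINT y|M2. L y) - (LINT y|M2. H y * ln (H y))) + ennreal ((LINT y|M2. H y * ln (H y)) - m * ln m)"
    by (auto simp: ennreal_plus_if intro!: ennreal_leI)
  also have "\<dots> \<le> (\<integral>\<^sup>+y. ennreal (Ent M1 (\<lambda>x. h (x, y))) \<partial>M2) + (\<integral>\<^sup>+x. ennreal (Ent M2 (\<lambda>y. h (x, y))) \<partial>M1)"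
    using e1 e2 e3 by (intro add_mono) auto
  finally show ?thesis .
qed

section \<open>The inequality on the whole line, and entropy over finite products\<close>

lemma prob_space_std_gaussian: "prob_space std_gaussian"
  by (rule prob_space_normal_density) simp

lemma integrable_std_gaussian_iff:
  "w \<in> borel_measurable borel \<Longrightarrow> integrable std_gaussian w \<longleftrightarrow> integrable lborel (\<lambda>x. w x * std_normal_density x)"
  for w :: "real \<Rightarrow> real"
  by (subst integrable_density) (auto simp: mult.commute)

lemma integral_std_gaussian:
  "w \<in> borel_measurable borel \<Longrightarrow> (LINT x|std_gaussian. w x) = (LINT x|lborel. w x * std_normal_density x)"
  for w :: "real \<Rightarrow> real"
  by (subst integral_density) (auto simp: mult.commute)

text \<open>The bound \<open>Suc n\<close> keeps the interval nondegenerate, since the inequality on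
  \<open>{-R..R}\<close> asks for \<open>0 < R\<close>.\<close>

lemma integral_Icc_tendsto_std_gaussian:
  fixes w :: "real \<Rightarrow> real"
  assumes "integrable std_gaussian w"
  shows "(\<lambda>n. LINT x|lborel. w x * std_normal_density x * indicator {- real (Suc n)..real (Suc n)} x)
     \<longlonglongrightarrow> (LINT x|std_gaussian. w x)"
proof -
  have [measurable]: "w \<in> borel_measurable borel"
    using borel_measurable_integrable[OF assms] by simp
  have i: "integrable lborel (\<lambda>x. w x * std_normal_density x)"
    using assms integrable_std_gaussian_iff[of w] by simp
  show ?thesis
    unfolding integral_std_gaussian[OF \<open>w \<in> borel_measurable borel\<close>]
  proof (rule integral_dominated_convergence[where w = "\<lambda>x. norm (w x * std_normal_density x)"])
    show "AE x in lborel. (\<lambda>n. w x * std_normal_density x * indicator {- real (Suc n)..real (Suc n)} x)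
      \<longlonglongrightarrow> w x * std_normal_density x"
    proof (rule AE_I2, rule tendsto_eventually)
      fix x :: real
      obtain N where N: "\<bar>x\<bar> < real N" using reals_Archimedean2 by blast
      have "x \<in> {- real (Suc n)..real (Suc n)}" if "N \<le> n" for n
      proof -
        have "real N \<le> real (Suc n)" using that by simp
        then show ?thesis using N by auto
      qed
      then show "\<forall>\<^sub>F n in sequentially. w x * std_normal_density x * indicator {- real (Suc n)..real (Suc n)} x
        = w x * std_normal_density x"
        by (auto simp: eventually_sequentially intro!: exI[of _ N])
    qed
    show "integrable lborel (\<lambda>x. norm (w x * std_normal_density x))"
      by (rule integrable_norm[OF i])
  qed (auto simp: indicator_def)
qed

text \<open>A divergent energy makes the right side infinite. Otherwise all four truncated integrals
  converge; \<open>?P\<close> tends to 1, so \<open>?A * ln (?P / ?A)\<close> tends to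
  \<open>- s * ln s\<close>, the second term of the entropy.\<close>

theorem gaussian_log_sobolev_real:
  fixes f f' :: "real \<Rightarrow> real"
  assumes f: "\<And>x. (f has_real_derivative f' x) (at x)" "0 < a" "\<And>x. a \<le> f x" "\<And>x. f x \<le> b"
    and f': "continuous_on UNIV f'"
  shows "ennreal (Ent std_gaussian (\<lambda>x. (f x)\<^sup>2)) \<le> 2 * (\<integral>\<^sup>+x. ennreal ((f' x)\<^sup>2) \<partial>std_gaussian)"
proof (cases "(\<integral>\<^sup>+x. ennreal ((f' x)\<^sup>2) \<partial>std_gaussian) = \<infinity>")
  case True
  then show ?thesis by (simp add: ennreal_mult_top)
next
  case False
  interpret prob_space std_gaussian by (rule prob_space_std_gaussian)
  have fpos: "0 < f x" for x using f(2) f(3)[of x] by linarith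
  have [measurable]: "f \<in> borel_measurable borel"
    using f(1) by (intro borel_measurable_continuous_onI) (meson DERIV_isCont continuous_at_imp_continuous_on)
  have [measurable]: "f' \<in> borel_measurable borel"
    by (rule borel_measurable_continuous_onI[OF f'])
  have h: "(\<lambda>x. (f x)\<^sup>2) \<in> borel_measurable std_gaussian" "0 < a\<^sup>2" "\<And>x. a\<^sup>2 \<le> (f x)\<^sup>2" "\<And>x. (f x)\<^sup>2 \<le> b\<^sup>2"
    using f(2,3,4) less_imp_le[OF fpos] by (auto intro!: power_mono)
  have i': "integrable std_gaussian (\<lambda>x. (f' x)\<^sup>2)"
    using False by (auto simp: integrable_iff_bounded less_top)
  have ih: "integrable std_gaussian (\<lambda>x. (f x)\<^sup>2)" by (rule integrable_between[OF h])
  have il: "integrable std_gaussian (\<lambda>x. (f x)\<^sup>2 * ln ((f x)\<^sup>2))" by (rule integrable_mult_ln[OF h])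
  let ?I = "\<lambda>w n. LINT x|lborel. w x * std_normal_density x * indicator {- real (Suc n)..real (Suc n)} x"
  let ?P = "?I (\<lambda>_. 1)" and ?A = "?I (\<lambda>x. (f x)\<^sup>2)" and ?L = "?I (\<lambda>x. (f x)\<^sup>2 * ln ((f x)\<^sup>2))"
    and ?D = "?I (\<lambda>x. (f' x)\<^sup>2)"
  have intI: "integrable lborel (\<lambda>x. w x * std_normal_density x * indicator {- real (Suc n)..real (Suc n)} x)"
    if "integrable std_gaussian w" for w :: "real \<Rightarrow> real" and n
  proof -
    have [measurable]: "w \<in> borel_measurable borel"
      using borel_measurable_integrable[OF that] by simp
    show ?thesis
      using that integrable_std_gaussian_iff[of w] by (intro integrable_real_mult_indicator) auto
  qed
  have P: "?P \<longlonglongrightarrow> 1"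
    using integral_Icc_tendsto_std_gaussian[of "\<lambda>_. 1"] prob_space by simp
  note A = integral_Icc_tendsto_std_gaussian[OF ih] and L = integral_Icc_tendsto_std_gaussian[OF il]
    and D = integral_Icc_tendsto_std_gaussian[OF i']
  define s where "s = (LINT x|std_gaussian. (f x)\<^sup>2)"
  have s: "0 < s" using integral_between(1)[OF h] h(2) unfolding s_def by linarith
  have le: "?L n + ?A n * ln (?P n / ?A n) - 2 * ?D n \<le> 0" for n
  proof -
    have R: "0 < real (Suc n)" by simp
    note I = gaussian_log_sobolev_interval[OF R f(1) fpos f']
    define c where "c = ?P n / ?A n"
    have c: "0 < c" using I(2,3) by (simp add: c_def)
    have "?L n + ?A n * ln c - 2 * ?D n = (LINT x|lborel.
       ((f x)\<^sup>2 * ln ((f x)\<^sup>2)) * std_normal_density x * indicator {- real (Suc n)..real (Suc n)} x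
       + ((f x)\<^sup>2 * std_normal_density x * indicator {- real (Suc n)..real (Suc n)} x) * ln c
       - 2 * ((f' x)\<^sup>2 * std_normal_density x * indicator {- real (Suc n)..real (Suc n)} x))"
      using intI[OF ih, of n] intI[OF il, of n] intI[OF i', of n] by simp
    also have "\<dots> = (LINT x|lborel. ((f x)\<^sup>2 * ln ((f x)\<^sup>2 * c) - 2 * (f' x)\<^sup>2) * std_normal_density x
            * indicator {- real (Suc n)..real (Suc n)} x)"
      using fpos c by (intro Bochner_Integration.integral_cong) (auto simp: ln_mult less_imp_neq[symmetric] algebra_simps)
    also have "\<dots> \<le> 0"
      using I(1) by (simp add: c_def)
    finally show ?thesis by (simp add: c_def)
  qed
  have "(\<lambda>n. ?L n + ?A n * ln (?P n / ?A n) - 2 * ?D n) \<longlonglongrightarrow>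
     (LINT x|std_gaussian. (f x)\<^sup>2 * ln ((f x)\<^sup>2)) + s * ln (1 / s) - 2 * (LINT x|std_gaussian. (f' x)\<^sup>2)"
    unfolding s_def using s by (intro tendsto_intros A L D P) (auto simp: s_def)
  then have "(LINT x|std_gaussian. (f x)\<^sup>2 * ln ((f x)\<^sup>2)) + s * ln (1 / s) - 2 * (LINT x|std_gaussian. (f' x)\<^sup>2) \<le> 0"
    by (rule LIMSEQ_le_const2) (use le in auto)
  then have "Ent std_gaussian (\<lambda>x. (f x)\<^sup>2) \<le> 2 * (LINT x|std_gaussian. (f' x)\<^sup>2)"
    using s by (simp add: Ent_def s_def[symmetric] ln_div)
  then have "ennreal (Ent std_gaussian (\<lambda>x. (f x)\<^sup>2)) \<le> ennreal (2 * (LINT x|std_gaussian. (f' x)\<^sup>2))"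
    by (rule ennreal_leI)
  also have "\<dots> = 2 * (\<integral>\<^sup>+x. ennreal ((f' x)\<^sup>2) \<partial>std_gaussian)"
    using i' by (subst nn_integral_eq_integral) (auto simp: ennreal_mult')
  finally show ?thesis .
qed

text \<open>The energies \<open>g i\<close> are arbitrary functions instead of partial derivatives,
  so that the induction can freeze the new coordinate \<open>i\<close> at a value \<open>t\<close>
  in \<open>h\<close> and in every \<open>g j\<close> alike.\<close>

lemma Ent_PiM_le:
  assumes N: "\<And>i. prob_space (N i)" and "finite I"
    and "h \<in> borel_measurable (Pi\<^sub>M I N)" "0 < a" "\<And>x. a \<le> h x" "\<And>x. h x \<le> b"
    and "\<And>i. i \<in> I \<Longrightarrow> g i \<in> borel_measurable (Pi\<^sub>M I N)"
    and "\<And>i x. i \<in> I \<Longrightarrow> x \<in> space (Pi\<^sub>M I N) \<Longrightarrow>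
      ennreal (Ent (N i) (\<lambda>t. h (x(i := t)))) \<le> (\<integral>\<^sup>+t. g i (x(i := t)) \<partial>N i)"
  shows "ennreal (Ent (Pi\<^sub>M I N) h) \<le> (\<Sum>i\<in>I. \<integral>\<^sup>+x. g i x \<partial>Pi\<^sub>M I N)"
  using assms(2-)
proof (induction I arbitrary: h g rule: finite_induct)
  case empty
  have "Ent (Pi\<^sub>M {} N) h = 0"
    unfolding Ent_def PiM_empty by (simp add: lebesgue_integral_count_space_finite)
  then show ?case by simp
next
  case (insert i I)
  interpret product_prob_space N I by (intro product_prob_spaceI N)
  note [measurable] = insert.prems(1)
  have [measurable]: "g j \<in> borel_measurable (Pi\<^sub>M (insert i I) N)" if "j \<in> insert i I" for j
    using insert.prems that by blast
  have PI: "prob_space (Pi\<^sub>M I N)" by (intro prob_space_PiM N)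
  have D: "distr (N i \<Otimes>\<^sub>M Pi\<^sub>M I N) (Pi\<^sub>M (insert i I) N) (\<lambda>(t, x). x(i := t)) = Pi\<^sub>M (insert i I) N"
    by (intro distr_pair_PiM_eq_PiM N)
  have upd[measurable]: "(\<lambda>(t, x). x(i := t)) \<in> measurable (N i \<Otimes>\<^sub>M Pi\<^sub>M I N) (Pi\<^sub>M (insert i I) N)"
    unfolding split_beta' by (intro measurable_fun_upd[where J = I]) auto
  have updI: "(\<lambda>x. x(i := t)) \<in> measurable (Pi\<^sub>M I N) (Pi\<^sub>M (insert i I) N)" if "t \<in> space (N i)" for t
    using that by (intro measurable_fun_upd[where J = I]) auto
  have "Ent (Pi\<^sub>M (insert i I) N) h = Ent (N i \<Otimes>\<^sub>M Pi\<^sub>M I N) (\<lambda>z. h ((\<lambda>(t, x). x(i := t)) z))"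
    by (subst D[symmetric], subst Ent_distr) auto
  also have "ennreal \<dots> \<le> (\<integral>\<^sup>+x. ennreal (Ent (N i) (\<lambda>t. h (x(i := t)))) \<partial>Pi\<^sub>M I N)
      + (\<integral>\<^sup>+t. ennreal (Ent (Pi\<^sub>M I N) (\<lambda>x. h (x(i := t)))) \<partial>N i)"
    using Ent_pair_measure_le[OF N PI _ insert.prems(2), of "\<lambda>z. h ((\<lambda>(t, x). x(i := t)) z)" i b] insert.prems(3,4)
    by simp
  also have "\<dots> \<le> (\<integral>\<^sup>+x. g i x \<partial>Pi\<^sub>M (insert i I) N) + (\<Sum>j\<in>I. \<integral>\<^sup>+x. g j x \<partial>Pi\<^sub>M (insert i I) N)"
  proof (rule add_mono)
    have "(\<integral>\<^sup>+x. ennreal (Ent (N i) (\<lambda>t. h (x(i := t)))) \<partial>Pi\<^sub>M I N) \<le> (\<integral>\<^sup>+x. (\<integral>\<^sup>+t. g i (x(i := t)) \<partial>N i) \<partial>Pi\<^sub>M I N)"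
    proof (rule nn_integral_mono)
      fix x assume x: "x \<in> space (Pi\<^sub>M I N)"
      \<comment> \<open>The hypothesis speaks of points of the full product. Any value at
        \<open>i\<close> serves to extend \<open>x\<close>, because the later update at
        \<open>i\<close> overwrites it.\<close>
      obtain t where t: "t \<in> space (N i)" using prob_space.not_empty[OF N] by blast
      have "x(i := t) \<in> space (Pi\<^sub>M (insert i I) N)" using x t by (auto simp: space_PiM PiE_def extensional_def)
      from insert.prems(6)[OF insertI1 this]
      show "ennreal (Ent (N i) (\<lambda>t. h (x(i := t)))) \<le> (\<integral>\<^sup>+t. g i (x(i := t)) \<partial>N i)"
        by (simp only: fun_upd_upd)
    qed
    also have "\<dots> = (\<integral>\<^sup>+x. g i x \<partial>Pi\<^sub>M (insert i I) N)"
      using insert by (subst product_nn_integral_insert) auto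
    finally show "(\<integral>\<^sup>+x. ennreal (Ent (N i) (\<lambda>t. h (x(i := t)))) \<partial>Pi\<^sub>M I N) \<le> (\<integral>\<^sup>+x. g i x \<partial>Pi\<^sub>M (insert i I) N)" .
    have "(\<integral>\<^sup>+t. ennreal (Ent (Pi\<^sub>M I N) (\<lambda>x. h (x(i := t)))) \<partial>N i)
        \<le> (\<integral>\<^sup>+t. (\<Sum>j\<in>I. \<integral>\<^sup>+x. g j (x(i := t)) \<partial>Pi\<^sub>M I N) \<partial>N i)"
    proof (rule nn_integral_mono)
      fix t assume t: "t \<in> space (N i)"
      show "ennreal (Ent (Pi\<^sub>M I N) (\<lambda>x. h (x(i := t)))) \<le> (\<Sum>j\<in>I. \<integral>\<^sup>+x. g j (x(i := t)) \<partial>Pi\<^sub>M I N)"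
      proof (rule insert.IH)
        fix j x assume j: "j \<in> I" and x: "x \<in> space (Pi\<^sub>M I N)"
        have "x(i := t) \<in> space (Pi\<^sub>M (insert i I) N)" using x t by (auto simp: space_PiM PiE_def extensional_def)
        note le = insert.prems(6)[OF insertI2[OF j] this]
        have "j \<noteq> i" using j insert.hyps by auto
        then have tw: "x(j := s, i := t) = x(i := t, j := s)" for s by (rule fun_upd_twist)
        show "ennreal (Ent (N j) (\<lambda>s. h (x(j := s, i := t)))) \<le> (\<integral>\<^sup>+s. g j (x(j := s, i := t)) \<partial>N j)"
          unfolding tw by (rule le)
      qed (rule measurable_compose[OF updI[OF t] insert.prems(1)]
          measurable_compose[OF updI[OF t] insert.prems(5)] insert.prems(2-4) insertI2 | assumption)+
    qed
    also have "\<dots> = (\<Sum>j\<in>I. \<integral>\<^sup>+t. (\<integral>\<^sup>+x. g j (x(i := t)) \<partial>Pi\<^sub>M I N) \<partial>N i)"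
      by (rule nn_integral_sum) measurable
    also have "\<dots> = (\<Sum>j\<in>I. \<integral>\<^sup>+x. g j x \<partial>Pi\<^sub>M (insert i I) N)"
      using insert.hyps by (intro sum.cong refl product_nn_integral_insert_rev[symmetric]) auto
    finally show "(\<integral>\<^sup>+t. ennreal (Ent (Pi\<^sub>M I N) (\<lambda>x. h (x(i := t)))) \<partial>N i) \<le> \<dots>" .
  qed
  finally show ?case using insert.hyps by simp
qed

section \<open>The standard Gaussian measure\<close>

text \<open>The derivative is a linear functional, hence the inner product with its adjoint applied
  to 1; uniqueness of the derivative makes \<open>THE\<close> select this vector.\<close>

lemma GDERIV_grad:
  fixes f :: "'a::euclidean_space \<Rightarrow> real"
  assumes "f differentiable (at x)"
  shows "GDERIV f x :> grad f x"
proof -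
  obtain f' where f': "(f has_derivative f') (at x)"
    using assms by (auto simp: differentiable_def)
  have "f' = (\<lambda>h. h \<bullet> adjoint f' 1)"
    using adjoint_works[OF has_derivative_linear[OF f'], of _ 1] by auto
  then have D: "GDERIV f x :> adjoint f' 1"
    using f' unfolding gderiv_def by metis
  show ?thesis
    unfolding grad_def
  proof (rule theI)
    fix D' assume "GDERIV f x :> D'"
    then show "D' = adjoint f' 1"
      using has_derivative_unique[of f _ x] D unfolding gderiv_def by (metis (no_types) inner_commute vector_eq_rdot)
  qed (rule D)
qed

lemma grad_eqI:
  fixes f :: "'a::euclidean_space \<Rightarrow> real"
  assumes "GDERIV f x :> D"
  shows "grad f x = D"
proof -
  have "f differentiable (at x)"
    using assms by (auto simp: gderiv_def differentiable_def)
  then have "GDERIV f x :> grad f x" by (rule GDERIV_grad)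
  then have "(\<lambda>h. h \<bullet> grad f x) = (\<lambda>h. h \<bullet> D)"
    using assms unfolding gderiv_def by (rule has_derivative_unique)
  then show ?thesis by (metis inner_commute vector_eq_rdot)
qed

text \<open>Positive bounds on \<open>f\<close> make both integrals in \<open>Ent\<close> finite
  under a probability measure, and the energy may be infinite in \<open>ennreal\<close>. So no
  integrability has to be carried through products, images and perturbations.\<close>

definition log_sobolev_bounded :: "'a::euclidean_space measure \<Rightarrow> real \<Rightarrow> bool" where
  "log_sobolev_bounded N C \<longleftrightarrow> (\<forall>f a b. 0 < a \<longrightarrow> (\<forall>x. a \<le> f x \<and> f x \<le> b) \<longrightarrow>
     (\<forall>x. f differentiable (at x)) \<longrightarrow> continuous_on UNIV (grad f) \<longrightarrow>
     ennreal (Ent N (\<lambda>x. (f x)\<^sup>2)) \<le> ennreal C * (\<integral>\<^sup>+x. ennreal ((norm (grad f x))\<^sup>2) \<partial>N))"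

definition gaussian_pdf :: "'a::euclidean_space \<Rightarrow> real" where
  "gaussian_pdf x = exp (- (norm x)\<^sup>2 / 2) / sqrt (2 * pi) ^ DIM('a)"

definition gaussian_measure :: "'a::euclidean_space measure" where
  "gaussian_measure = density lborel (\<lambda>x. ennreal (gaussian_pdf x))"

lemma gaussian_pdf_pos: "0 < gaussian_pdf x"
  by (simp add: gaussian_pdf_def)

lemma borel_measurable_gaussian_pdf [measurable]: "gaussian_pdf \<in> borel_measurable borel"
  unfolding gaussian_pdf_def by measurable

lemma sets_gaussian_measure [measurable_cong, simp]: "sets gaussian_measure = sets borel"
  by (simp add: gaussian_measure_def)

lemma gaussian_pdf_eq_prod:
  "gaussian_pdf x = (\<Prod>b\<in>Basis. std_normal_density (x \<bullet> b))" for x :: "'a::euclidean_space"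
proof -
  have "(\<Prod>b\<in>Basis. std_normal_density (x \<bullet> b)) = (1 / sqrt (2 * pi)) ^ DIM('a) * (\<Prod>b\<in>Basis. exp (- (x \<bullet> b)\<^sup>2 / 2))"
    by (simp add: std_normal_density_def prod_dividef power_divide)
  also have "(\<Prod>b\<in>Basis. exp (- (x \<bullet> b)\<^sup>2 / 2)) = exp (- (\<Sum>b\<in>Basis. (x \<bullet> b)\<^sup>2) / 2)"
    by (simp add: exp_sum[symmetric] sum_negf sum_divide_distrib)
  also have "(\<Sum>b\<in>Basis. (x \<bullet> b)\<^sup>2) = (norm x)\<^sup>2"
    by (simp add: norm_eq_sqrt_inner euclidean_inner[of x x] power2_eq_square sum_nonneg)
  finally show ?thesis by (simp add: gaussian_pdf_def power_divide)
qed

text \<open>The image measure divided by \<open>gaussian_pdf\<close> is shown to be Lebesgue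
  measure: \<open>1 / gaussian_pdf\<close> times the indicator of a box factors over the
  coordinates, so its integral is the product of the side lengths. Multiplying the density back
  gives the claim.\<close>

lemma gaussian_measure_eq_PiM:
  "(gaussian_measure :: 'a::euclidean_space measure)
     = distr (\<Pi>\<^sub>M b\<in>Basis. std_gaussian) borel (\<lambda>x. \<Sum>b\<in>Basis. x b *\<^sub>R b)"
proof -
  let ?S = "\<lambda>x::'a \<Rightarrow> real. \<Sum>b\<in>Basis. x b *\<^sub>R b"
  define N where "N = distr (\<Pi>\<^sub>M b\<in>Basis. std_gaussian) borel ?S"
  interpret product_prob_space "\<lambda>_. std_gaussian" Basis
    by (intro product_prob_spaceI prob_space_std_gaussian)
  have S[measurable]: "?S \<in> measurable (\<Pi>\<^sub>M b\<in>Basis. std_gaussian) borel" by measurable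
  have setsN[measurable_cong]: "sets N = sets borel" by (simp add: N_def)
  have "lborel = density N (\<lambda>x. ennreal (1 / gaussian_pdf x))"
  proof (rule lborel_eqI)
    fix l u :: 'a assume lu: "\<And>b. b \<in> Basis \<Longrightarrow> l \<bullet> b \<le> u \<bullet> b"
    let ?g = "\<lambda>b t. ennreal (1 / std_normal_density t) * indicator {l \<bullet> b<..<u \<bullet> b} t"
    have "emeasure (density N (\<lambda>x. ennreal (1 / gaussian_pdf x))) (box l u)
        = (\<integral>\<^sup>+x. ennreal (1 / gaussian_pdf (?S x)) * indicator (box l u) (?S x) \<partial>(\<Pi>\<^sub>M b\<in>Basis. std_gaussian))"
      unfolding N_def by (subst emeasure_density) (auto simp: nn_integral_distr)
    also have "\<dots> = (\<integral>\<^sup>+x. (\<Prod>b\<in>Basis. ?g b (x b)) \<partial>(\<Pi>\<^sub>M b\<in>Basis. std_gaussian))"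
    proof (rule nn_integral_cong)
      fix x :: "'a \<Rightarrow> real"
      have "indicator (box l u) (?S x) = (\<Prod>b\<in>Basis. indicator {l \<bullet> b<..<u \<bullet> b} (x b) :: ennreal)"
        by (auto simp: indicator_def box_def prod_zero_iff)
      moreover have "ennreal (1 / gaussian_pdf (?S x)) = (\<Prod>b\<in>Basis. ennreal (1 / std_normal_density (x b)))"
        by (subst prod_ennreal) (auto simp: gaussian_pdf_eq_prod prod_dividef)
      ultimately show "ennreal (1 / gaussian_pdf (?S x)) * indicator (box l u) (?S x) = (\<Prod>b\<in>Basis. ?g b (x b))"
        by (simp add: prod.distrib)
    qed
    also have "\<dots> = (\<Prod>b\<in>Basis. integral\<^sup>N std_gaussian (?g b))"
      by (rule product_nn_integral_prod) auto
    also have "\<dots> = (\<Prod>b\<in>Basis. ennreal ((u - l) \<bullet> b))"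
    proof (rule prod.cong[OF refl])
      fix b :: 'a assume b: "b \<in> Basis"
      have "integral\<^sup>N std_gaussian (?g b) = (\<integral>\<^sup>+t. ennreal (std_normal_density t) * ?g b t \<partial>lborel)"
        by (subst nn_integral_density) auto
      also have "\<dots> = (\<integral>\<^sup>+t. indicator {l \<bullet> b<..<u \<bullet> b} t \<partial>lborel)"
      proof (rule nn_integral_cong)
        fix t :: real
        have "ennreal (std_normal_density t) * ennreal (1 / std_normal_density t) = 1"
          using normal_density_pos[of 1 0 t] by (subst ennreal_mult'[symmetric]) auto
        then show "ennreal (std_normal_density t) * ?g b t = indicator {l \<bullet> b<..<u \<bullet> b} t"
          by (simp add: mult.assoc[symmetric])
      qed
      also have "\<dots> = ennreal ((u - l) \<bullet> b)"
        using lu[OF b] by (simp add: inner_diff_left)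
      finally show "integral\<^sup>N std_gaussian (?g b) = ennreal ((u - l) \<bullet> b)" .
    qed
    also have "\<dots> = ennreal (\<Prod>b\<in>Basis. (u - l) \<bullet> b)"
      using lu by (intro prod_ennreal) (auto simp: inner_diff_left)
    finally show "emeasure (density N (\<lambda>x. ennreal (1 / gaussian_pdf x))) (box l u) = (\<Prod>b\<in>Basis. (u - l) \<bullet> b)" .
  qed (simp add: setsN)
  then have "(gaussian_measure :: 'a measure) = density (density N (\<lambda>x. ennreal (1 / gaussian_pdf x))) (\<lambda>x. ennreal (gaussian_pdf x))"
    by (simp add: gaussian_measure_def)
  also have "\<dots> = density N (\<lambda>x. ennreal (1 / gaussian_pdf x) * ennreal (gaussian_pdf x))"
    by (rule density_density_eq) measurable
  also have "\<dots> = density N (\<lambda>_. 1)"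
  proof (intro density_cong AE_I2)
    fix x :: 'a
    show "ennreal (1 / gaussian_pdf x) * ennreal (gaussian_pdf x) = 1"
      using gaussian_pdf_pos[of x] by (subst ennreal_mult''[symmetric]) (auto simp: less_imp_le)
  qed auto
  finally show ?thesis by (simp add: density_1 N_def)
qed

lemma prob_space_gaussian_measure: "prob_space gaussian_measure"
  unfolding gaussian_measure_eq_PiM
  by (intro prob_space.prob_space_distr prob_space_PiM prob_space_std_gaussian) measurable

text \<open>On a line in direction \<open>c\<close> the derivative of \<open>f\<close> is
  \<open>grad f \<bullet> c\<close>, and the squares of these partial derivatives sum to the squared
  norm. Tensorization costs no factor, so the constant 2 of dimension one survives.\<close>

theorem gaussian_log_sobolev_bounded: "log_sobolev_bounded (gaussian_measure :: 'a::euclidean_space measure) 2"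
  unfolding log_sobolev_bounded_def
proof (intro allI impI)
  fix f :: "'a \<Rightarrow> real" and a b :: real
  assume a: "0 < a" and ab: "\<forall>x. a \<le> f x \<and> f x \<le> b"
    and diff: "\<forall>x. f differentiable (at x)" and cont: "continuous_on UNIV (grad f)"
  let ?P = "\<Pi>\<^sub>M b\<in>(Basis::'a set). std_gaussian"
  let ?S = "\<lambda>x::'a \<Rightarrow> real. \<Sum>b\<in>Basis. x b *\<^sub>R b"
  have S[measurable]: "?S \<in> measurable ?P borel" by measurable
  have [measurable]: "f \<in> borel_measurable borel"
    using diff by (intro borel_measurable_continuous_onI)
      (metis differentiable_imp_continuous_within continuous_at_imp_continuous_on)
  have [measurable]: "grad f \<in> borel_measurable borel"
    by (rule borel_measurable_continuous_onI[OF cont])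
  have fnn: "0 \<le> f x" for x using a ab by (meson order_trans less_imp_le)
  have "ennreal (Ent gaussian_measure (\<lambda>x. (f x)\<^sup>2)) = ennreal (Ent ?P (\<lambda>x. (f (?S x))\<^sup>2))"
    unfolding gaussian_measure_eq_PiM by (subst Ent_distr) auto
  also have "\<dots> \<le> (\<Sum>c\<in>Basis. \<integral>\<^sup>+x. 2 * ennreal ((grad f (?S x) \<bullet> c)\<^sup>2) \<partial>?P)"
  proof (rule Ent_PiM_le)
    show "0 < a\<^sup>2" "a\<^sup>2 \<le> (f (?S x))\<^sup>2" "(f (?S x))\<^sup>2 \<le> b\<^sup>2" for x
      using a ab fnn by (auto intro!: power_mono)
    fix c :: 'a and x :: "'a \<Rightarrow> real" assume c: "c \<in> Basis"
    define y where "y = ?S (x(c := 0))"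
    have Sx: "?S (x(c := t)) = y + t *\<^sub>R c" for t
    proof -
      have "?S (x(c := t)) = (\<Sum>b\<in>Basis. (x(c := 0)) b *\<^sub>R b + (if b = c then t *\<^sub>R b else 0))"
        by (rule sum.cong) auto
      also have "\<dots> = y + t *\<^sub>R c"
        using c by (simp only: sum.distrib y_def sum.delta finite_Basis if_True)
      finally show ?thesis .
    qed
    have "((\<lambda>t. f (y + t *\<^sub>R c)) has_real_derivative grad f (y + t *\<^sub>R c) \<bullet> c) (at t)" for t
    proof -
      have "(f has_derivative (\<lambda>h. h \<bullet> grad f (y + t *\<^sub>R c))) (at (y + t *\<^sub>R c))"
        using GDERIV_grad diff unfolding gderiv_def by blast
      then have "((\<lambda>t. f (y + t *\<^sub>R c)) has_derivative (\<lambda>h. (h *\<^sub>R c) \<bullet> grad f (y + t *\<^sub>R c))) (at t)"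
        by (rule has_derivative_compose[rotated]) (auto intro!: derivative_eq_intros)
      then show ?thesis
        by (simp add: has_field_derivative_def inner_commute mult_commute_abs)
    qed
    moreover have "continuous_on UNIV (\<lambda>t. grad f (y + t *\<^sub>R c) \<bullet> c)"
      by (intro continuous_intros continuous_on_compose2[OF cont]) auto
    ultimately have "ennreal (Ent std_gaussian (\<lambda>t. (f (y + t *\<^sub>R c))\<^sup>2))
        \<le> 2 * (\<integral>\<^sup>+t. ennreal ((grad f (y + t *\<^sub>R c) \<bullet> c)\<^sup>2) \<partial>std_gaussian)"
      using a ab by (intro gaussian_log_sobolev_real[where a = a and b = b]) auto
    also have "\<dots> = (\<integral>\<^sup>+t. 2 * ennreal ((grad f (y + t *\<^sub>R c) \<bullet> c)\<^sup>2) \<partial>std_gaussian)"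
      by (rule nn_integral_cmult[symmetric]) measurable
    finally show "ennreal (Ent std_gaussian (\<lambda>t. (f (?S (x(c := t))))\<^sup>2))
        \<le> (\<integral>\<^sup>+t. 2 * ennreal ((grad f (?S (x(c := t))) \<bullet> c)\<^sup>2) \<partial>std_gaussian)"
      unfolding Sx .
  qed (use prob_space_std_gaussian in \<open>auto\<close>)
  also have "\<dots> = (\<integral>\<^sup>+x. (\<Sum>c\<in>Basis. 2 * ennreal ((grad f (?S x) \<bullet> c)\<^sup>2)) \<partial>?P)"
    by (rule nn_integral_sum[symmetric]) measurable
  also have "\<dots> = (\<integral>\<^sup>+x. ennreal 2 * ennreal ((norm (grad f (?S x)))\<^sup>2) \<partial>?P)"
  proof (rule nn_integral_cong)
    fix x
    have "(\<Sum>c\<in>Basis. (v \<bullet> c)\<^sup>2) = (norm v)\<^sup>2" for v :: 'a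
      by (simp add: norm_eq_sqrt_inner euclidean_inner[of v v] power2_eq_square sum_nonneg)
    then show "(\<Sum>c\<in>Basis. 2 * ennreal ((grad f (?S x) \<bullet> c)\<^sup>2)) = ennreal 2 * ennreal ((norm (grad f (?S x)))\<^sup>2)"
      by (simp add: sum_distrib_left[symmetric] sum_ennreal)
  qed
  also have "\<dots> = ennreal 2 * (\<integral>\<^sup>+x. ennreal ((norm (grad f x))\<^sup>2) \<partial>gaussian_measure)"
    unfolding gaussian_measure_eq_PiM by (subst nn_integral_distr) (auto intro!: nn_integral_cmult)
  finally show "ennreal (Ent gaussian_measure (\<lambda>x. (f x)\<^sup>2))
      \<le> ennreal 2 * (\<integral>\<^sup>+x. ennreal ((norm (grad f x))\<^sup>2) \<partial>gaussian_measure)" .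
qed

section \<open>Stability of log-Sobolev inequalities\<close>

text \<open>Entropy is preserved by images, while the chain rule turns \<open>grad f\<close> into
  \<open>transpose L *v grad f\<close>. Hence \<open>K\<close>, a bound for the squared operator
  norm of \<open>transpose L\<close>, multiplies the constant.\<close>

lemma log_sobolev_bounded_affine_image:
  fixes L :: "real^'n^'n" and m :: "real^'n"
  assumes lsb: "log_sobolev_bounded N C" and sets: "sets N = sets borel"
    and K: "0 \<le> C" "0 \<le> K" "\<And>v. (norm (transpose L *v v))\<^sup>2 \<le> K * (norm v)\<^sup>2"
  shows "log_sobolev_bounded (distr N borel (\<lambda>y. m + L *v y)) (C * K)"
  unfolding log_sobolev_bounded_def
proof (intro allI impI)
  fix f :: "real^'n \<Rightarrow> real" and a b :: real
  assume a: "0 < a" and ab: "\<forall>x. a \<le> f x \<and> f x \<le> b"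
    and diff: "\<forall>x. f differentiable (at x)" and cont: "continuous_on UNIV (grad f)"
  let ?T = "\<lambda>y. m + L *v y"
  have contT: "continuous_on UNIV ?T"
    by (intro continuous_intros)
  have "?T \<in> borel_measurable borel" by (rule borel_measurable_continuous_onI[OF contT])
  then have [measurable]: "?T \<in> measurable N borel"
    unfolding measurable_cong_sets[OF sets refl] .
  have [measurable]: "f \<in> borel_measurable borel"
    using diff by (intro borel_measurable_continuous_onI)
      (metis differentiable_imp_continuous_within continuous_at_imp_continuous_on)
  have [measurable]: "grad f \<in> borel_measurable borel"
    by (rule borel_measurable_continuous_onI[OF cont])
  have D: "GDERIV (\<lambda>y. f (?T y)) y :> transpose L *v grad f (?T y)" for y
  proof -
    have "(f has_derivative (\<lambda>h. h \<bullet> grad f (?T y))) (at (?T y))"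
      using GDERIV_grad diff unfolding gderiv_def by blast
    then have "((\<lambda>y. f (?T y)) has_derivative (\<lambda>h. (L *v h) \<bullet> grad f (?T y))) (at y)"
      by (rule has_derivative_compose[rotated])
        (auto intro!: derivative_eq_intros bounded_linear.has_derivative[OF matrix_vector_mul_bounded_linear])
    moreover have "(\<lambda>h. (L *v h) \<bullet> grad f (?T y)) = (\<lambda>h. h \<bullet> (transpose L *v grad f (?T y)))"
      by (simp only: transpose_matrix_vector dot_lmul_matrix inner_commute[of "L *v _"] inner_commute[of _ "_ v* _"])
    ultimately show ?thesis
      by (simp only: gderiv_def)
  qed
  have g: "grad (\<lambda>y. f (?T y)) = (\<lambda>y. transpose L *v grad f (?T y))"
    using grad_eqI[OF D] by auto
  have "ennreal (Ent (distr N borel ?T) (\<lambda>x. (f x)\<^sup>2)) = ennreal (Ent N (\<lambda>y. (f (?T y))\<^sup>2))"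
    by (subst Ent_distr) auto
  also have "\<dots> \<le> ennreal C * (\<integral>\<^sup>+y. ennreal ((norm (grad (\<lambda>y. f (?T y)) y))\<^sup>2) \<partial>N)"
  proof -
    have "(\<lambda>y. f (?T y)) differentiable (at x)" for x
      using D[of x] by (auto simp: gderiv_def differentiable_def)
    moreover have "continuous_on UNIV (grad (\<lambda>y. f (?T y)))"
      unfolding g using continuous_on_compose2[OF cont contT]
      by (intro linear_continuous_on_compose[OF _ matrix_vector_mul_linear]) auto
    ultimately show ?thesis
      using lsb[unfolded log_sobolev_bounded_def, rule_format, of a "\<lambda>y. f (?T y)" b] a ab by simp
  qed
  also have "\<dots> \<le> ennreal C * (\<integral>\<^sup>+y. ennreal K * ennreal ((norm (grad f (?T y)))\<^sup>2) \<partial>N)"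
    unfolding g using K by (intro mult_left_mono nn_integral_mono) (auto simp: ennreal_mult'[symmetric] intro!: ennreal_leI)
  also have "\<dots> = ennreal (C * K) * (\<integral>\<^sup>+x. ennreal ((norm (grad f x))\<^sup>2) \<partial>distr N borel ?T)"
    using K by (subst nn_integral_cmult, measurable) (simp add: nn_integral_distr ennreal_mult mult.assoc)
  finally show "ennreal (Ent (distr N borel ?T) (\<lambda>x. (f x)\<^sup>2))
      \<le> ennreal (C * K) * (\<integral>\<^sup>+x. ennreal ((norm (grad f x))\<^sup>2) \<partial>distr N borel ?T)" .
qed

text \<open>The Holley--Stroock perturbation argument: \<open>Ent\<^sub>N h\<close> is the minimum over \<open>s > 0\<close> of the integral of
  the nonnegative function \<open>h ln h - h ln s - h + s\<close>, so it changes by at most the upper bound of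
  the density.\<close>

lemma log_sobolev_bounded_perturbation:
  fixes r :: "'a::euclidean_space \<Rightarrow> real"
  assumes lsb: "log_sobolev_bounded N C" and sets[measurable_cong]: "sets N = sets borel"
    and prob: "prob_space N" "prob_space (density N (\<lambda>x. ennreal (r x)))"
    and r[measurable]: "r \<in> borel_measurable borel" and c: "0 < c" "\<And>x. c \<le> r x" "\<And>x. r x \<le> B * c"
    and C: "0 \<le> C"
  shows "log_sobolev_bounded (density N (\<lambda>x. ennreal (r x))) (B * C)"
  unfolding log_sobolev_bounded_def
proof (intro allI impI)
  fix f :: "'a \<Rightarrow> real" and a b :: real
  assume a: "0 < a" and ab: "\<forall>x. a \<le> f x \<and> f x \<le> b"
    and diff: "\<forall>x. f differentiable (at x)" and cont: "continuous_on UNIV (grad f)"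
  let ?N = "density N (\<lambda>x. ennreal (r x))"
  interpret N: prob_space N by fact
  interpret N': prob_space ?N by fact
  have [measurable]: "f \<in> borel_measurable borel"
    using diff by (intro borel_measurable_continuous_onI)
      (metis differentiable_imp_continuous_within continuous_at_imp_continuous_on)
  have [measurable]: "grad f \<in> borel_measurable borel"
    by (rule borel_measurable_continuous_onI[OF cont])
  have fnn: "0 \<le> f x" for x using a ab by (meson order_trans less_imp_le)
  define h where "h x = (f x)\<^sup>2" for x
  have [measurable]: "h \<in> borel_measurable borel" unfolding h_def by measurable
  have hN: "h \<in> borel_measurable N" and hN': "h \<in> borel_measurable ?N" by measurable
  have hb: "0 < a\<^sup>2" "\<And>x. a\<^sup>2 \<le> h x" "\<And>x. h x \<le> b\<^sup>2"
    using a ab fnn by (auto simp: h_def intro!: power_mono)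
  have hpos: "0 < h x" for x using hb(1,2) by (metis less_le_trans)
  have rnn: "0 \<le> r x" for x using c(1) c(2)[of x] by linarith
  have B: "0 \<le> B"
    using c(1) c(2)[of undefined] c(3)[of undefined] by (metis less_le_trans not_less zero_less_mult_pos2 less_imp_le)
  note i = N.integrable_between[OF hN hb] and il = N.integrable_mult_ln[OF hN hb]
  note i' = N'.integrable_between[OF hN' hb] and il' = N'.integrable_mult_ln[OF hN' hb]
  define s where "s = (LINT x|N. h x)"
  have s: "0 < s" using N.integral_between(1)[OF hN hb] hb(1) unfolding s_def by linarith
  define t where "t = (LINT x|?N. h x)"
  have t: "0 < t" using N'.integral_between(1)[OF hN' hb] hb(1) unfolding t_def by linarith
  define \<psi> where "\<psi> x = h x * ln (h x) - h x * ln s - h x + s" for x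
  have [measurable]: "\<psi> \<in> borel_measurable borel" unfolding \<psi>_def by measurable
  have young: "x * ln s + x - s \<le> x * ln x" if "0 < x" for x
  proof -
    have "ln (s / x) \<le> s / x - 1" using s that by (intro ln_le_minus_one) auto
    then have "x * ln (s / x) \<le> x * (s / x - 1)" using that by (intro mult_left_mono) auto
    then show ?thesis using s that by (simp add: ln_div algebra_simps)
  qed
  have \<psi>: "0 \<le> \<psi> x" for x using young[OF hpos[of x]] by (simp add: \<psi>_def)
  have i\<psi>: "integrable N \<psi>" unfolding \<psi>_def using i il by auto
  have i\<psi>': "integrable ?N \<psi>" unfolding \<psi>_def using i' il' by auto
  \<comment> \<open>\<open>\<psi>\<close> uses the mean \<open>s\<close> under \<open>N\<close>,
    which need not be the minimizer for the perturbed measure; \<open>young\<close> at the perturbed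
    mean \<open>t\<close> shows that it still gives an upper bound.\<close>
  have "Ent ?N h \<le> (LINT x|?N. \<psi> x)"
    using young[OF t] i' il' N'.prob_space by (simp add: \<psi>_def Ent_def t_def)
  then have "ennreal (Ent ?N h) \<le> ennreal (LINT x|?N. \<psi> x)" by (rule ennreal_leI)
  also have "\<dots> = (\<integral>\<^sup>+x. ennreal (\<psi> x) \<partial>?N)"
    using i\<psi>' \<psi> by (intro nn_integral_eq_integral[symmetric]) auto
  also have "\<dots> = (\<integral>\<^sup>+x. ennreal (r x) * ennreal (\<psi> x) \<partial>N)"
    by (rule nn_integral_density) measurable
  also have "\<dots> \<le> (\<integral>\<^sup>+x. ennreal (B * c) * ennreal (\<psi> x) \<partial>N)"
    using c by (intro nn_integral_mono mult_right_mono ennreal_leI) auto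
  also have "\<dots> = ennreal (B * c) * (\<integral>\<^sup>+x. ennreal (\<psi> x) \<partial>N)"
    by (rule nn_integral_cmult) measurable
  also have "(\<integral>\<^sup>+x. ennreal (\<psi> x) \<partial>N) = ennreal (LINT x|N. \<psi> x)"
    using i\<psi> \<psi> by (intro nn_integral_eq_integral) auto
  also have "(LINT x|N. \<psi> x) = Ent N h"
    using i il by (simp add: \<psi>_def Ent_def s_def N.prob_space)
  also have "ennreal (Ent N h) \<le> ennreal C * (\<integral>\<^sup>+x. ennreal ((norm (grad f x))\<^sup>2) \<partial>N)"
    using lsb a ab diff cont unfolding log_sobolev_bounded_def h_def[abs_def] by blast
  finally have 1: "ennreal (Ent ?N h) \<le> ennreal (B * c) * (ennreal C * (\<integral>\<^sup>+x. ennreal ((norm (grad f x))\<^sup>2) \<partial>N))"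
    by (simp add: mult_left_mono)
  \<comment> \<open>The lower bound on \<open>r\<close> carries the energy back to the perturbed
    measure and absorbs the factor \<open>c\<close> produced by the upper bound.\<close>
  have "ennreal c * (\<integral>\<^sup>+x. ennreal ((norm (grad f x))\<^sup>2) \<partial>N) = (\<integral>\<^sup>+x. ennreal c * ennreal ((norm (grad f x))\<^sup>2) \<partial>N)"
    by (rule nn_integral_cmult[symmetric]) measurable
  also have "\<dots> \<le> (\<integral>\<^sup>+x. ennreal (r x) * ennreal ((norm (grad f x))\<^sup>2) \<partial>N)"
    using c by (intro nn_integral_mono mult_right_mono ennreal_leI) auto
  also have "\<dots> = (\<integral>\<^sup>+x. ennreal ((norm (grad f x))\<^sup>2) \<partial>?N)"
    by (rule nn_integral_density[symmetric]) measurable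
  finally have 2: "ennreal c * (\<integral>\<^sup>+x. ennreal ((norm (grad f x))\<^sup>2) \<partial>N) \<le> (\<integral>\<^sup>+x. ennreal ((norm (grad f x))\<^sup>2) \<partial>?N)" .
  have "ennreal (B * c) * (ennreal C * (\<integral>\<^sup>+x. ennreal ((norm (grad f x))\<^sup>2) \<partial>N))
      = ennreal (B * C) * (ennreal c * (\<integral>\<^sup>+x. ennreal ((norm (grad f x))\<^sup>2) \<partial>N))"
    using B C c(1) by (simp add: ennreal_mult mult_ac)
  also have "\<dots> \<le> ennreal (B * C) * (\<integral>\<^sup>+x. ennreal ((norm (grad f x))\<^sup>2) \<partial>?N)"
    by (rule mult_left_mono[OF 2]) simp
  finally show "ennreal (Ent ?N (\<lambda>x. (f x)\<^sup>2)) \<le> ennreal (B * C) * (\<integral>\<^sup>+x. ennreal ((norm (grad f x))\<^sup>2) \<partial>?N)"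
    using 1 unfolding h_def[abs_def] by (meson order_trans)
qed

section \<open>From bounded to square integrable test functions\<close>

lemma mult_ln_ge: "- 1 \<le> x * ln x" if "0 \<le> x" for x :: real
proof (cases "x = 0")
  case False
  then have "x > 0" using that by simp
  have "ln (1 / x) \<le> 1 / x - 1" using \<open>x > 0\<close> by (intro ln_le_minus_one) auto
  then have "x * ln (1 / x) \<le> x * (1 / x - 1)" using \<open>x > 0\<close> by (intro mult_left_mono) auto
  then show ?thesis using \<open>x > 0\<close> by (simp add: ln_div algebra_simps)
qed simp

text \<open>At \<open>l = 0\<close> continuity of \<open>ln\<close> is of no help; there
  \<open>ln (1 / sqrt x) \<le> 1 / sqrt x - 1\<close> gives
  \<open>\<bar>x * ln x\<bar> \<le> 2 * sqrt x\<close> for \<open>x < 1\<close>. The case occurs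
  wherever a test function vanishes.\<close>

lemma tendsto_mult_ln_0:
  fixes u :: "nat \<Rightarrow> real"
  assumes u: "u \<longlonglongrightarrow> l" "\<And>n. 0 \<le> u n"
  shows "(\<lambda>n. u n * ln (u n)) \<longlonglongrightarrow> l * ln l"
proof (cases "l = 0")
  case False
  then show ?thesis by (intro tendsto_intros u)
next
  case True
  have bound: "\<bar>x * ln x\<bar> \<le> 2 * sqrt x" if "0 \<le> x" "x < 1" for x :: real
  proof (cases "x = 0")
    case False
    then have x: "0 < x" using that by simp
    have "ln (1 / sqrt x) \<le> 1 / sqrt x - 1" using x by (intro ln_le_minus_one) auto
    then have "- ln x \<le> 2 / sqrt x" using x by (simp add: ln_div ln_sqrt)
    then have "x * (- ln x) \<le> x * (2 / sqrt x)" using x by (intro mult_left_mono) auto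
    also have "\<dots> = 2 * sqrt x" using x by (simp add: field_simps)
    finally show ?thesis using x that by (simp add: abs_mult)
  qed simp
  have "\<forall>\<^sub>F n in sequentially. u n < 1"
    using u(1) True by (intro order_tendstoD) auto
  then have "\<forall>\<^sub>F n in sequentially. norm (u n * ln (u n)) \<le> 2 * sqrt (u n)"
    by eventually_elim (use bound u(2) in auto)
  moreover have "(\<lambda>n. 2 * sqrt (u n)) \<longlonglongrightarrow> 2 * sqrt l"
    by (intro tendsto_intros u)
  ultimately show ?thesis
    using True by (simp add: Lim_null_comparison)
qed

text \<open>The cutoff \<open>sqrt (e + t\<^sup>2 / (1 + e t\<^sup>2))\<close> is 1-Lipschitz, bounded, bounded away from 0, and tends to \<open>\<bar>t\<bar>\<close>
  as \<open>e\<close> tends to 0.\<close>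

definition entropy_cutoff :: "real \<Rightarrow> real \<Rightarrow> real" where
  "entropy_cutoff e t = sqrt (e + t\<^sup>2 / (1 + e * t\<^sup>2))"

context
  fixes e :: real
  assumes e: "0 < e"
begin

lemma entropy_cutoff_sq: "(entropy_cutoff e t)\<^sup>2 = e + t\<^sup>2 / (1 + e * t\<^sup>2)"
  using e by (simp add: entropy_cutoff_def add_nonneg_nonneg)

lemma entropy_cutoff_denom: "1 \<le> 1 + e * t\<^sup>2"
  using e by simp

lemma entropy_cutoff_bounds:
  "sqrt e \<le> entropy_cutoff e t" "entropy_cutoff e t \<le> sqrt (e + 1 / e)" "(entropy_cutoff e t)\<^sup>2 \<le> e + t\<^sup>2"
proof -
  have d: "0 < 1 + e * t\<^sup>2" using entropy_cutoff_denom[of t] by linarith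
  have "t\<^sup>2 / (1 + e * t\<^sup>2) \<le> 1 / e" using d e by (simp add: field_simps)
  then show "entropy_cutoff e t \<le> sqrt (e + 1 / e)" by (simp add: entropy_cutoff_def)
  show "sqrt e \<le> entropy_cutoff e t" using d by (simp add: entropy_cutoff_def)
  have "t\<^sup>2 * 1 \<le> t\<^sup>2 * (1 + e * t\<^sup>2)"
    by (rule mult_left_mono[OF entropy_cutoff_denom]) simp
  then have "t\<^sup>2 / (1 + e * t\<^sup>2) \<le> t\<^sup>2"
    using d by (simp add: pos_divide_le_eq)
  then show "(entropy_cutoff e t)\<^sup>2 \<le> e + t\<^sup>2" by (simp add: entropy_cutoff_sq)
qed

lemma entropy_cutoff_pos: "0 < entropy_cutoff e t"
  using entropy_cutoff_bounds(1)[of t] e by (meson less_le_trans real_sqrt_gt_zero)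

lemma entropy_cutoff_DERIV:
  "(entropy_cutoff e has_real_derivative t / ((1 + e * t\<^sup>2)\<^sup>2 * entropy_cutoff e t)) (at t)"
proof -
  have d: "0 < 1 + e * t\<^sup>2" using entropy_cutoff_denom[of t] by linarith
  have "((\<lambda>t. e + t\<^sup>2 / (1 + e * t\<^sup>2)) has_real_derivative
      (2 * t * (1 + e * t\<^sup>2) - t\<^sup>2 * (e * (2 * t))) / ((1 + e * t\<^sup>2) * (1 + e * t\<^sup>2))) (at t)"
    using d by - (rule derivative_eq_intros refl | simp)+
  then have "((\<lambda>t. e + t\<^sup>2 / (1 + e * t\<^sup>2)) has_real_derivative 2 * t / (1 + e * t\<^sup>2)\<^sup>2) (at t)"
    by (simp add: power2_eq_square algebra_simps)
  moreover have "0 < e + t\<^sup>2 / (1 + e * t\<^sup>2)" using d e by (simp add: add_pos_nonneg)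
  ultimately have "((\<lambda>t. sqrt (e + t\<^sup>2 / (1 + e * t\<^sup>2))) has_real_derivative
      (inverse (sqrt (e + t\<^sup>2 / (1 + e * t\<^sup>2))) / 2) * (2 * t / (1 + e * t\<^sup>2)\<^sup>2)) (at t)"
    by (rule DERIV_chain2[OF DERIV_real_sqrt, rotated])
  then show ?thesis
    unfolding entropy_cutoff_def[abs_def] by (simp add: field_simps)
qed

lemma entropy_cutoff_deriv_le: "\<bar>t / ((1 + e * t\<^sup>2)\<^sup>2 * entropy_cutoff e t)\<bar> \<le> 1"
proof -
  let ?d = "1 + e * t\<^sup>2"
  have d: "1 \<le> ?d" by (rule entropy_cutoff_denom)
  have "t\<^sup>2 / ?d \<le> (entropy_cutoff e t)\<^sup>2" using e by (simp add: entropy_cutoff_sq)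
  then have "t\<^sup>2 \<le> ?d * (entropy_cutoff e t)\<^sup>2" using d by (simp add: pos_divide_le_eq mult.commute)
  \<comment> \<open>As \<open>?d \<ge> 1\<close>, its power may be raised from 1 to 4, which matches
    the square of the denominator \<open>?d^2 * entropy_cutoff e t\<close>.\<close>
  also have "\<dots> \<le> ?d ^ 4 * (entropy_cutoff e t)\<^sup>2"
    using d by (intro mult_right_mono self_le_power) auto
  also have "\<dots> = (?d\<^sup>2 * entropy_cutoff e t)\<^sup>2" by (simp add: power_mult_distrib flip: power_mult)
  finally have "\<bar>t\<bar> \<le> \<bar>?d\<^sup>2 * entropy_cutoff e t\<bar>" by (simp add: abs_le_square_iff)
  moreover have "0 < ?d\<^sup>2 * entropy_cutoff e t" using d entropy_cutoff_pos by (intro mult_pos_pos zero_less_power) auto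
  ultimately show ?thesis by (simp add: abs_divide)
qed

end

text \<open>The cutoff does not increase gradients, so all \<open>g n\<close> satisfy the bounded
  inequality with one right side \<open>C * D\<close>. The means \<open>sn n\<close> converge by
  domination. Fatou's lemma then gives the integrability of \<open>f^2 * ln (f^2)\<close>, which is
  part of the claim, together with the bound.\<close>

lemma log_sobolev_if_bounded:
  fixes N :: "'a::euclidean_space measure"
  assumes lsb: "log_sobolev_bounded N C" and prob: "prob_space N" and sets[measurable_cong]: "sets N = sets borel" and C: "0 \<le> C"
  shows "log_sobolev N C"
  unfolding log_sobolev_def
proof (intro allI impI)
  fix f :: "'a \<Rightarrow> real"
  assume "lsi_test N f"
  then have diff: "\<And>x. f differentiable (at x)" and cont: "continuous_on UNIV (grad f)"
    and i2: "integrable N (\<lambda>x. (f x)\<^sup>2)" and ig: "integrable N (\<lambda>x. (norm (grad f x))\<^sup>2)"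
    by (auto simp: lsi_test_def)
  interpret prob_space N by fact
  have contf: "continuous_on UNIV f"
    using diff by (metis differentiable_imp_continuous_within continuous_at_imp_continuous_on)
  have [measurable]: "f \<in> borel_measurable borel" by (rule borel_measurable_continuous_onI[OF contf])
  have [measurable]: "grad f \<in> borel_measurable borel"
    by (rule borel_measurable_continuous_onI[OF cont])
  define e where "e n = inverse (real (Suc n))" for n
  have e: "0 < e n" "e n \<le> 1" for n by (auto simp: e_def divide_simps)
  have elim: "e \<longlonglongrightarrow> 0" unfolding e_def by (rule LIMSEQ_inverse_real_of_nat)
  define g where "g n x = entropy_cutoff (e n) (f x)" for n x
  have g2: "(g n x)\<^sup>2 = e n + (f x)\<^sup>2 / (1 + e n * (f x)\<^sup>2)" for n x
    unfolding g_def by (rule entropy_cutoff_sq[OF e(1)])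
  have denom: "1 + e n * (f x)\<^sup>2 \<noteq> 0" for n x
    using entropy_cutoff_denom[OF e(1)[of n], of "f x"] by linarith
  have gD: "GDERIV (g n) x :> (f x / ((1 + e n * (f x)\<^sup>2)\<^sup>2 * g n x)) *\<^sub>R grad f x" for n x
    unfolding g_def using entropy_cutoff_DERIV[OF e(1)] GDERIV_grad[OF diff] by (intro GDERIV_DERIV_compose)
  have gpos: "0 < g n x" for n x unfolding g_def by (rule entropy_cutoff_pos[OF e(1)])
  have contg: "continuous_on UNIV (g n)" for n
    unfolding g_def entropy_cutoff_def
    using denom by (intro continuous_intros contf) auto
  have [measurable]: "g n \<in> borel_measurable borel" for n by (rule borel_measurable_continuous_onI[OF contg])
  have gg: "grad (g n) = (\<lambda>x. (f x / ((1 + e n * (f x)\<^sup>2)\<^sup>2 * g n x)) *\<^sub>R grad f x)" for n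
    using grad_eqI[OF gD] by auto
  have ng: "norm (grad (g n) x) \<le> norm (grad f x)" for n x
    using mult_right_mono[OF entropy_cutoff_deriv_le[OF e(1)[of n], of "f x"] norm_ge_zero[of "grad f x"]]
    by (simp only: gg g_def norm_scaleR real_norm_def mult_1_left)
  define D where "D = (LINT x|N. (norm (grad f x))\<^sup>2)"
  have hm: "(\<lambda>x. (g n x)\<^sup>2) \<in> borel_measurable N" for n by measurable
  have hb: "0 < (sqrt (e n))\<^sup>2"
    "\<And>x. (sqrt (e n))\<^sup>2 \<le> (g n x)\<^sup>2" "\<And>x. (g n x)\<^sup>2 \<le> (sqrt (e n + 1 / e n))\<^sup>2" for n
    unfolding g_def using entropy_cutoff_bounds(1,2)[OF e(1)[of n]] e(1)[of n] less_imp_le[OF entropy_cutoff_pos[OF e(1)[of n]]]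
    by (auto simp del: real_sqrt_pow2 intro!: power_mono)
  have entle: "Ent N (\<lambda>x. (g n x)\<^sup>2) \<le> C * D" for n
  proof -
    have "ennreal (Ent N (\<lambda>x. (g n x)\<^sup>2)) \<le> ennreal C * (\<integral>\<^sup>+x. ennreal ((norm (grad (g n) x))\<^sup>2) \<partial>N)"
    proof -
      have "\<forall>x. g n differentiable (at x)" using gD[of n] by (auto simp: gderiv_def differentiable_def)
      moreover have "continuous_on UNIV (grad (g n))"
        unfolding gg using denom gpos[of n]
        by (intro continuous_intros contf contg cont) (auto simp: less_imp_neq[symmetric])
      moreover have "\<forall>x. sqrt (e n) \<le> g n x \<and> g n x \<le> sqrt (e n + 1 / e n)"
        unfolding g_def using entropy_cutoff_bounds[OF e(1)] by blast
      moreover have "0 < sqrt (e n)" using e by simp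
      ultimately show ?thesis using lsb unfolding log_sobolev_bounded_def by blast
    qed
    also have "\<dots> \<le> ennreal C * (\<integral>\<^sup>+x. ennreal ((norm (grad f x))\<^sup>2) \<partial>N)"
      using ng by (intro mult_left_mono nn_integral_mono ennreal_leI power_mono) auto
    also have "\<dots> = ennreal (C * D)"
      using C ig by (simp add: nn_integral_eq_integral D_def ennreal_mult)
    finally show ?thesis using C by (simp add: D_def)
  qed
  have glim: "(\<lambda>n. (g n x)\<^sup>2) \<longlonglongrightarrow> (f x)\<^sup>2" for x
  proof -
    have "(\<lambda>n. e n + (f x)\<^sup>2 / (1 + e n * (f x)\<^sup>2)) \<longlonglongrightarrow> 0 + (f x)\<^sup>2 / (1 + 0 * (f x)\<^sup>2)"
      by (intro tendsto_intros elim) auto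
    then show ?thesis by (simp add: g2)
  qed
  define s where "s = (LINT x|N. (f x)\<^sup>2)"
  define sn where "sn n = (LINT x|N. (g n x)\<^sup>2)" for n
  have slim: "sn \<longlonglongrightarrow> s"
    unfolding sn_def s_def
  proof (rule integral_dominated_convergence[where w = "\<lambda>x. 1 + (f x)\<^sup>2"])
    \<comment> \<open>Since \<open>e n \<le> 1\<close>, the pointwise bound \<open>e n + f^2\<close>
      has a majorant free of \<open>n\<close>.\<close>
    show "AE x in N. norm ((g n x)\<^sup>2) \<le> 1 + (f x)\<^sup>2" for n
    proof (rule AE_I2)
      fix x
      show "norm ((g n x)\<^sup>2) \<le> 1 + (f x)\<^sup>2"
        using entropy_cutoff_bounds(3)[OF e(1)[of n], of "f x"] e(2)[of n] by (simp add: g_def)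
    qed
  qed (use i2 glim in auto)
  have snn: "0 \<le> sn n" for n unfolding sn_def by (intro integral_nonneg_AE) auto
  let ?q = "\<lambda>x. (f x)\<^sup>2 * ln ((f x)\<^sup>2)"
  \<comment> \<open>Fatou's lemma wants nonnegative integrands; the shift by 1 provides them because
    \<open>x * ln x \<ge> -1\<close>, and it adds exactly 1 to integrals over a probability
    space.\<close>
  have "(\<integral>\<^sup>+x. ennreal (?q x + 1) \<partial>N) = (\<integral>\<^sup>+x. liminf (\<lambda>n. ennreal ((g n x)\<^sup>2 * ln ((g n x)\<^sup>2) + 1)) \<partial>N)"
  proof (rule nn_integral_cong)
    fix x
    have "(\<lambda>n. ennreal ((g n x)\<^sup>2 * ln ((g n x)\<^sup>2) + 1)) \<longlonglongrightarrow> ennreal (?q x + 1)"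
      by (intro tendsto_ennrealI tendsto_intros tendsto_mult_ln_0 glim) auto
    then show "ennreal (?q x + 1) = liminf (\<lambda>n. ennreal ((g n x)\<^sup>2 * ln ((g n x)\<^sup>2) + 1))"
      by (intro lim_imp_Liminf[symmetric]) auto
  qed
  also have "\<dots> \<le> liminf (\<lambda>n. \<integral>\<^sup>+x. ennreal ((g n x)\<^sup>2 * ln ((g n x)\<^sup>2) + 1) \<partial>N)"
    by (rule nn_integral_liminf) measurable
  also have "\<dots> \<le> liminf (\<lambda>n. ennreal (C * D + sn n * ln (sn n) + 1))"
  proof (intro Liminf_mono always_eventually allI)
    fix n
    note il = integrable_mult_ln[OF hm hb, of n]
    have "(\<integral>\<^sup>+x. ennreal ((g n x)\<^sup>2 * ln ((g n x)\<^sup>2) + 1) \<partial>N) = ennreal (LINT x|N. (g n x)\<^sup>2 * ln ((g n x)\<^sup>2) + 1)"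
    proof (intro nn_integral_eq_integral AE_I2)
      show "0 \<le> (g n x)\<^sup>2 * ln ((g n x)\<^sup>2) + 1" for x
        using mult_ln_ge[of "(g n x)\<^sup>2"] by simp
    qed (use il in auto)
    also have "\<dots> = ennreal ((LINT x|N. (g n x)\<^sup>2 * ln ((g n x)\<^sup>2)) + 1)"
      using il by (simp add: prob_space)
    also have "\<dots> \<le> ennreal (C * D + sn n * ln (sn n) + 1)"
      using entle[of n] by (intro ennreal_leI) (simp add: Ent_def sn_def)
    finally show "(\<integral>\<^sup>+x. ennreal ((g n x)\<^sup>2 * ln ((g n x)\<^sup>2) + 1) \<partial>N) \<le> ennreal (C * D + sn n * ln (sn n) + 1)" .
  qed
  also have "\<dots> = ennreal (C * D + s * ln s + 1)"
    by (intro lim_imp_Liminf tendsto_ennrealI tendsto_intros tendsto_mult_ln_0 slim snn) auto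
  finally have le: "(\<integral>\<^sup>+x. ennreal (?q x + 1) \<partial>N) \<le> ennreal (C * D + s * ln s + 1)" .
  have qnn: "0 \<le> ?q x + 1" for x using mult_ln_ge[of "(f x)\<^sup>2"] by simp
  have iq1: "integrable N (\<lambda>x. ?q x + 1)"
    using le qnn by (intro integrableI_bounded) (auto simp: abs_of_nonneg less_top[symmetric] top_unique)
  then have "integrable N (\<lambda>x. (?q x + 1) - 1)" by (intro Bochner_Integration.integrable_diff) auto
  then have iq: "integrable N ?q" by simp
  have Dnn: "0 \<le> D" unfolding D_def by (intro integral_nonneg_AE) auto
  have "0 \<le> s" unfolding s_def by (intro integral_nonneg_AE) auto
  have "(LINT x|N. ?q x + 1) \<le> C * D + s * ln s + 1"
  proof -
    have "ennreal (LINT x|N. ?q x + 1) \<le> ennreal (C * D + s * ln s + 1)"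
      using le iq1 qnn by (subst (asm) nn_integral_eq_integral) auto
    \<comment> \<open>\<open>ennreal\<close> sends negative numbers to 0, so the inequality returns
      to the reals only once the right side is known to be nonnegative.\<close>
    moreover have "0 \<le> C * D + s * ln s + 1"
      using mult_nonneg_nonneg[OF C Dnn] mult_ln_ge[OF \<open>0 \<le> s\<close>] by linarith
    ultimately show ?thesis by (simp only: ennreal_le_iff)
  qed
  then have "Ent N (\<lambda>x. (f x)\<^sup>2) \<le> C * dirichlet_form N f"
    using iq by (simp add: Ent_def dirichlet_form_def D_def s_def prob_space)
  with iq show "integrable N ?q \<and> Ent N (\<lambda>x. (f x)\<^sup>2) \<le> C * dirichlet_form N f" by simp
qed

text \<open>The infimum is attained, since each \<open>f\<close> imposes a closed condition on the
  constant: a positive energy can be divided out, and at zero energy all admissible constants give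
  the same inequality. The given \<open>C\<close> makes the set of admissible constants
  nonempty.\<close>

lemma log_sobolev_C_LSI:
  assumes "0 \<le> C" "log_sobolev N C"
  shows "log_sobolev N (C_LSI N)" "C_LSI N \<le> C"
proof -
  let ?A = "{C. 0 \<le> C \<and> log_sobolev N C}"
  have bdd: "bdd_below ?A" by (rule bdd_belowI[of _ 0]) auto
  show "C_LSI N \<le> C" unfolding C_LSI_def using assms bdd by (intro cInf_lower) auto
  show "log_sobolev N (C_LSI N)"
    unfolding log_sobolev_def
  proof (intro allI impI conjI)
    fix f assume f: "lsi_test N f"
    then show "integrable N (\<lambda>x. (f x)\<^sup>2 * ln ((f x)\<^sup>2))"
      using assms by (auto simp: log_sobolev_def)
    have le: "Ent N (\<lambda>x. (f x)\<^sup>2) \<le> c * dirichlet_form N f" if "c \<in> ?A" for c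
      using that f by (auto simp: log_sobolev_def)
    have nn: "0 \<le> dirichlet_form N f"
      unfolding dirichlet_form_def by (intro integral_nonneg_AE) auto
    show "Ent N (\<lambda>x. (f x)\<^sup>2) \<le> C_LSI N * dirichlet_form N f"
    proof (cases "dirichlet_form N f = 0")
      case True
      then show ?thesis using le assms by fastforce
    next
      case False
      then have "Ent N (\<lambda>x. (f x)\<^sup>2) / dirichlet_form N f \<le> C_LSI N"
        unfolding C_LSI_def using nn le assms by (intro cInf_greatest) (auto simp: pos_divide_le_eq)
      then show ?thesis using False nn by (simp add: pos_divide_le_eq)
    qed
  qed
qed

section \<open>Linear change of variables\<close>

lemma Basis_vec_image: "(Basis :: (real^'n) set) = (\<lambda>i. axis i 1) ` UNIV"
  by (auto simp: Basis_vec_def)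

lemma inj_axis: "inj (\<lambda>i::'n::finite. axis i (1::real))"
  by (auto simp: inj_on_def axis_eq_axis)

lemma sum_Basis_vec: "(\<Sum>b\<in>Basis. f b) = (\<Sum>i\<in>UNIV. f (axis i 1 :: real^'n))"
  unfolding Basis_vec_image by (subst sum.reindex[OF inj_axis]) simp

lemma prod_Basis_vec: "(\<Prod>b\<in>Basis. f b) = (\<Prod>i\<in>UNIV. f (axis i 1 :: real^'n))"
  unfolding Basis_vec_image by (subst prod.reindex[OF inj_axis]) simp

text \<open>Singular matrices satisfy this vacuously, because the induction over elementary matrices
  also passes through matrices with a zero row.\<close>

definition lebesgue_scaling :: "real^'n^'n \<Rightarrow> bool" where
  "lebesgue_scaling A \<longleftrightarrow> (det A \<noteq> 0 \<longrightarrow>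
     (\<forall>g\<in>borel_measurable borel. (\<integral>\<^sup>+x. g x \<partial>lborel) = ennreal \<bar>det A\<bar> * (\<integral>\<^sup>+x. g (A *v x) \<partial>lborel)))"

lemma lebesgue_scalingI:
  assumes "\<bar>det A\<bar> = 1" "\<And>x. A *v x = T x"
    and "\<And>g. g \<in> borel_measurable borel \<Longrightarrow> (\<integral>\<^sup>+x. g (T x) \<partial>lborel) = (\<integral>\<^sup>+x. g x \<partial>lborel)"
  shows "lebesgue_scaling A"
  unfolding lebesgue_scaling_def assms(1,2) using assms(3) by simp

lemma lebesgue_scalingD:
  assumes "lebesgue_scaling A" "det A \<noteq> 0" "g \<in> borel_measurable borel"
  shows "(\<integral>\<^sup>+x. g x \<partial>lborel) = ennreal \<bar>det A\<bar> * (\<integral>\<^sup>+x. g (A *v x) \<partial>lborel)"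
  using assms unfolding lebesgue_scaling_def by blast

lemma measurable_matrix_vector_mult [measurable]: "(*v) A \<in> borel_measurable borel" for A :: "real^'n^'m"
  by (intro borel_measurable_continuous_onI continuous_intros)

lemma lebesgue_scaling_mult:
  assumes "lebesgue_scaling A" "lebesgue_scaling B"
  shows "lebesgue_scaling (A ** B)"
  unfolding lebesgue_scaling_def
proof (intro impI ballI)
  fix g :: "real^'a \<Rightarrow> ennreal"
  assume d: "det (A ** B) \<noteq> 0" and g[measurable]: "g \<in> borel_measurable borel"
  have dd: "det A \<noteq> 0" "det B \<noteq> 0" using d by (auto simp: det_mul)
  have "(\<integral>\<^sup>+x. g x \<partial>lborel) = ennreal \<bar>det A\<bar> * (\<integral>\<^sup>+x. g (A *v x) \<partial>lborel)"
    by (rule lebesgue_scalingD[OF assms(1) dd(1) g])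
  also have "(\<integral>\<^sup>+x. g (A *v x) \<partial>lborel) = ennreal \<bar>det B\<bar> * (\<integral>\<^sup>+x. g (A *v (B *v x)) \<partial>lborel)"
    by (rule lebesgue_scalingD[OF assms(2) dd(2)]) measurable
  finally show "(\<integral>\<^sup>+x. g x \<partial>lborel) = ennreal \<bar>det (A ** B)\<bar> * (\<integral>\<^sup>+x. g ((A ** B) *v x) \<partial>lborel)"
    by (simp add: det_mul abs_mult ennreal_mult mult.assoc matrix_vector_mul_assoc)
qed

lemma lebesgue_scaling_diagonal:
  fixes A :: "real^'n^'n"
  assumes A: "\<And>i j. i \<noteq> j \<Longrightarrow> A $ i $ j = 0"
  shows "lebesgue_scaling A"
  unfolding lebesgue_scaling_def
proof (intro impI ballI)
  fix g :: "real^'n \<Rightarrow> ennreal"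
  assume d: "det A \<noteq> 0" and g[measurable]: "g \<in> borel_measurable borel"
  have det: "det A = (\<Prod>i\<in>UNIV. A $ i $ i)" using A by (rule det_diagonal)
  define c where "c b = (A *v b) \<bullet> b" for b :: "real^'n"
  have c: "c (axis i 1) = A $ i $ i" for i
    by (simp add: c_def inner_axis matrix_vector_mult_basis column_def)
  have T: "0 + (\<Sum>j\<in>Basis. (c j * (x \<bullet> j)) *\<^sub>R j) = A *v x" for x
  proof -
    have "(\<Sum>j\<in>Basis. (c j * (x \<bullet> j)) *\<^sub>R j) = (\<Sum>i\<in>UNIV. (A $ i $ i * x $ i) *\<^sub>R axis i 1)"
      by (simp add: sum_Basis_vec c inner_axis)
    also have "\<dots> = A *v x"
    proof -
      have "(\<Sum>j\<in>UNIV. A $ i $ j * x $ j) = A $ i $ i * x $ i" for i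
        using A by (subst sum.remove[of _ i]) (auto intro!: sum.neutral)
      then show ?thesis
        by (simp add: vec_eq_iff matrix_vector_mult_def axis_def if_distrib cong: if_cong)
    qed
    finally show ?thesis by simp
  qed
  have "c j \<noteq> 0" if "j \<in> Basis" for j
    using that d unfolding det by (auto simp: Basis_vec_def c)
  note eq = lborel_affine_euclidean[of c 0, unfolded T, OF this]
  have "(\<Prod>j\<in>Basis. \<bar>c j\<bar>) = \<bar>det A\<bar>"
    unfolding det by (simp add: prod_Basis_vec c abs_prod)
  from eq[unfolded this]
  have "(\<integral>\<^sup>+x. g x \<partial>lborel) = (\<integral>\<^sup>+x. g x \<partial>density (distr lborel borel (\<lambda>x. A *v x)) (\<lambda>_. ennreal \<bar>det A\<bar>))"
    by (rule arg_cong)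
  also have "\<dots> = ennreal \<bar>det A\<bar> * (\<integral>\<^sup>+x. g (A *v x) \<partial>lborel)"
    by (subst nn_integral_density) (auto simp: nn_integral_distr nn_integral_cmult)
  finally show "(\<integral>\<^sup>+x. g x \<partial>lborel) = ennreal \<bar>det A\<bar> * (\<integral>\<^sup>+x. g (A *v x) \<partial>lborel)" .
qed

text \<open>The preimage of a box is the box with its corners permuted by \<open>inv p\<close>, and
  reindexing the product of the side lengths leaves the volume unchanged.\<close>

lemma lborel_eq_distr_permute:
  fixes p :: "'n::finite \<Rightarrow> 'n"
  assumes p: "p permutes UNIV"
  shows "(lborel :: (real^'n) measure) = distr lborel borel (\<lambda>x. \<chi> i. x $ p i)"
proof (rule lborel_eqI)
  have T[measurable]: "(\<lambda>x::real^'n. \<chi> i. x $ p i) \<in> borel_measurable borel"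
    by (intro borel_measurable_continuous_onI continuous_intros)
  fix l u :: "real^'n" assume lu: "\<And>b. b \<in> Basis \<Longrightarrow> l \<bullet> b \<le> u \<bullet> b"
  let ?q = "inv p"
  have q: "?q (p i) = i" "p (?q i) = i" for i
    using permutes_inverses[OF p] by auto
  let ?s = "\<lambda>x::real^'n. \<chi> i. x $ ?q i"
  have le: "l $ i \<le> u $ i" for i using lu[of "axis i 1"] by (simp add: inner_axis)
  have "(\<lambda>x. \<chi> i. x $ p i) -` box l u = box (?s l) (?s u)"
    by (auto simp: mem_box_cart) (metis q)+
  then have "emeasure (distr lborel borel (\<lambda>x. \<chi> i. x $ p i)) (box l u) = emeasure lborel (box (?s l) (?s u))"
    by (simp add: emeasure_distr)
  also have "\<dots> = (\<Prod>b\<in>Basis. (?s u - ?s l) \<bullet> b)"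
    using le by (intro emeasure_lborel_box) (auto simp: Basis_vec_def inner_axis)
  also have "(\<Prod>b\<in>Basis. (?s u - ?s l) \<bullet> b) = (\<Prod>b\<in>Basis. (u - l) \<bullet> b)"
  proof -
    have e: "(\<Prod>b\<in>Basis. v \<bullet> b) = (\<Prod>i\<in>UNIV. v $ i)" for v :: "real^'n"
      by (simp add: prod_Basis_vec inner_axis)
    have "(\<Prod>i\<in>UNIV. (u - l) $ ?q i) = (\<Prod>i\<in>UNIV. (u - l) $ i)"
      using prod.permute[OF permutes_inv[OF p], of "\<lambda>i. (u - l) $ i"] by (simp add: o_def)
    then show ?thesis unfolding e by simp
  qed
  finally show "emeasure (distr lborel borel (\<lambda>x. \<chi> i. x $ p i)) (box l u) = (\<Prod>b\<in>Basis. (u - l) \<bullet> b)" .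
qed simp

text \<open>With all coordinates but \<open>e\<close> fixed, the shear translates the
  \<open>e\<close>-coordinate by the \<open>e'\<close>-coordinate, which is constant there.
  Integrating along \<open>e\<close> first reduces the claim to translation invariance on the
  line.\<close>

lemma nn_integral_lborel_shear:
  fixes g :: "'a::euclidean_space \<Rightarrow> ennreal"
  assumes e: "e \<in> Basis" "e' \<in> Basis" "e \<noteq> e'" and g[measurable]: "g \<in> borel_measurable borel"
  shows "(\<integral>\<^sup>+x. g (x + (x \<bullet> e') *\<^sub>R e) \<partial>lborel) = (\<integral>\<^sup>+x. g x \<partial>lborel)"
proof -
  let ?S = "\<lambda>x::'a \<Rightarrow> real. \<Sum>b\<in>Basis. x b *\<^sub>R b"
  let ?B = "Basis - {e}"
  interpret product_sigma_finite "\<lambda>_::'a. lborel :: real measure" by standard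
  have B: "insert e ?B = Basis" using e by auto
  have S[measurable]: "?S \<in> measurable (\<Pi>\<^sub>M b\<in>Basis. lborel) borel" by measurable
  have F: "(\<integral>\<^sup>+x. k x \<partial>lborel) = (\<integral>\<^sup>+x. (\<integral>\<^sup>+t. k (?S (x(e := t))) \<partial>lborel) \<partial>(\<Pi>\<^sub>M b\<in>?B. lborel))"
    if [measurable]: "k \<in> borel_measurable borel" for k :: "'a \<Rightarrow> ennreal"
  proof -
    have "(\<integral>\<^sup>+x. k x \<partial>lborel) = (\<integral>\<^sup>+x. k (?S x) \<partial>(\<Pi>\<^sub>M b\<in>insert e ?B. lborel))"
      unfolding B by (subst lborel_eq) (rule nn_integral_distr; measurable)
    also have "\<dots> = (\<integral>\<^sup>+x. (\<integral>\<^sup>+t. k (?S (x(e := t))) \<partial>lborel) \<partial>(\<Pi>\<^sub>M b\<in>?B. lborel))"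
      by (rule product_nn_integral_insert) (simp_all add: B del: insert_Diff_single)
    finally show ?thesis .
  qed
  have Sx: "?S (x(e := t)) + (?S (x(e := t)) \<bullet> e') *\<^sub>R e = ?S (x(e := x e' + 1 * t))" for x t
  proof -
    have 1: "?S y \<bullet> e' = y e'" for y using e by simp
    have 2: "?S (x(e := s)) = s *\<^sub>R e + (\<Sum>b\<in>?B. x b *\<^sub>R b)" for s
      using e by (subst sum.remove[of _ e]) auto
    show ?thesis unfolding 1 using e unfolding 2 by (simp add: scaleR_left_distrib)
  qed
  have "(\<integral>\<^sup>+x. g (x + (x \<bullet> e') *\<^sub>R e) \<partial>lborel)
      = (\<integral>\<^sup>+x. (\<integral>\<^sup>+t. g (?S (x(e := x e' + 1 * t))) \<partial>lborel) \<partial>(\<Pi>\<^sub>M b\<in>?B. lborel))"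
    by (subst F) (simp_all only: Sx, measurable)
  also have "\<dots> = (\<integral>\<^sup>+x. (\<integral>\<^sup>+t. g (?S (x(e := t))) \<partial>lborel) \<partial>(\<Pi>\<^sub>M b\<in>?B. lborel))"
  proof (rule nn_integral_cong)
    fix x assume x: "x \<in> space (\<Pi>\<^sub>M b\<in>?B. lborel :: real measure)"
    have "?S (x(e := t)) = t *\<^sub>R e + (\<Sum>b\<in>?B. x b *\<^sub>R b)" for t
      using e by (subst sum.remove[of _ e]) auto
    then have "(\<lambda>t. g (?S (x(e := t)))) \<in> borel_measurable borel" by simp
    from nn_integral_real_affine[OF this, of 1 "x e'"]
    show "(\<integral>\<^sup>+t. g (?S (x(e := x e' + 1 * t))) \<partial>lborel) = (\<integral>\<^sup>+t. g (?S (x(e := t))) \<partial>lborel)" by simp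
  qed
  also have "\<dots> = (\<integral>\<^sup>+x. g x \<partial>lborel)" by (rule F[symmetric]) fact
  finally show ?thesis .
qed

text \<open>The library's change of variables for linear maps needs a well-ordered index type; the reduction to
  elementary matrices does not.\<close>

lemma nn_integral_lborel_linear:
  fixes L :: "real^'n^'n"
  assumes "det L \<noteq> 0" "g \<in> borel_measurable borel"
  shows "(\<integral>\<^sup>+x. g x \<partial>lborel) = ennreal \<bar>det L\<bar> * (\<integral>\<^sup>+x. g (L *v x) \<partial>lborel)"
proof -
  have "lebesgue_scaling L"
  proof (induction L rule: induct_matrix_elementary_alt)
    case (1 A B)
    then show ?case by (rule lebesgue_scaling_mult)
  next
    case (2 A i)
    then have "det A = 0" by (rule det_zero_row)
    then show ?case by (simp add: lebesgue_scaling_def)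
  next
    case (3 A)
    then show ?case by (rule lebesgue_scaling_diagonal)
  next
    case (4 m n)
    let ?p = "Transposition.transpose m n"
    let ?A = "\<chi> i j. mat 1 $ i $ ?p j :: real^'n^'n"
    have p: "?p permutes UNIV" by (rule permutes_swap_id) auto
    have "\<bar>det ?A\<bar> = 1"
      using 4 by (subst det_permute_columns[OF p]) (simp add: sign_swap_id)
    moreover have "?A *v x = (\<chi> i. x $ ?p i)" for x
    proof -
      have "(\<Sum>j\<in>UNIV. (if i = ?p j then 1 else 0) * x $ j) = x $ ?p i" for i
      proof -
        have "i = ?p j \<longleftrightarrow> j = ?p i" for j by (metis transpose_involutory)
        then show ?thesis by (simp add: if_distrib[of "\<lambda>c. c * _"] cong: if_cong)
      qed
      then show ?thesis by (simp add: vec_eq_iff matrix_vector_mult_def mat_def)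
    qed
    moreover have "(\<integral>\<^sup>+x. g (\<chi> i. x $ ?p i) \<partial>lborel) = (\<integral>\<^sup>+x. g x \<partial>lborel)"
      if [measurable]: "g \<in> borel_measurable borel" for g :: "real^'n \<Rightarrow> ennreal"
    proof -
      have [measurable]: "(\<lambda>x::real^'n. \<chi> i. x $ ?p i) \<in> borel_measurable borel"
        by (intro borel_measurable_continuous_onI continuous_intros)
      show ?thesis by (subst (2) lborel_eq_distr_permute[OF p]) (simp add: nn_integral_distr)
    qed
    ultimately show ?case by (rule lebesgue_scalingI)
  next
    case (5 m n)
    let ?A = "\<chi> i j. of_bool (i = m \<and> j = n \<or> i = j) :: real^'n^'n"
    \<comment> \<open>The identity with row \<open>n\<close> added to row \<open>m\<close>, an
      operation that preserves the determinant.\<close>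
    have "?A = (\<chi> k. if k = m then row m (mat 1) + 1 *s row n (mat 1) else row k (mat 1))"
      using 5 by (auto simp: vec_eq_iff row_def mat_def)
    then have "det ?A = 1" using det_row_operation[OF 5, of "mat 1 :: real^'n^'n" 1] by (simp only: det_I)
    moreover have "?A *v x = x + (x \<bullet> axis n 1) *\<^sub>R axis m 1" for x
    proof -
      have "(\<Sum>j\<in>UNIV. of_bool (i = m \<and> j = n \<or> i = j) * x $ j)
          = (\<Sum>j\<in>UNIV. (if j = i then x $ j else 0) + (if j = n then (if i = m then x $ j else 0) else 0))" for i
        using 5 by (intro sum.cong) auto
      then have "(\<Sum>j\<in>UNIV. of_bool (i = m \<and> j = n \<or> i = j) * x $ j) = x $ i + (if i = m then x $ n else 0)" for i
        by (simp add: sum.distrib)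
      moreover have "x \<bullet> axis n 1 = x $ n" by (simp add: inner_axis)
      ultimately show ?thesis by (simp add: vec_eq_iff matrix_vector_mult_def axis_def)
    qed
    moreover have "axis m 1 \<in> (Basis :: (real^'n) set)" "axis n 1 \<in> (Basis :: (real^'n) set)" "axis m (1::real) \<noteq> axis n 1"
      using 5 by (auto simp: Basis_vec_def axis_eq_axis)
    ultimately show ?case
      by (intro lebesgue_scalingI[OF _ _ nn_integral_lborel_shear]) auto
  qed
  then show ?thesis using assms by (rule lebesgue_scalingD)
qed

section \<open>Gaussian densities\<close>

lemma matrix_inv_mult:
  assumes "invertible A"
  shows "A ** matrix_inv A = mat 1" "matrix_inv A ** A = mat 1"
  using someI_ex[OF assms[unfolded invertible_def]] unfolding matrix_inv_def by auto

lemma inner_matrix_vector_mult: "(A *v x) \<bullet> y = x \<bullet> (transpose A *v y)" for A :: "real^'n^'m"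
  by (simp only: transpose_matrix_vector dot_lmul_matrix inner_commute[of "A *v x" y] inner_commute[of x "y v* A"])

lemma pos_def_matrixD:
  assumes "pos_def_matrix S"
  shows "transpose S = S" "v \<noteq> 0 \<Longrightarrow> 0 < v \<bullet> (S *v v)"
    "x \<bullet> (S *v y) = (S *v x) \<bullet> y"
  using assms by (auto simp: pos_def_matrix_def inner_matrix_vector_mult[of S x y])

text \<open>Gram-Schmidt for the form \<open>x \<bullet> (S *v y)\<close>, without projections:
  below full dimension some nonzero \<open>v\<close> is Euclidean-orthogonal to all
  \<open>S *v u\<close>, hence \<open>S\<close>-orthogonal to \<open>U\<close>, and division by
  \<open>r\<close> normalizes it.\<close>

lemma pos_def_orthonormal_set:
  fixes S :: "real^'n^'n"
  assumes S: "pos_def_matrix S" and "k \<le> CARD('n)"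
  shows "\<exists>U. finite U \<and> card U = k \<and> (\<forall>u\<in>U. \<forall>w\<in>U. u \<bullet> (S *v w) = (if u = w then 1 else 0))"
  using assms(2)
proof (induction k)
  case 0
  show ?case by (intro exI[of _ "{}"]) auto
next
  case (Suc k)
  then obtain U where U: "finite U" "card U = k"
    "\<And>u w. u \<in> U \<Longrightarrow> w \<in> U \<Longrightarrow> u \<bullet> (S *v w) = (if u = w then 1 else 0)" by auto
  have "dim ((*v) S ` U) \<le> card ((*v) S ` U)" 
    using U(1) by (intro dim_le_card span_superset) simp
  also have "\<dots> \<le> k" using U card_image_le by blast
  also have "\<dots> < DIM(real^'n)" using Suc.prems by simp
  finally obtain v where v: "v \<noteq> 0" "\<And>y. y \<in> span ((*v) S ` U) \<Longrightarrow> orthogonal v y"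
    using orthogonal_to_subspace_exists by blast
  define r where "r = sqrt (v \<bullet> (S *v v))"
  have r: "0 < r" "r * r = v \<bullet> (S *v v)" using pos_def_matrixD(2)[OF S v(1)] by (auto simp: r_def)
  define z where "z = (1 / r) *\<^sub>R v"
  have zz: "z \<bullet> (S *v z) = 1"
    using r by (simp add: z_def matrix_vector_mult_scaleR flip: r(2))
  have zu: "z \<bullet> (S *v u) = 0" if "u \<in> U" for u
    using v(2)[of "S *v u"] that by (simp add: z_def orthogonal_def span_base)
  have uz: "u \<bullet> (S *v z) = 0" if "u \<in> U" for u
    using zu[OF that] pos_def_matrixD(3)[OF S, of u z] by (simp add: inner_commute)
  have "z \<notin> U" using zz zu by force
  then show ?case
    using U zz zu uz by (intro exI[of _ "insert z U"]) auto
qed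

text \<open>If the columns of \<open>C\<close> are orthonormal for \<open>S\<close>, then
  \<open>transpose C ** S ** C\<close> is the identity. So \<open>Q = transpose C ** S\<close>
  inverts \<open>C\<close>, and \<open>S = transpose Q ** Q\<close>; neither a square root nor a
  diagonalization of \<open>S\<close> is involved.\<close>

lemma pos_def_factorization:
  fixes S :: "real^'n^'n"
  assumes S: "pos_def_matrix S"
  obtains A :: "real^'n^'n" where "invertible A" "S = A ** transpose A"
proof -
  obtain U where U: "finite U" "card U = CARD('n)"
    "\<And>u w. u \<in> U \<Longrightarrow> w \<in> U \<Longrightarrow> u \<bullet> (S *v w) = (if u = w then 1 else 0)"
    using pos_def_orthonormal_set[OF S order_refl] by auto
  obtain c where c: "bij_betw c (UNIV :: 'n set) U"
    using U finite_same_card_bij[of "UNIV :: 'n set" U] by auto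
  define C :: "real^'n^'n" where "C = (\<chi> i j. c j $ i)"
  define Q where "Q = transpose C ** S"
  have col: "column j C = c j" for j by (simp add: C_def column_def vec_eq_iff)
  have QC: "Q ** C = mat 1"
  proof -
    have "(Q ** C) $ i $ j = c i \<bullet> (S *v c j)" for i j
    proof -
      have "(Q ** C) $ i $ j = row i (transpose C) \<bullet> (S *v column j C)"
        unfolding Q_def matrix_mul_assoc[symmetric]
        by (simp add: matrix_matrix_mult_def matrix_vector_mult_def inner_vec_def row_def column_def)
      then show ?thesis by (simp add: row_transpose col)
    qed
    moreover have "c i \<in> U" for i using c by (auto simp: bij_betw_def)
    moreover have "c i = c j \<longleftrightarrow> i = j" for i j using c by (auto simp: bij_betw_def inj_on_def)
    ultimately show ?thesis using U(3) by (simp add: vec_eq_iff mat_def)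
  qed
  then have CQ: "C ** Q = mat 1" by (simp add: matrix_left_right_inverse)
  show ?thesis
  proof (rule that[of "transpose Q"])
    have "transpose C ** transpose Q = mat 1"
      by (simp flip: matrix_transpose_mul add: QC transpose_mat)
    then show "invertible (transpose Q)" by (auto simp: invertible_left_inverse)
    have TQ: "transpose Q = S ** C" using pos_def_matrixD(1)[OF S] by (simp add: Q_def matrix_transpose_mul)
    have "transpose Q ** transpose (transpose Q) = S ** C ** Q"
      unfolding transpose_transpose by (simp only: TQ)
    then show "S = transpose Q ** transpose (transpose Q)"
      by (simp only: matrix_mul_assoc[symmetric] CQ matrix_mul_rid)
  qed
qed

text \<open>\<open>lambda_max\<close> is a \<open>Max\<close>, which is informative only over a
  finite set. Symmetry makes eigenvectors of distinct eigenvalues orthogonal, hence independent,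
  hence finite in number.\<close>

lemma finite_eigenvalues:
  fixes S :: "real^'n^'n"
  assumes S: "pos_def_matrix S"
  shows "finite (eigenvalues S)"
proof -
  obtain e where e: "\<And>l. l \<in> eigenvalues S \<Longrightarrow> e l \<noteq> 0 \<and> S *v e l = l *\<^sub>R e l"
  proof -
    have "\<forall>l\<in>eigenvalues S. \<exists>v. v \<noteq> 0 \<and> S *v v = l *\<^sub>R v" by (simp add: eigenvalues_def)
    from bchoice[OF this] show ?thesis using that by blast
  qed
  have inj: "inj_on e (eigenvalues S)"
  proof (rule inj_onI)
    fix l l' assume l: "l \<in> eigenvalues S" "l' \<in> eigenvalues S" "e l = e l'"
    then have "l *\<^sub>R e l = l' *\<^sub>R e l" using e by metis
    then show "l = l'" using e[OF l(1)] by simp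
  qed
  have orth: "e l \<bullet> e l' = 0" if l: "l \<in> eigenvalues S" "l' \<in> eigenvalues S" "l \<noteq> l'" for l l'
  proof -
    have "l' * (e l \<bullet> e l') = l * (e l \<bullet> e l')"
      using pos_def_matrixD(3)[OF S, of "e l" "e l'"] e[OF l(1)] e[OF l(2)] by simp
    then show ?thesis using l(3) by simp
  qed
  have "independent (e ` eigenvalues S)"
    using e orth by (intro pairwise_orthogonal_independent) (auto simp: pairwise_def orthogonal_def)
  then have "finite (e ` eigenvalues S)" by (rule finiteI_independent)
  then show ?thesis using inj by (rule finite_imageD)
qed

text \<open>The maximum \<open>l\<close> of the Rayleigh quotient, attained on the unit sphere by
  compactness, is itself an eigenvalue and therefore at most \<open>lambda_max S\<close>.\<close>

lemma inner_le_lambda_max: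
  fixes S :: "real^'n^'n"
  assumes S: "pos_def_matrix S"
  shows "v \<bullet> (S *v v) \<le> lambda_max S * (norm v)\<^sup>2"
proof -
  obtain u where u: "norm u = 1" "\<And>y. norm y = 1 \<Longrightarrow> y \<bullet> (S *v y) \<le> u \<bullet> (S *v u)"
  proof -
    have "compact (sphere (0::real^'n) 1)" "sphere (0::real^'n) 1 \<noteq> {}" by auto
    moreover have "continuous_on (sphere 0 1) (\<lambda>y. y \<bullet> (S *v y))" by (intro continuous_intros)
    ultimately show ?thesis using continuous_attains_sup[of "sphere 0 1" "\<lambda>y. y \<bullet> (S *v y)"] that by auto
  qed
  define l where "l = u \<bullet> (S *v u)"
  define q where "q w = l * (w \<bullet> w) - w \<bullet> (S *v w)" for w
  have le: "w \<bullet> (S *v w) \<le> l * (norm w)\<^sup>2" for w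
  proof (cases "w = 0")
    case False
    have "((1 / norm w) *\<^sub>R w) \<bullet> (S *v ((1 / norm w) *\<^sub>R w)) \<le> l"
      unfolding l_def using False by (intro u) simp
    then show ?thesis using False by (simp add: matrix_vector_mult_scaleR field_simps power2_eq_square)
  qed simp
  then have qnn: "0 \<le> q w" for w by (simp add: q_def power2_norm_eq_inner)
  text \<open>The nonnegative form \<open>q\<close> vanishes at \<open>u\<close>, so its derivative does too.\<close>
  define d where "d = l *\<^sub>R u - S *v u"
  have "q u = 0" using u(1) by (simp add: q_def l_def[symmetric] power2_norm_eq_inner[symmetric])
  then have exp: "q (u + t *\<^sub>R d) = 2 * t * (norm d)\<^sup>2 + t\<^sup>2 * q d" for t
  proof -
    have s: "d \<bullet> (S *v u) = u \<bullet> (S *v d)" using pos_def_matrixD(3)[OF S, of u d] by (simp add: inner_commute)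
    have nd: "(norm d)\<^sup>2 = l * (u \<bullet> d) - u \<bullet> (S *v d)"
      unfolding s[symmetric] by (simp add: power2_norm_eq_inner inner_diff_left d_def inner_diff_right inner_commute algebra_simps)
    show ?thesis
      using \<open>q u = 0\<close> unfolding nd
      by (simp add: q_def matrix_vector_right_distrib matrix_vector_mult_scaleR inner_add_left inner_add_right s
          inner_commute[of d u] power2_eq_square algebra_simps)
  qed
  have "d = 0"
  proof (rule ccontr)
    assume "d \<noteq> 0"
    \<comment> \<open>Negative, and small enough for the linear term of
      \<open>q (u + t *\<^sub>R d)\<close> to outweigh the quadratic one, so that \<open>q\<close>
      would become negative. The \<open>+ 1\<close> keeps the denominator positive.\<close>
    define t where "t = - ((norm d)\<^sup>2 / (q d + 1))"
    have n: "0 < (norm d)\<^sup>2" using \<open>d \<noteq> 0\<close> by simp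
    have t: "t < 0" unfolding t_def using n qnn[of d] by (simp add: divide_pos_pos)
    have "- ((norm d)\<^sup>2) \<le> t * q d"
      unfolding t_def using n qnn[of d] by (simp add: field_simps)
    then have "0 < 2 * (norm d)\<^sup>2 + t * q d" using n by linarith
    then have "t * (2 * (norm d)\<^sup>2 + t * q d) < 0" using t by (simp add: mult_neg_pos)
    then show False using exp[of t] qnn[of "u + t *\<^sub>R d"] by (simp add: power2_eq_square algebra_simps)
  qed
  then have "l \<in> eigenvalues S"
    unfolding eigenvalues_def d_def using u(1) by (auto intro!: exI[of _ u])
  then have "l \<le> lambda_max S"
    unfolding lambda_max_def using finite_eigenvalues[OF S] by simp
  then have "l * (norm v)\<^sup>2 \<le> lambda_max S * (norm v)\<^sup>2" by (rule mult_right_mono) simp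
  then show ?thesis using le[of v] by linarith
qed

lemma lambda_max_nonneg:
  fixes S :: "real^'n^'n"
  assumes S: "pos_def_matrix S"
  shows "0 \<le> lambda_max S"
  using inner_le_lambda_max[OF S, of "axis undefined 1"] pos_def_matrixD(2)[OF S, of "axis undefined 1"]
  by (simp add: axis_eq_0_iff)

section \<open>Powers of Gaussian densities as images of the standard Gaussian\<close>

lemma nn_integral_lborel_affine:
  fixes L :: "real^'n^'n" and m :: "real^'n"
  assumes L: "det L \<noteq> 0" and g[measurable]: "g \<in> borel_measurable borel"
  shows "(\<integral>\<^sup>+x. g x \<partial>lborel) = ennreal \<bar>det L\<bar> * (\<integral>\<^sup>+y. g (m + L *v y) \<partial>lborel)"
proof -
  have "(\<integral>\<^sup>+x. g x \<partial>lborel) = (\<integral>\<^sup>+x. g x \<partial>distr lborel borel ((+) m))"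
    by (simp only: lborel_distr_plus)
  also have "\<dots> = (\<integral>\<^sup>+x. g (m + x) \<partial>lborel)"
    by (rule nn_integral_distr) auto
  also have "\<dots> = ennreal \<bar>det L\<bar> * (\<integral>\<^sup>+y. g (m + L *v y) \<partial>lborel)"
    by (rule nn_integral_lborel_linear[OF L]) measurable
  finally show ?thesis .
qed

text \<open>For positive definite \<open>S\<close> and \<open>0 < b\<close> this is the integral of
  \<open>gauss m S x powr b\<close>, a multiple of the Gaussian density with covariance
  \<open>S / b\<close>. It does not depend on the mean.\<close>

definition gauss_mass :: "real^'n^'n \<Rightarrow> real \<Rightarrow> real" where
  "gauss_mass S b = b powr (- real CARD('n) / 2) * ((2 * pi) ^ CARD('n) * det S) powr ((1 - b) / 2)"

lemma det_pos_def:
  fixes S :: "real^'n^'n"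
  assumes S: "pos_def_matrix S"
  shows "0 < det S"
proof -
  obtain A :: "real^'n^'n" where A: "invertible A" "S = A ** transpose A"
    using pos_def_factorization[OF S] by metis
  then have "det S = (det A)\<^sup>2" by (simp add: det_mul det_transpose power2_eq_square)
  then show ?thesis using A(1) by (simp add: invertible_det_nz)
qed

lemma gauss_pos:
  fixes S :: "real^'n^'n"
  assumes S: "pos_def_matrix S"
  shows "0 < gauss m S x"
  using det_pos_def[OF S] by (simp add: gauss_def)

lemma continuous_on_gauss: "continuous_on UNIV (gauss m S)"
  unfolding gauss_def by (cases "sqrt ((2 * pi) ^ CARD('a) * det S) = 0")
    (auto intro!: continuous_intros bounded_linear.continuous_on[OF matrix_vector_mul_bounded_linear])

lemma gauss_mass_pos:
  fixes S :: "real^'n^'n"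
  assumes "pos_def_matrix S" "0 < b"
  shows "0 < gauss_mass S b"
  using assms det_pos_def[of S] by (simp add: gauss_mass_def)

text \<open>With \<open>S = A ** transpose A\<close> and \<open>L = A / sqrt b\<close>, the map
  \<open>m + L *v y\<close> gives the standard Gaussian mean \<open>m\<close> and covariance
  \<open>S / b\<close>. The operator bound is \<open>inner_le_lambda_max\<close>, because the
  squared norm of \<open>transpose A *v v\<close> equals
  \<open>v \<bullet> (S *v v)\<close>.\<close>

lemma gauss_powr_affine:
  fixes S :: "real^'n^'n" and m :: "real^'n"
  assumes S: "pos_def_matrix S" and b: "0 < b"
  obtains L :: "real^'n^'n" where "det L \<noteq> 0" "\<And>v. (norm (transpose L *v v))\<^sup>2 \<le> lambda_max S / b * (norm v)\<^sup>2"
    "\<And>y. \<bar>det L\<bar> * gauss m S (m + L *v y) powr b = gauss_mass S b * gaussian_pdf y"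
proof -
  obtain A :: "real^'n^'n" where A: "invertible A" "S = A ** transpose A"
    using pos_def_factorization[OF S] by metis
  define c where "c = 1 / sqrt b"
  have c: "0 < c" "c * c = 1 / b" using b by (auto simp: c_def)
  define L where "L = c *\<^sub>R A"
  have Lv: "L *v y = c *\<^sub>R (A *v y)" for y by (simp add: L_def scaleR_matrix_vector_assoc)
  have LTv: "transpose L *v y = c *\<^sub>R (transpose A *v y)" for y
    by (simp only: L_def transpose_scalar scaleR_matrix_vector_assoc)
  have "det L = c ^ CARD('n) * det A"
  proof -
    have "L = (\<chi> i. c *s (A $ i))" by (simp add: L_def vec_eq_iff)
    then have "det L = prod (\<lambda>_. c) (UNIV :: 'n set) * det (\<chi> i. A $ i)" by (simp only: det_rows_mul)
    then show ?thesis by simp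
  qed
  then have dL: "\<bar>det L\<bar> = b powr (- real CARD('n) / 2) * sqrt (det S)"
  proof -
    have "sqrt (det S) = \<bar>det A\<bar>" by (simp add: A(2) det_mul det_transpose)
    moreover have "c ^ CARD('n) = b powr (- real CARD('n) / 2)"
      using b c(1) by (simp add: powr_realpow[symmetric] c_def powr_half_sqrt[symmetric] powr_powr powr_minus_divide[symmetric])
    ultimately show ?thesis using \<open>det L = _\<close> c by (simp add: abs_mult)
  qed
  have S1: "S ** matrix_inv S = mat 1"
    using det_pos_def[OF S] matrix_inv_mult[of S] by (auto simp: invertible_det_nz)
  \<comment> \<open>\<open>S ** matrix_inv S = mat 1\<close> makes
    \<open>transpose A ** matrix_inv S\<close> a right inverse of \<open>A\<close>; for square
    matrices it is then a left inverse.\<close>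
  then have "(transpose A ** matrix_inv S) ** A = mat 1"
    unfolding matrix_left_right_inverse[of _ A] by (simp add: A(2) matrix_mul_assoc)
  then have quad: "(A *v y) \<bullet> (matrix_inv S *v (A *v y)) = (norm y)\<^sup>2" for y
    by (simp add: inner_matrix_vector_mult[of A y] matrix_vector_mul_assoc matrix_mul_assoc power2_norm_eq_inner)
  let ?D = "(2 * pi) ^ CARD('n) * det S"
  have D: "0 < ?D" using det_pos_def[OF S] by simp
  show ?thesis
  proof (rule that[of L])
    show "det L \<noteq> 0" using A(1) c \<open>det L = _\<close> by (simp add: invertible_det_nz)
    fix v :: "real^'n"
    have "(norm (transpose L *v v))\<^sup>2 = (c * c) * (norm (transpose A *v v))\<^sup>2"
      unfolding LTv by (simp add: power_mult_distrib power2_eq_square)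
    also have "(norm (transpose A *v v))\<^sup>2 = v \<bullet> (S *v v)"
      by (simp only: power2_norm_eq_inner inner_matrix_vector_mult[of "transpose A"] transpose_transpose
          matrix_vector_mul_assoc A(2)[symmetric])
    also have "c * c * (v \<bullet> (S *v v)) \<le> c * c * (lambda_max S * (norm v)\<^sup>2)"
      using c(1) by (intro mult_left_mono inner_le_lambda_max S) simp
    finally show "(norm (transpose L *v v))\<^sup>2 \<le> lambda_max S / b * (norm v)\<^sup>2" by (simp add: c)
  next
    fix y :: "real^'n"
    have "gauss m S (m + L *v y) = exp (- ((norm y)\<^sup>2 / b) / 2) / sqrt ?D"
      using c b by (simp add: gauss_def Lv matrix_vector_mult_scaleR quad mult.assoc[symmetric])
    then have "gauss m S (m + L *v y) powr b = exp (- (norm y)\<^sup>2 / 2) / sqrt ?D powr b"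
      using D b by (simp add: powr_divide powr_def[of "exp _"])
    also have "\<dots> = gaussian_pdf y * (sqrt (2 * pi) ^ CARD('n) / ?D powr (b / 2))"
      using D by (simp add: gaussian_pdf_def powr_half_sqrt[symmetric] powr_powr)
    finally have "\<bar>det L\<bar> * gauss m S (m + L *v y) powr b
        = b powr (- real CARD('n) / 2) * ((sqrt (det S) * sqrt (2 * pi) ^ CARD('n)) / ?D powr (b / 2)) * gaussian_pdf y"
      by (simp add: dL mult_ac)
    also have "sqrt (det S) * sqrt (2 * pi) ^ CARD('n) = ?D powr (1 / 2)"
      using D by (simp add: powr_half_sqrt real_sqrt_mult real_sqrt_power power_mult_distrib mult_ac)
    also have "?D powr (1 / 2) / ?D powr (b / 2) = ?D powr ((1 - b) / 2)"
      by (simp add: powr_diff[symmetric] diff_divide_distrib)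
    finally show "\<bar>det L\<bar> * gauss m S (m + L *v y) powr b = gauss_mass S b * gaussian_pdf y"
      by (simp add: gauss_mass_def)
  qed
qed

theorem gauss_powr_log_sobolev:
  fixes S :: "real^'n^'n" and m :: "real^'n"
  assumes S: "pos_def_matrix S" and b: "0 < b"
  defines "N \<equiv> density lborel (\<lambda>x. ennreal (gauss m S x powr b / gauss_mass S b))"
  shows "prob_space N" "log_sobolev_bounded N (2 * (lambda_max S / b))"
proof -
  obtain L :: "real^'n^'n" where L: "det L \<noteq> 0" "\<And>v. (norm (transpose L *v v))\<^sup>2 \<le> lambda_max S / b * (norm v)\<^sup>2"
    "\<And>y. \<bar>det L\<bar> * gauss m S (m + L *v y) powr b = gauss_mass S b * gaussian_pdf y"
    using gauss_powr_affine[OF S b, of m] by metis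
  let ?T = "\<lambda>y. m + L *v y"
  have T[measurable]: "?T \<in> borel_measurable borel"
    by (intro borel_measurable_continuous_onI continuous_intros)
  have T'[measurable]: "?T \<in> measurable gaussian_measure borel"
    unfolding measurable_cong_sets[OF sets_gaussian_measure refl] by (rule T)
  have [measurable]: "gauss m S \<in> borel_measurable borel"
    by (rule borel_measurable_continuous_onI[OF continuous_on_gauss])
  have pos: "0 < gauss_mass S b" by (rule gauss_mass_pos[OF S b])
  have N: "N = distr gaussian_measure borel ?T"
  proof (rule measure_eqI)
    fix X assume "X \<in> sets N"
    then have X[measurable]: "X \<in> sets borel" by (simp add: N_def)
    have "emeasure N X = (\<integral>\<^sup>+x. ennreal (gauss m S x powr b / gauss_mass S b) * indicator X x \<partial>lborel)"
      unfolding N_def by (rule emeasure_density) auto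
    also have "\<dots> = ennreal \<bar>det L\<bar> * (\<integral>\<^sup>+y. ennreal (gauss m S (?T y) powr b / gauss_mass S b) * indicator X (?T y) \<partial>lborel)"
      by (rule nn_integral_lborel_affine[OF L(1)]) measurable
    also have "\<dots> = (\<integral>\<^sup>+y. ennreal \<bar>det L\<bar> * (ennreal (gauss m S (?T y) powr b / gauss_mass S b) * indicator X (?T y)) \<partial>lborel)"
      by (rule nn_integral_cmult[symmetric]) measurable
    also have "\<dots> = (\<integral>\<^sup>+y. ennreal (gaussian_pdf y) * indicator X (?T y) \<partial>lborel)"
    proof (rule nn_integral_cong)
      fix y :: "real^'n"
      have "\<bar>det L\<bar> * (gauss m S (?T y) powr b / gauss_mass S b) = gaussian_pdf y"
        using L(3)[of y] pos by (simp add: field_simps)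
      then show "ennreal \<bar>det L\<bar> * (ennreal (gauss m S (?T y) powr b / gauss_mass S b) * indicator X (?T y))
          = ennreal (gaussian_pdf y) * indicator X (?T y)"
        by (simp add: mult.assoc[symmetric] ennreal_mult'[symmetric])
    qed
    also have "\<dots> = (\<integral>\<^sup>+y. indicator X (?T y) \<partial>gaussian_measure)"
      unfolding gaussian_measure_def by (rule nn_integral_density[symmetric]) measurable
    also have "\<dots> = (\<integral>\<^sup>+x. indicator X x \<partial>distr gaussian_measure borel ?T)"
      by (rule nn_integral_distr[symmetric]) measurable
    also have "\<dots> = emeasure (distr gaussian_measure borel ?T) X" by simp
    finally show "emeasure N X = emeasure (distr gaussian_measure borel ?T) X" .
  qed (simp add: N_def)
  show "prob_space N"
    unfolding N by (rule prob_space.prob_space_distr[OF prob_space_gaussian_measure T'])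
  show "log_sobolev_bounded N (2 * (lambda_max S / b))"
    unfolding N using L(2) lambda_max_nonneg[OF S] b
    by (intro log_sobolev_bounded_affine_image gaussian_log_sobolev_bounded) auto
qed

section \<open>Tempered Gaussian mixtures\<close>

lemma borel_measurable_gauss [measurable]: "gauss m S \<in> borel_measurable borel"
  by (rule borel_measurable_continuous_onI[OF continuous_on_gauss])

text \<open>The value is read off from the total mass 1 of the image of the standard
  Gaussian.\<close>

lemma has_bochner_integral_gauss_powr:
  fixes S :: "real^'n^'n" and m :: "real^'n"
  assumes S: "pos_def_matrix S" and b: "0 < b"
  shows "has_bochner_integral lborel (\<lambda>x. gauss m S x powr b) (gauss_mass S b)"
proof -
  let ?N = "density lborel (\<lambda>x. ennreal (gauss m S x powr b / gauss_mass S b))"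
  have pos: "0 < gauss_mass S b" by (rule gauss_mass_pos[OF S b])
  interpret prob_space ?N by (rule gauss_powr_log_sobolev(1)[OF S b])
  have "(\<integral>\<^sup>+x. ennreal (gauss m S x powr b / gauss_mass S b) \<partial>lborel) = ennreal 1"
    using emeasure_space_1 by (simp add: emeasure_density)
  then have "has_bochner_integral lborel (\<lambda>x. gauss m S x powr b / gauss_mass S b) 1"
    using pos by (intro has_bochner_integral_nn_integral) auto
  from has_bochner_integral_mult_left[OF this, of "gauss_mass S b"] show ?thesis
    using pos by simp
qed

lemma prob_space_law_normalize_fun:
  assumes "integrable lborel g" "\<And>x. 0 \<le> g x" "0 < (LINT x|lborel. g x)"
  shows "prob_space (law (normalize_fun g))"
proof
  have [measurable]: "g \<in> borel_measurable borel" using borel_measurable_integrable[OF assms(1)] by simp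
  let ?Z = "LINT x|lborel. g x"
  have "emeasure (law (normalize_fun g)) (space (law (normalize_fun g))) = (\<integral>\<^sup>+x. ennreal (g x / ?Z) \<partial>lborel)"
    by (simp add: law_def normalize_fun_def emeasure_density)
  also have "\<dots> = ennreal (LINT x|lborel. g x / ?Z)"
    using assms by (intro nn_integral_eq_integral) auto
  also have "\<dots> = 1" using assms(3) by simp
  finally show "emeasure (law (normalize_fun g)) (space (law (normalize_fun g))) = 1" .
qed

text \<open>The right side is the tangent at 1 of a concave function; it comes from convexity of
  \<open>exp\<close> between 0 and \<open>ln t\<close> with weights \<open>1 - b\<close> and
  \<open>b\<close>.\<close>

lemma powr_le_tangent:
  fixes t b :: real
  assumes "0 < t" "0 < b" "b \<le> 1"
  shows "t powr b \<le> b * t + (1 - b)"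
proof -
  have "exp ((1 - b) *\<^sub>R 0 + b *\<^sub>R ln t) \<le> (1 - b) * exp 0 + b * exp (ln t)"
    using assms by (intro convex_onD[OF exp_convex]) auto
  then show ?thesis using assms by (simp add: powr_def)
qed

locale tempered_mixture =
  fixes M :: nat and \<alpha> :: "nat \<Rightarrow> real" and m :: "nat \<Rightarrow> real^'n" and S :: "nat \<Rightarrow> real^'n^'n" and b :: real
  assumes \<alpha>_pos: "\<And>k. k \<in> {1..M} \<Longrightarrow> 0 < \<alpha> k" and \<alpha>_sum: "(\<Sum>k=1..M. \<alpha> k) = 1"
    and S_pos_def: "\<And>k. k \<in> {1..M} \<Longrightarrow> pos_def_matrix (S k)"
    and b: "0 < b" "b \<le> 1"
begin

abbreviation "\<alpha>min \<equiv> (MIN k\<in>{1..M}. \<alpha> k)"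
abbreviation "\<pi> x \<equiv> gauss_mix M \<alpha> m S x"
abbreviation "q k x \<equiv> gauss (m k) (S k) x"
abbreviation "tempered_sum x \<equiv> (\<Sum>j=1..M. \<alpha> j * q j x powr b)"
abbreviation "\<nu> k x \<equiv> comp_unnorm M \<alpha> m S b k x"
abbreviation "Z k \<equiv> LINT x|lborel. \<nu> k x"
abbreviation "K k \<equiv> gauss_mass (S k) b"

lemma components_nonempty: "{1..M} \<noteq> {}"
  using \<alpha>_sum by (intro notI) simp

lemma \<alpha>min: "0 < \<alpha>min" "k \<in> {1..M} \<Longrightarrow> \<alpha>min \<le> \<alpha> k" "k \<in> {1..M} \<Longrightarrow> \<alpha> k \<le> 1" "\<alpha>min \<le> 1"
proof -
  show "0 < \<alpha>min" using components_nonempty \<alpha>_pos by (subst Min_gr_iff) auto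
  show 1: "\<alpha>min \<le> \<alpha> k" if "k \<in> {1..M}" for k using that by simp
  show 2: "\<alpha> k \<le> 1" if "k \<in> {1..M}" for k
    using member_le_sum[of k "{1..M}" \<alpha>] that \<alpha>_pos \<alpha>_sum by (auto simp: less_imp_le)
  show "\<alpha>min \<le> 1" using components_nonempty 1 2 by (meson ex_in_conv order_trans)
qed

lemma q_pos: "k \<in> {1..M} \<Longrightarrow> 0 < q k x"
  by (rule gauss_pos[OF S_pos_def])

lemma \<pi>_pos: "0 < \<pi> x"
  unfolding gauss_mix_def using components_nonempty \<alpha>_pos q_pos by (intro sum_pos) auto

lemma tempered_sum_pos: "0 < tempered_sum x"
  using components_nonempty \<alpha>_pos q_pos by (intro sum_pos) (auto intro!: mult_pos_pos simp: less_imp_neq[symmetric])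

text \<open>Jensen's inequality in tangent form: division by \<open>\<pi> x\<close> places the mean
  of the numbers \<open>q j x / \<pi> x\<close> under the weights \<open>\<alpha> j\<close> at 1,
  the point of tangency.\<close>

lemma tempered_sum_le: "tempered_sum x \<le> \<pi> x powr b"
proof -
  have "tempered_sum x \<le> (\<Sum>j=1..M. \<alpha> j * (\<pi> x powr b * (b * (q j x / \<pi> x) + (1 - b))))"
  proof (rule sum_mono)
    fix j assume j: "j \<in> {1..M}"
    have "(q j x / \<pi> x) powr b \<le> b * (q j x / \<pi> x) + (1 - b)"
      using q_pos[OF j] \<pi>_pos b by (intro powr_le_tangent) auto
    then have "\<pi> x powr b * (q j x / \<pi> x) powr b \<le> \<pi> x powr b * (b * (q j x / \<pi> x) + (1 - b))"
      by (rule mult_left_mono) simp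
    moreover have "\<pi> x powr b * (q j x / \<pi> x) powr b = q j x powr b"
      using q_pos[OF j, of x] \<pi>_pos[of x] by (simp add: powr_mult[symmetric] less_imp_neq[symmetric])
    ultimately show "\<alpha> j * q j x powr b \<le> \<alpha> j * (\<pi> x powr b * (b * (q j x / \<pi> x) + (1 - b)))"
      using \<alpha>_pos[OF j] by (intro mult_left_mono) auto
  qed
  also have "\<dots> = \<pi> x powr b * b / \<pi> x * (\<Sum>j=1..M. \<alpha> j * q j x) + \<pi> x powr b * (1 - b) * (\<Sum>j=1..M. \<alpha> j)"
    unfolding sum_distrib_left sum.distrib[symmetric] by (intro sum.cong) (auto simp: algebra_simps)
  also have "\<dots> = \<pi> x powr b"
    unfolding gauss_mix_def[symmetric] \<alpha>_sum using \<pi>_pos[of x] by (simp add: algebra_simps)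
  finally show ?thesis .
qed

text \<open>The shares \<open>\<alpha> j * q j x / \<pi> x\<close> lie in \<open>[0, 1]\<close> and
  sum to 1, so a power \<open>b \<le> 1\<close> can only increase them. Then
  \<open>\<alpha> j powr b \<le> 1\<close> removes the inner weight and
  \<open>\<alpha>min \<le> \<alpha> j\<close> restores the outer one.\<close>

lemma tempered_sum_ge: "\<alpha>min * \<pi> x powr b \<le> tempered_sum x"
proof -
  have "\<alpha>min * \<pi> x powr b = (\<Sum>j=1..M. \<alpha>min * (\<pi> x powr b * (\<alpha> j * q j x / \<pi> x)))"
    using \<pi>_pos[of x] by (simp add: gauss_mix_def flip: sum_distrib_left sum_divide_distrib)
  also have "\<dots> \<le> tempered_sum x"
  proof (rule sum_mono)
    fix j assume j: "j \<in> {1..M}"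
    have a: "0 < \<alpha> j * q j x" using \<alpha>_pos[OF j] q_pos[OF j] by simp
    have "\<alpha> j * q j x \<le> \<pi> x"
      unfolding gauss_mix_def using j \<alpha>_pos q_pos
      by (intro member_le_sum[of j "{1..M}" "\<lambda>j. \<alpha> j * q j x"]) (auto intro!: mult_nonneg_nonneg less_imp_le)
    then have "\<alpha> j * q j x / \<pi> x \<le> (\<alpha> j * q j x / \<pi> x) powr b"
      using powr_mono'[of b 1 "\<alpha> j * q j x / \<pi> x"] a \<pi>_pos[of x] b by simp
    then have "\<pi> x powr b * (\<alpha> j * q j x / \<pi> x) \<le> \<pi> x powr b * (\<alpha> j * q j x / \<pi> x) powr b"
      by (rule mult_left_mono) simp
    also have "\<dots> = (\<alpha> j * q j x) powr b"
      using a \<pi>_pos[of x] by (simp add: powr_mult[symmetric] less_imp_neq[symmetric])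
    also have "\<dots> = \<alpha> j powr b * q j x powr b"
      using \<alpha>_pos[OF j] q_pos[OF j, of x] by (simp add: powr_mult)
    finally have "\<alpha>min * (\<pi> x powr b * (\<alpha> j * q j x / \<pi> x)) \<le> \<alpha>min * (\<alpha> j powr b * q j x powr b)"
      using \<alpha>min(1) by (intro mult_left_mono) auto
    also have "\<dots> \<le> \<alpha>min * (1 * q j x powr b)"
      using \<alpha>min(1) \<alpha>min(3)[OF j] \<alpha>_pos[OF j] b powr_le1[of b "\<alpha> j"]
      by (intro mult_left_mono mult_right_mono) auto
    also have "\<dots> \<le> \<alpha> j * q j x powr b"
      using \<alpha>min(2)[OF j] by (simp add: mult_right_mono)
    finally show "\<alpha>min * (\<pi> x powr b * (\<alpha> j * q j x / \<pi> x)) \<le> \<alpha> j * q j x powr b" .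
  qed
  finally show ?thesis .
qed

text \<open>This factor is the same for all \<open>k\<close>, so one pair of bounds serves every
  component, and summing the components restores \<open>\<pi> x powr b\<close>.\<close>

definition "\<rho> x = \<pi> x powr b / tempered_sum x"

lemma \<rho>_bounds: "1 \<le> \<rho> x" "\<rho> x \<le> 1 / \<alpha>min"
  using tempered_sum_le[of x] tempered_sum_ge[of x] tempered_sum_pos[of x] \<alpha>min(1)
  by (auto simp: \<rho>_def field_simps)

lemma \<nu>_eq: "\<nu> k x = \<rho> x * q k x powr b"
  by (simp add: comp_unnorm_def \<rho>_def)

lemma borel_measurable_\<rho> [measurable]: "\<rho> \<in> borel_measurable borel"
  unfolding \<rho>_def[abs_def] gauss_mix_def by measurable

lemma \<nu>_bounds: "q k x powr b \<le> \<nu> k x" "\<nu> k x \<le> 1 / \<alpha>min * q k x powr b"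
  using mult_right_mono[OF \<rho>_bounds(1)[of x], of "q k x powr b"] mult_right_mono[OF \<rho>_bounds(2)[of x], of "q k x powr b"]
  by (auto simp: \<nu>_eq)

lemma \<nu>_nonneg: "0 \<le> \<nu> k x"
  using \<nu>_bounds(1)[of k x] powr_ge_zero[of "q k x" b] by linarith

lemma \<pi>_powr_eq: "\<pi> x powr b = (\<Sum>k=1..M. \<alpha> k * \<nu> k x)"
proof -
  have "(\<Sum>k=1..M. \<alpha> k * \<nu> k x) = \<rho> x * tempered_sum x"
    by (simp add: \<nu>_eq sum_distrib_left mult_ac)
  then show ?thesis using tempered_sum_pos[of x] by (simp add: \<rho>_def)
qed

context
  fixes k assumes k: "k \<in> {1..M}"
begin

lemma K_pos: "0 < K k"
  by (rule gauss_mass_pos[OF S_pos_def[OF k] b(1)])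

lemma integrable_q_powr: "integrable lborel (\<lambda>x. q k x powr b)" and integral_q_powr: "(LINT x|lborel. q k x powr b) = K k"
  using has_bochner_integral_gauss_powr[OF S_pos_def[OF k] b(1), of "m k"] by (auto simp: has_bochner_integral_iff)

lemma integrable_\<nu>: "integrable lborel (\<lambda>x. \<nu> k x)"
proof (rule Bochner_Integration.integrable_bound)
  show "integrable lborel (\<lambda>x. 1 / \<alpha>min * q k x powr b)" using integrable_q_powr by simp
  show "AE x in lborel. norm (\<nu> k x) \<le> norm (1 / \<alpha>min * q k x powr b)"
    using \<nu>_bounds(2)[of k] \<nu>_nonneg[of k] \<alpha>min(1) by (intro AE_I2) (auto simp: abs_of_nonneg)
  show "(\<lambda>x. \<nu> k x) \<in> borel_measurable lborel" unfolding \<nu>_eq by measurable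
qed

lemma Z_bounds: "K k \<le> Z k" "Z k \<le> K k / \<alpha>min"
proof -
  show "K k \<le> Z k"
    unfolding integral_q_powr[symmetric] using \<nu>_bounds(1) integrable_q_powr integrable_\<nu> by (intro integral_mono) auto
  have "Z k \<le> (LINT x|lborel. 1 / \<alpha>min * q k x powr b)"
    using \<nu>_bounds(2) integrable_q_powr integrable_\<nu> by (intro integral_mono) auto
  then show "Z k \<le> K k / \<alpha>min" by (simp add: integral_q_powr)
qed

lemma Z_pos: "0 < Z k"
  using K_pos Z_bounds(1) by linarith

lemma prob_space_comp: "prob_space (law (comp_density M \<alpha> m S b k))"
  unfolding comp_density_def using integrable_\<nu> \<nu>_nonneg Z_pos by (rule prob_space_law_normalize_fun)

text \<open>Relative to the normalized Gaussian power the component has density \<open>?r\<close>,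
  with values between \<open>c\<close> and \<open>c / \<alpha>min\<close> for
  \<open>c = K k / Z k\<close>. Only the quotient of these bounds enters the constant, so the size
  of \<open>Z k\<close> is immaterial.\<close>

lemma log_sobolev_comp:
  shows "log_sobolev (law (comp_density M \<alpha> m S b k)) (C_LSI (law (comp_density M \<alpha> m S b k)))"
    and "C_LSI (law (comp_density M \<alpha> m S b k)) \<le> 2 * (1 / \<alpha>min * (lambda_max (S k) / b))"
proof -
  let ?N = "density lborel (\<lambda>x. ennreal (q k x powr b / K k))"
  let ?r = "\<lambda>x. \<rho> x * (K k / Z k)"
  have eq: "law (comp_density M \<alpha> m S b k) = density ?N (\<lambda>x. ennreal (?r x))"
  proof -
    have "density ?N (\<lambda>x. ennreal (?r x)) = density lborel (\<lambda>x. ennreal (q k x powr b / K k) * ennreal (?r x))"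
      by (rule density_density_eq) measurable
    also have "\<dots> = density lborel (\<lambda>x. ennreal (comp_density M \<alpha> m S b k x))"
    proof (rule density_cong)
      show "AE x in lborel. ennreal (q k x powr b / K k) * ennreal (?r x) = ennreal (comp_density M \<alpha> m S b k x)"
        using K_pos by (intro AE_I2) (auto simp: ennreal_mult'[symmetric] comp_density_def normalize_fun_def \<nu>_eq mult_ac)
      show "(\<lambda>x. ennreal (comp_density M \<alpha> m S b k x)) \<in> borel_measurable lborel"
        unfolding comp_density_def normalize_fun_def \<nu>_eq by measurable
    qed measurable
    finally show ?thesis by (simp add: law_def)
  qed
  note N = gauss_powr_log_sobolev[OF S_pos_def[OF k] b(1), of "m k"]
  have lam: "0 \<le> lambda_max (S k)" by (rule lambda_max_nonneg[OF S_pos_def[OF k]])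
  have C: "0 \<le> 1 / \<alpha>min * (2 * (lambda_max (S k) / b))" using lam b \<alpha>min(1) by simp
  have "log_sobolev_bounded (density ?N (\<lambda>x. ennreal (?r x))) (1 / \<alpha>min * (2 * (lambda_max (S k) / b)))"
  proof (rule log_sobolev_bounded_perturbation[OF N(2) _ N(1)])
    show "0 < K k / Z k" using K_pos Z_pos by simp
    show "K k / Z k \<le> ?r x" "?r x \<le> 1 / \<alpha>min * (K k / Z k)" for x
      using \<rho>_bounds[of x] mult_right_mono[of 1 "\<rho> x" "K k / Z k"] mult_right_mono[of "\<rho> x" "1 / \<alpha>min" "K k / Z k"] K_pos Z_pos by auto
  qed (use prob_space_comp lam b in \<open>auto simp: eq\<close>)
  then have "log_sobolev (law (comp_density M \<alpha> m S b k)) (1 / \<alpha>min * (2 * (lambda_max (S k) / b)))"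
    unfolding eq[symmetric] using prob_space_comp C by (intro log_sobolev_if_bounded) (auto simp: law_def)
  then show "log_sobolev (law (comp_density M \<alpha> m S b k)) (C_LSI (law (comp_density M \<alpha> m S b k)))"
    "C_LSI (law (comp_density M \<alpha> m S b k)) \<le> 2 * (1 / \<alpha>min * (lambda_max (S k) / b))"
    using log_sobolev_C_LSI[OF C] by (auto simp: mult_ac)
qed

end

lemma integrable_\<pi>_powr: "integrable lborel (\<lambda>x. \<pi> x powr b)"
  unfolding \<pi>_powr_eq using integrable_\<nu> by (intro Bochner_Integration.integrable_sum integrable_mult_right) auto

lemma integral_\<pi>_powr: "(LINT x|lborel. \<pi> x powr b) = (\<Sum>k=1..M. \<alpha> k * Z k)"
  unfolding \<pi>_powr_eq using integrable_\<nu> by (subst Bochner_Integration.integral_sum) auto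

lemma sum_\<alpha>_K_pos: "0 < (\<Sum>k=1..M. \<alpha> k * K k)"
  using components_nonempty \<alpha>_pos K_pos by (intro sum_pos) auto

lemma sum_\<alpha>_Z_bounds:
  "(\<Sum>k=1..M. \<alpha> k * K k) \<le> (\<Sum>k=1..M. \<alpha> k * Z k)"
  "(\<Sum>k=1..M. \<alpha> k * Z k) \<le> (\<Sum>k=1..M. \<alpha> k * K k) / \<alpha>min"
proof -
  show "(\<Sum>k=1..M. \<alpha> k * K k) \<le> (\<Sum>k=1..M. \<alpha> k * Z k)"
    using \<alpha>_pos Z_bounds(1) by (intro sum_mono mult_left_mono) (auto simp: less_imp_le)
  have "(\<Sum>k=1..M. \<alpha> k * Z k) \<le> (\<Sum>k=1..M. \<alpha> k * (K k / \<alpha>min))"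
    using \<alpha>_pos Z_bounds(2) by (intro sum_mono mult_left_mono) (auto simp: less_imp_le)
  then show "(\<Sum>k=1..M. \<alpha> k * Z k) \<le> (\<Sum>k=1..M. \<alpha> k * K k) / \<alpha>min"
    by (simp add: sum_divide_distrib)
qed

lemma sum_\<alpha>_Z_pos: "0 < (\<Sum>k=1..M. \<alpha> k * Z k)"
  using sum_\<alpha>_K_pos sum_\<alpha>_Z_bounds(1) by linarith

lemma prob_space_tempered: "prob_space (law (tempered M \<alpha> m S b))"
  unfolding tempered_def using integrable_\<pi>_powr sum_\<alpha>_Z_pos
  by (intro prob_space_law_normalize_fun) (auto simp: integral_\<pi>_powr)

lemma tempered_pos: "0 < tempered M \<alpha> m S b x"
  unfolding tempered_def normalize_fun_def integral_\<pi>_powr using \<pi>_pos sum_\<alpha>_Z_pos by (simp add: less_imp_neq[symmetric])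

lemma borel_measurable_tempered: "tempered M \<alpha> m S b \<in> borel_measurable borel"
  unfolding tempered_def normalize_fun_def gauss_mix_def by measurable

lemma comp_weight_nonneg: "k \<in> {1..M} \<Longrightarrow> 0 \<le> comp_weight M \<alpha> m S b k"
  unfolding comp_weight_def using \<alpha>_pos Z_pos sum_\<alpha>_Z_pos by (intro divide_nonneg_nonneg mult_nonneg_nonneg) (auto simp: less_imp_le)

lemma sum_comp_weight: "(\<Sum>k=1..M. comp_weight M \<alpha> m S b k) = 1"
  unfolding comp_weight_def using sum_\<alpha>_Z_pos by (simp flip: sum_divide_distrib)

lemma tempered_eq_mixture:
  "tempered M \<alpha> m S b x = (\<Sum>k=1..M. comp_weight M \<alpha> m S b k * comp_density M \<alpha> m S b k x)"
proof -
  have "tempered M \<alpha> m S b x = (\<Sum>k=1..M. \<alpha> k * \<nu> k x / (\<Sum>k=1..M. \<alpha> k * Z k))"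
    unfolding tempered_def normalize_fun_def integral_\<pi>_powr by (simp only: \<pi>_powr_eq sum_divide_distrib)
  also have "\<dots> = (\<Sum>k=1..M. comp_weight M \<alpha> m S b k * comp_density M \<alpha> m S b k x)"
    using Z_pos by (intro sum.cong) (auto simp: comp_weight_def comp_density_def normalize_fun_def less_imp_neq[symmetric])
  finally show ?thesis .
qed

text \<open>One factor \<open>\<alpha>min\<close> comes from the denominator, where
  \<open>Z j \<le> K j / \<alpha>min\<close>; the other from the prefactor
  \<open>\<alpha> k\<close>. The numerator uses \<open>K k \<le> Z k\<close> at no cost.\<close>

lemma comp_weight_ge:
  assumes k: "k \<in> {1..M}"
  shows "K k / (\<Sum>j=1..M. \<alpha> j * K j) * (MIN k\<in>{1..M}. (\<alpha> k)\<^sup>2) \<le> comp_weight M \<alpha> m S b k"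
proof -
  let ?s = "\<Sum>j=1..M. \<alpha> j * K j"
  \<comment> \<open>The minimum of the weights is attained, which bounds the minimum of the squares
    by the square of the minimum.\<close>
  have "\<alpha>min \<in> \<alpha> ` {1..M}" using components_nonempty by (intro Min_in) auto
  then obtain k0 where "k0 \<in> {1..M}" "\<alpha> k0 = \<alpha>min" by auto
  then have "(MIN k\<in>{1..M}. (\<alpha> k)\<^sup>2) \<le> \<alpha>min\<^sup>2" by (intro Min_le) (auto intro!: image_eqI[of _ _ k0])
  also have "\<dots> \<le> \<alpha> k * \<alpha>min"
    using \<alpha>min(1) \<alpha>min(2)[OF k] by (simp add: power2_eq_square mult_right_mono)
  finally have "K k / ?s * (MIN k\<in>{1..M}. (\<alpha> k)\<^sup>2) \<le> K k / ?s * (\<alpha> k * \<alpha>min)"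
    using K_pos[OF k] sum_\<alpha>_K_pos by (intro mult_left_mono) (auto simp: less_imp_le)
  also have "\<dots> = \<alpha> k * K k / (?s / \<alpha>min)" using \<alpha>min(1) by simp
  also have "\<dots> \<le> comp_weight M \<alpha> m S b k"
    unfolding comp_weight_def
    using sum_\<alpha>_Z_bounds(2) sum_\<alpha>_Z_pos Z_bounds(1)[OF k] K_pos[OF k] Z_pos[OF k] \<alpha>_pos[OF k]
    by (intro frac_le mult_left_mono mult_nonneg_nonneg) (auto simp: less_imp_le)
  finally show ?thesis .
qed

end

section \<open>Density ratios between two temperatures\<close>

lemma gauss_mass_ratio_le:
  fixes S :: "real^'n^'n"
  assumes S: "pos_def_matrix S" and b: "0 < b'" "b' \<le> b" and D: "det S \<le> D"
  shows "gauss_mass S b' \<le> (b / b') powr (real CARD('n) / 2) * ((2 * pi) ^ CARD('n) * D) powr ((b - b') / 2) * gauss_mass S b"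
proof -
  let ?c = "(2 * pi) ^ CARD('n) * det S"
  have c: "0 < ?c" using det_pos_def[OF S] by simp
  have "gauss_mass S b' = (b / b') powr (real CARD('n) / 2) * ?c powr ((b - b') / 2) * gauss_mass S b"
  proof -
    have "?c powr ((1 - b') / 2) = ?c powr ((b - b') / 2) * ?c powr ((1 - b) / 2)"
      by (simp add: powr_add[symmetric] diff_divide_distrib)
    moreover have "b' powr (- real CARD('n) / 2) = (b / b') powr (real CARD('n) / 2) * b powr (- real CARD('n) / 2)"
      using b by (simp add: powr_divide powr_minus field_simps)
    ultimately show ?thesis by (simp add: gauss_mass_def)
  qed
  also have "\<dots> \<le> (b / b') powr (real CARD('n) / 2) * ((2 * pi) ^ CARD('n) * D) powr ((b - b') / 2) * gauss_mass S b"
    using D b c gauss_mass_pos[OF S, of b]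
    by (intro mult_right_mono mult_left_mono powr_mono2) auto
  finally show ?thesis .
qed

lemma gauss_le:
  fixes S :: "real^'n^'n"
  assumes S: "pos_def_matrix S" and D: "0 < D" "D \<le> det S"
  shows "gauss m S x \<le> ((2 * pi) ^ CARD('n) * D) powr (- 1 / 2)"
proof -
  have "0 \<le> y \<bullet> (matrix_inv S *v y)" for y
  proof -
    have "S ** matrix_inv S = mat 1"
      using det_pos_def[OF S] matrix_inv_mult[of S] by (auto simp: invertible_det_nz)
    then have "S *v (matrix_inv S *v y) = y" by (simp add: matrix_vector_mul_assoc)
    \<comment> \<open>Writing \<open>y\<close> as \<open>S\<close> applied to
      \<open>matrix_inv S *v y\<close> carries positivity from \<open>S\<close> over to its
      inverse.\<close>
    then have "y \<bullet> (matrix_inv S *v y) = (matrix_inv S *v y) \<bullet> (S *v (matrix_inv S *v y))"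
      by (simp add: inner_commute)
    then show ?thesis using pos_def_matrixD(2)[OF S, of "matrix_inv S *v y"] by (cases "matrix_inv S *v y = 0") auto
  qed
  then have "gauss m S x \<le> 1 / sqrt ((2 * pi) ^ CARD('n) * det S)"
    unfolding gauss_def using det_pos_def[OF S] by (intro divide_right_mono) auto
  also have "\<dots> \<le> 1 / sqrt ((2 * pi) ^ CARD('n) * D)"
    using D by (intro frac_le) (auto intro!: mult_left_mono)
  also have "\<dots> = ((2 * pi) ^ CARD('n) * D) powr (- 1 / 2)"
    using D by (simp add: powr_half_sqrt[symmetric] powr_minus_divide)
  finally show ?thesis .
qed

text \<open>The quotient of the densities is \<open>\<pi> x powr (b - b')\<close> times a quotient
  of normalizers. The first factor is bounded by the highest Gaussian peak, which brings in the
  least determinant; the normalizers are compared through the masses \<open>K\<close>, whose ratio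
  brings in the greatest. Only the normalizer at \<open>b'\<close> is bounded from above, so
  \<open>1 / \<alpha>min\<close> enters once.\<close>

theorem tempered_ratio_le:
  fixes m :: "nat \<Rightarrow> real^'n"
  assumes "tempered_mixture M \<alpha> S b" "tempered_mixture M \<alpha> S b'" and bb: "b' \<le> b"
  shows "tempered M \<alpha> m S b x \<le> ratio_bound M \<alpha> S b b' * tempered M \<alpha> m S b' x"
proof -
  interpret B: tempered_mixture M \<alpha> m S b by fact
  interpret B': tempered_mixture M \<alpha> m S b' by fact
  let ?max = "MAX k\<in>{1..M}. det (S k)" and ?min = "MIN k\<in>{1..M}. det (S k)"
  let ?C = "(2 * pi) ^ CARD('n) :: real"
  let ?e = "(b - b') / 2" and ?r = "(b / b') powr (real CARD('n) / 2)"
  have min: "0 < ?min" "\<And>k. k \<in> {1..M} \<Longrightarrow> ?min \<le> det (S k)"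
    using B.components_nonempty det_pos_def[OF B.S_pos_def] by (auto simp: Min_gr_iff)
  have max: "\<And>k. k \<in> {1..M} \<Longrightarrow> det (S k) \<le> ?max" by simp
  then have max_pos: "0 < ?max"
    using min B.components_nonempty by (metis ex_in_conv less_le_trans)
  have le: "gauss_mix M \<alpha> m S x \<le> (?C * ?min) powr (- 1 / 2)"
  proof -
    have "gauss_mix M \<alpha> m S x \<le> (\<Sum>k=1..M. \<alpha> k * (?C * ?min) powr (- 1 / 2))"
      unfolding gauss_mix_def using B.\<alpha>_pos min gauss_le[OF B.S_pos_def]
      by (intro sum_mono mult_left_mono) (auto simp: less_imp_le)
    also have "\<dots> = (\<Sum>k=1..M. \<alpha> k) * (?C * ?min) powr (- 1 / 2)" by (rule sum_distrib_right[symmetric])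
    finally show ?thesis by (simp only: B.\<alpha>_sum mult_1_left)
  qed
  have "gauss_mix M \<alpha> m S x powr (b - b') \<le> ((?C * ?min) powr (- 1 / 2)) powr (b - b')"
    using bb le B.\<pi>_pos[of x] by (intro powr_mono2) auto
  also have "\<dots> = (?C * ?min) powr (- ?e)"
    by (simp add: powr_powr)
  finally have p: "gauss_mix M \<alpha> m S x powr (b - b') \<le> (?C * ?min) powr (- ?e)" .
  have "(\<Sum>k=1..M. \<alpha> k * B'.Z k) \<le> (\<Sum>k=1..M. \<alpha> k * B'.K k) / B.\<alpha>min"
    by (rule B'.sum_\<alpha>_Z_bounds(2))
  also have "\<dots> \<le> (\<Sum>k=1..M. \<alpha> k * (?r * (?C * ?max) powr ?e * B.K k)) / B.\<alpha>min"
    using B.\<alpha>_pos B.\<alpha>min(1) bb B'.b max gauss_mass_ratio_le[OF B.S_pos_def, of _ b' b ?max]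
    by (intro divide_right_mono sum_mono mult_left_mono) (auto simp: less_imp_le)
  also have "\<dots> = ?r * (?C * ?max) powr ?e / B.\<alpha>min * (\<Sum>k=1..M. \<alpha> k * B.K k)"
  proof -
    have "(\<Sum>k=1..M. \<alpha> k * (c * B.K k)) = c * (\<Sum>k=1..M. \<alpha> k * B.K k)" for c
      by (simp add: sum_distrib_left mult_ac)
    then show ?thesis by (simp only: times_divide_eq_left)
  qed
  also have "\<dots> \<le> ?r * (?C * ?max) powr ?e / B.\<alpha>min * (\<Sum>k=1..M. \<alpha> k * B.Z k)"
    using B.sum_\<alpha>_Z_bounds(1) B.\<alpha>min(1) by (intro mult_left_mono) auto
  finally have Z: "(\<Sum>k=1..M. \<alpha> k * B'.Z k) \<le> ?r * (?C * ?max) powr ?e / B.\<alpha>min * (\<Sum>k=1..M. \<alpha> k * B.Z k)" .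
  \<comment> \<open>The powers of \<open>2 * pi\<close> cancel between the peak bound and the ratio
    of masses.\<close>
  have rb: "ratio_bound M \<alpha> S b b' = (?C * ?min) powr (- ?e) * (?r * (?C * ?max) powr ?e / B.\<alpha>min)"
    using min(1) max_pos by (simp add: ratio_bound_def powr_mult powr_divide powr_minus field_simps)
  have "gauss_mix M \<alpha> m S x powr (b - b') * (\<Sum>k=1..M. \<alpha> k * B'.Z k)
      \<le> (?C * ?min) powr (- ?e) * (?r * (?C * ?max) powr ?e / B.\<alpha>min * (\<Sum>k=1..M. \<alpha> k * B.Z k))"
    using B'.sum_\<alpha>_Z_pos by (intro mult_mono p Z) (auto simp: less_imp_le)
  then have "gauss_mix M \<alpha> m S x powr (b - b') * (\<Sum>k=1..M. \<alpha> k * B'.Z k) \<le> ratio_bound M \<alpha> S b b' * (\<Sum>k=1..M. \<alpha> k * B.Z k)"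
    by (simp add: rb mult.assoc)
  then have "gauss_mix M \<alpha> m S x powr (b - b') / (\<Sum>k=1..M. \<alpha> k * B.Z k) \<le> ratio_bound M \<alpha> S b b' / (\<Sum>k=1..M. \<alpha> k * B'.Z k)"
    using B.sum_\<alpha>_Z_pos B'.sum_\<alpha>_Z_pos by (simp add: divide_le_eq le_divide_eq mult_ac)
  then have "gauss_mix M \<alpha> m S x powr b' * (gauss_mix M \<alpha> m S x powr (b - b') / (\<Sum>k=1..M. \<alpha> k * B.Z k))
      \<le> gauss_mix M \<alpha> m S x powr b' * (ratio_bound M \<alpha> S b b' / (\<Sum>k=1..M. \<alpha> k * B'.Z k))"
    by (rule mult_left_mono) simp
  then show ?thesis
    unfolding tempered_def normalize_fun_def B.integral_\<pi>_powr B'.integral_\<pi>_powr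
    by (simp add: powr_add[symmetric] mult_ac)
qed

text \<open>Positivity of the density of \<open>N'\<close> makes \<open>N\<close> the measure with
  the quotient as density relative to \<open>N'\<close>; uniqueness then identifies this quotient
  with \<open>RN_deriv\<close> almost everywhere.\<close>

corollary RN_deriv_tempered_le:
  fixes m :: "nat \<Rightarrow> real^'n"
  assumes "tempered_mixture M \<alpha> S b" "tempered_mixture M \<alpha> S b'" and bb: "b' \<le> b"
  defines "N \<equiv> law (tempered M \<alpha> m S b)" and "N' \<equiv> law (tempered M \<alpha> m S b')"
  shows "absolutely_continuous N' N" "AE x in N'. RN_deriv N' N x \<le> ennreal (ratio_bound M \<alpha> S b b')"
proof -
  interpret B: tempered_mixture M \<alpha> m S b by fact
  interpret B': tempered_mixture M \<alpha> m S b' by fact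
  let ?p = "tempered M \<alpha> m S b" and ?p' = "tempered M \<alpha> m S b'"
  note [measurable] = B.borel_measurable_tempered B'.borel_measurable_tempered
  interpret N': prob_space N' unfolding N'_def by (rule B'.prob_space_tempered)
  have [measurable]: "(\<lambda>x. ennreal (?p x / ?p' x)) \<in> borel_measurable N'"
    unfolding N'_def law_def by measurable
  have "density N' (\<lambda>x. ennreal (?p x / ?p' x)) = density lborel (\<lambda>x. ennreal (?p' x) * ennreal (?p x / ?p' x))"
    unfolding N'_def law_def by (rule density_density_eq) measurable
  also have "\<dots> = N"
    unfolding N_def law_def
  proof (intro density_cong AE_I2)
    fix x
    show "ennreal (?p' x) * ennreal (?p x / ?p' x) = ennreal (?p x)"
      using B'.tempered_pos[of x] by (simp add: ennreal_mult'[symmetric])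
  qed auto
  finally have eq: "density N' (\<lambda>x. ennreal (?p x / ?p' x)) = N" .
  show "absolutely_continuous N' N"
    unfolding eq[symmetric] by (rule absolutely_continuousI_density) measurable
  have "AE x in N'. ennreal (?p x / ?p' x) = RN_deriv N' N x"
    by (rule N'.RN_deriv_unique[OF _ eq]) measurable
  then show "AE x in N'. RN_deriv N' N x \<le> ennreal (ratio_bound M \<alpha> S b b')"
  proof eventually_elim
    case (elim x)
    have "?p x / ?p' x \<le> ratio_bound M \<alpha> S b b'"
      using tempered_ratio_le[OF assms(1-3), of m x] B'.tempered_pos[of x] by (simp add: pos_divide_le_eq)
    then show ?case unfolding elim[symmetric] by (rule ennreal_leI)
  qed
qed

theorem proposition9:
  fixes M n :: nat and \<alpha> \<beta> :: "nat \<Rightarrow> real"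
    and m :: "nat \<Rightarrow> real^'n" and S :: "nat \<Rightarrow> real^'n^'n"
  assumes "\<forall>k\<in>{1..M}. 0 < \<alpha> k" and "(\<Sum>k=1..M. \<alpha> k) = 1"
    and "\<forall>k\<in>{1..M}. pos_def_matrix (S k)"
    and "1 \<le> n" and "0 < \<beta> 1" and "strict_mono_on {1..n} \<beta>" and "\<beta> n = 1"
  shows
    "(\<forall>i\<in>{1..n}. prob_space (law (tempered M \<alpha> m S (\<beta> i))))
   \<and> (\<forall>i\<in>{2..n}.
        absolutely_continuous (law (tempered M \<alpha> m S (\<beta> (i - 1)))) (law (tempered M \<alpha> m S (\<beta> i)))
      \<and> (AE x in law (tempered M \<alpha> m S (\<beta> (i - 1))).
           RN_deriv (law (tempered M \<alpha> m S (\<beta> (i - 1)))) (law (tempered M \<alpha> m S (\<beta> i))) x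
             \<le> ennreal (ratio_bound M \<alpha> S (\<beta> i) (\<beta> (i - 1)))))
   \<and> (\<forall>i\<in>{1..n}.
        (\<forall>k\<in>{1..M}. prob_space (law (comp_density M \<alpha> m S (\<beta> i) k)) \<and> 0 \<le> comp_weight M \<alpha> m S (\<beta> i) k)
      \<and> (\<Sum>k=1..M. comp_weight M \<alpha> m S (\<beta> i) k) = 1
      \<and> (\<forall>x. tempered M \<alpha> m S (\<beta> i) x
              = (\<Sum>k=1..M. comp_weight M \<alpha> m S (\<beta> i) k * comp_density M \<alpha> m S (\<beta> i) k x))
      \<and> (\<forall>k\<in>{1..M}.
           log_sobolev (law (comp_density M \<alpha> m S (\<beta> i) k)) (C_LSI (law (comp_density M \<alpha> m S (\<beta> i) k)))
         \<and> C_LSI (law (comp_density M \<alpha> m S (\<beta> i) k))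
             \<le> 2 * (1 / (MIN j\<in>{1..M}. \<alpha> j) * (lambda_max (S k) / \<beta> i))))
   \<and> (MIN (i, k)\<in>{1..n} \<times> {1..M}. comp_weight M \<alpha> m S (\<beta> i) k)
       \<ge> (MIN (i, k)\<in>{1..n} \<times> {1..M}.
             (LINT x|lborel. gauss (m k) (S k) x powr \<beta> i)
               / (\<Sum>j=1..M. \<alpha> j * (LINT x|lborel. gauss (m j) (S j) x powr \<beta> i)))
          * (MIN k\<in>{1..M}. (\<alpha> k)\<^sup>2)
   \<and> ((\<forall>j\<in>{1..M}. \<forall>k\<in>{1..M}. S j = S k) \<longrightarrow>
        (MIN (i, k)\<in>{1..n} \<times> {1..M}. comp_weight M \<alpha> m S (\<beta> i) k)
          \<ge> (MIN k\<in>{1..M}. (\<alpha> k)\<^sup>2))"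
proof -
  have mix: "tempered_mixture M \<alpha> S (\<beta> i)" if i: "i \<in> {1..n}" for i
  proof
    have "\<beta> 1 \<le> \<beta> i" "\<beta> i \<le> \<beta> n"
      using strict_mono_on_imp_mono_on[OF assms(6)] i assms(4) by (auto simp: mono_on_def)
    then show "0 < \<beta> i" "\<beta> i \<le> 1" using assms(5,7) by auto
  qed (use assms in auto)
  have mass: "(LINT x|lborel. gauss (m k) (S k) x powr \<beta> i) = gauss_mass (S k) (\<beta> i)"
    if "i \<in> {1..n}" "k \<in> {1..M}" for i k
    using tempered_mixture.integral_q_powr[OF mix] that by blast
  let ?W = "\<lambda>(i, k). comp_weight M \<alpha> m S (\<beta> i) k"
  let ?V = "\<lambda>(i, k). (LINT x|lborel. gauss (m k) (S k) x powr \<beta> i)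
      / (\<Sum>j=1..M. \<alpha> j * (LINT x|lborel. gauss (m j) (S j) x powr \<beta> i))"
  let ?I = "{1..n} \<times> {1..M}"
  have M: "{1..M} \<noteq> {}" using tempered_mixture.components_nonempty[OF mix[of 1]] assms(4) by simp
  have I: "finite ?I" "?I \<noteq> {}" using M assms(4) by auto
  have a: "0 \<le> (MIN k\<in>{1..M}. (\<alpha> k)\<^sup>2)" using M by (intro Min.boundedI) auto
  have V: "?V z = gauss_mass (S (snd z)) (\<beta> (fst z)) / (\<Sum>j=1..M. \<alpha> j * gauss_mass (S j) (\<beta> (fst z)))"
    if "z \<in> ?I" for z
  proof -
    have "(\<Sum>j=1..M. \<alpha> j * (LINT x|lborel. gauss (m j) (S j) x powr \<beta> (fst z))) = (\<Sum>j=1..M. \<alpha> j * gauss_mass (S j) (\<beta> (fst z)))"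
      using that mass by (intro sum.cong) auto
    then show ?thesis using that mass[of "fst z" "snd z"] by (auto simp: case_prod_beta)
  qed
  have W: "?V z * (MIN k\<in>{1..M}. (\<alpha> k)\<^sup>2) \<le> ?W z" if "z \<in> ?I" for z
    using tempered_mixture.comp_weight_ge[OF mix, of "fst z" "snd z" m] that V[OF that] by (auto simp: case_prod_beta)
  have weights: "(MIN z\<in>?I. ?V z) * (MIN k\<in>{1..M}. (\<alpha> k)\<^sup>2) \<le> (MIN z\<in>?I. ?W z)"
  proof (rule Min.boundedI)
    fix w assume "w \<in> ?W ` ?I"
    then obtain z where z: "w = ?W z" "z \<in> ?I" by (rule imageE)
    have "(MIN z\<in>?I. ?V z) \<le> ?V z" using I z by (intro Min_le) auto
    then have "(MIN z\<in>?I. ?V z) * (MIN k\<in>{1..M}. (\<alpha> k)\<^sup>2) \<le> ?V z * (MIN k\<in>{1..M}. (\<alpha> k)\<^sup>2)"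
      using a by (rule mult_right_mono)
    then show "(MIN z\<in>?I. ?V z) * (MIN k\<in>{1..M}. (\<alpha> k)\<^sup>2) \<le> w" using W[OF z(2)] z(1) by linarith
  qed (use I in auto)
  have equal: "(MIN k\<in>{1..M}. (\<alpha> k)\<^sup>2) \<le> (MIN z\<in>?I. ?W z)" if eq: "\<forall>j\<in>{1..M}. \<forall>k\<in>{1..M}. S j = S k"
  proof (rule Min.boundedI)
    fix w assume "w \<in> ?W ` ?I"
    then obtain z where z: "w = ?W z" "z \<in> ?I" by (rule imageE)
    let ?K = "gauss_mass (S (snd z)) (\<beta> (fst z))"
    \<comment> \<open>Different means do no harm: \<open>gauss_mass\<close> sees only the
      covariance, so equal covariances and weights of sum 1 reduce the quotient \<open>?V z\<close>
      to 1.\<close>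
    have "(\<Sum>j=1..M. \<alpha> j * gauss_mass (S j) (\<beta> (fst z))) = (\<Sum>j=1..M. \<alpha> j * ?K)"
    proof (rule sum.cong[OF refl])
      fix j assume "j \<in> {1..M}"
      moreover have "snd z \<in> {1..M}" using z(2) by auto
      ultimately have "S j = S (snd z)" by (rule eq[rule_format])
      then show "\<alpha> j * gauss_mass (S j) (\<beta> (fst z)) = \<alpha> j * ?K" by simp
    qed
    also have "\<dots> = ?K" unfolding sum_distrib_right[symmetric] assms(2) by simp
    finally have "?V z = 1"
      using V[OF z(2)] tempered_mixture.K_pos[OF mix, of "fst z" "snd z"] z(2) by auto
    then show "(MIN k\<in>{1..M}. (\<alpha> k)\<^sup>2) \<le> w" using W[OF z(2)] z(1) by simp
  qed (use I in auto)
  have prev: "i \<in> {1..n}" "i - 1 \<in> {1..n}" "\<beta> (i - 1) \<le> \<beta> i" if "i \<in> {2..n}" for i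
  proof -
    show 1: "i \<in> {1..n}" "i - 1 \<in> {1..n}" using that by auto
    show "\<beta> (i - 1) \<le> \<beta> i"
      using strict_mono_onD[OF assms(6) 1(2) 1(1)] that by simp
  qed
  show ?thesis
  proof (intro conjI ballI impI allI)
    fix i k assume i: "i \<in> {1..n}" and k: "k \<in> {1..M}"
    interpret tempered_mixture M \<alpha> m S "\<beta> i" by (rule mix[OF i])
    show "prob_space (law (comp_density M \<alpha> m S (\<beta> i) k))" by (rule prob_space_comp[OF k])
    show "0 \<le> comp_weight M \<alpha> m S (\<beta> i) k" by (rule comp_weight_nonneg[OF k])
    show "log_sobolev (law (comp_density M \<alpha> m S (\<beta> i) k)) (C_LSI (law (comp_density M \<alpha> m S (\<beta> i) k)))"
      "C_LSI (law (comp_density M \<alpha> m S (\<beta> i) k)) \<le> 2 * (1 / (MIN j\<in>{1..M}. \<alpha> j) * (lambda_max (S k) / \<beta> i))"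
      by (rule log_sobolev_comp[OF k])+
  next
    fix i x assume i: "i \<in> {1..n}"
    show "prob_space (law (tempered M \<alpha> m S (\<beta> i)))" by (rule tempered_mixture.prob_space_tempered[OF mix[OF i]])
    show "(\<Sum>k=1..M. comp_weight M \<alpha> m S (\<beta> i) k) = 1" by (rule tempered_mixture.sum_comp_weight[OF mix[OF i]])
    show "tempered M \<alpha> m S (\<beta> i) x = (\<Sum>k=1..M. comp_weight M \<alpha> m S (\<beta> i) k * comp_density M \<alpha> m S (\<beta> i) k x)"
      by (rule tempered_mixture.tempered_eq_mixture[OF mix[OF i]])
  next
    fix i assume "i \<in> {2..n}"
    note ratio = RN_deriv_tempered_le[OF mix[OF prev(1)] mix[OF prev(2)] prev(3), OF this this this, of m]
    show "absolutely_continuous (law (tempered M \<alpha> m S (\<beta> (i - 1)))) (law (tempered M \<alpha> m S (\<beta> i)))"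
      by (rule ratio(1))
    show "AE x in law (tempered M \<alpha> m S (\<beta> (i - 1))).
        RN_deriv (law (tempered M \<alpha> m S (\<beta> (i - 1)))) (law (tempered M \<alpha> m S (\<beta> i))) x
          \<le> ennreal (ratio_bound M \<alpha> S (\<beta> i) (\<beta> (i - 1)))"
      by (rule ratio(2))
  qed (rule weights, rule equal)
qed

end
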